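(* Let $\pi$ be a Poisson bivector field on $\mathbb{R}^d$ and let $\Omega$ be a constant volume form on $\mathbb{R}^d$ such that ${\rm div}_\Omega\,\pi=0$. Let $*$ be the Kontsevich star-product constructed from $\pi$ (with the harmonic angle function). Then $*$ is cyclic, i.e. $$\int_{\mathbb{R}^d}(f*g)\cdot h\cdot\Omega=\int_{\mathbb{R}^d}(g*h)\cdot f\cdot\Omega$$ for any three functions $f,g,h\in C^\infty(\mathbb{R}^d)$ with compact support (an equality of formal power series in the deformation parameter $\hbar$).
   Context: **Divergence.** For a volume form $\Omega$ on $\mathbb{R}^d$, contraction with $\Omega$ identifies $k$-vector fields with $(d-k)$-forms, and ${\rm div}_\Omega$ (from $k$-vector fields to $(k-1)$-vector fields) is the de Rham differential under this identification. **Kontsevich star-product.** $$f*g=fg+\sum_{n\ge1}\frac{\hbar^n}{n!}\,\mathcal{U}_n(\pi,\dots,\pi)(f\otimes g),$$ where the $\mathcal{U}_n$ are the Taylor components of Kontsevich's formality morphism with the harmonic angle function $$\varphi^h(z,w)=\frac{1}{2i}\log\left(\frac{(z-w)(z-\overline w)}{(\overline z-w)(\overline z-\overline w)}\right),$$ defined as follows. An admissible graph $\Gamma$ has vertex set $\{1,\dots,n\}\sqcup\{\bar1,\dots,\bar m\}$ (first and second type), with oriented edge set $E_\Gamma\subset V_\Gamma\times V_\Gamma$; every edge starts at a vertex of the first type; there are no loops $(v,v)$; and for each $k\in\{1,\dots,n\}$ the set ${\rm Star}(k)$ of edges starting at $k$ is labelled (ordered) as $e_k^1,\dots,e_k^{\#{\rm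 Star}(k)}$. Operator $\mathcal{U}_\Gamma$: for polyvector fields $\gamma_i$ on $\mathbb{R}^d$, $\mathcal{U}_\Gamma(\gamma_1\otimes\dots\otimes\gamma_n)=0$ unless each $\gamma_i$ is a $\#{\rm Star}(i)$-vector field, and then $$\mathcal{U}_\Gamma(\gamma_1\otimes\dots\otimes\gamma_n)(f_1\otimes\dots\otimes f_m)=\sum_{I:E_\Gamma\to\{1,\dots,d\}}\ \prod_{v\in V_\Gamma}\Big(\prod_{e=( *,v)\in E_\Gamma}\partial_{I(e)}\Big)\psi_v,$$ where $\psi_{\bar j}=f_j$ and $\psi_i=\langle\gamma_i,dx^{I(e_i^1)}\otimes\dots\otimes dx^{I(e_i^{\#{\rm Star}(i)})}\rangle$, with $\xi_1\wedge\dots\wedge\xi_k$ identified with $\sum_{\sigma}{\rm sgn}(\sigma)\,\xi_{\sigma(1)}\otimes\dots\otimes\xi_{\sigma(k)}$. Weight: let $\mathcal{H}$ be the open upper half-plane and $C_{n,m}^+$ the quotient of the space of $(p_1,\dots,p_n;q_1,\dots,q_m)$ with $p_i\in\mathcal{H}$ pairwise distinct and $q_1<\dots<q_m$ in $\mathbb{R}$, by the group $\{z\mapsto az+b: a>0,\ b\in\mathbb{R}\}$; it has dimension $2n+m-2$ and carries the quotient of the product orientation (the group is oriented via its free transitive action on $\mathcal{H}$). For $\Gamma$ with $2n+m-2$ edges, $$W_\Gamma=\prod_{k=1}^n\frac{1}{(\#{\rm Star}(k))!}\cdot\frac{1}{(2\pi)^{2n+m-2}}\int_{C^+_{n,m}}\bigwedge_{e\in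 E_\Gamma}d\varphi_e,$$ where, for $e=(v_1,v_2)$, $\varphi_e=\varphi^h(z,w)$ with $z,w$ the points corresponding to $v_1,v_2$ (the point $p_i$ for vertex $i$, $q_j$ for $\bar j$), and the wedge product is taken in lexicographic order of the edges $e_k^l$. Then $\mathcal{U}_n=\sum_{m\ge0}\sum_{\Gamma}W_\Gamma\,\mathcal{U}_\Gamma$, the sum over all admissible graphs with $n$ vertices of the first type, $m$ of the second type and $2n+m-2$ edges. (For a bivector field $\pi$, only $m=2$ contributes to $\mathcal{U}_n(\pi,\dots,\pi)$.) *)

theory Defs
  imports "HOL-Analysis.Analysis"
begin

section \<open>Smooth functions and tensor fields on Euclidean space\<close>

text \<open>The index type \<open>'d\<close> plays the role of \<open>{1,\<dots>,d}\<close>; its linear order fixes the standard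
  order of the coordinates.\<close>

definition partial :: "'d::finite \<Rightarrow> (real^'d \<Rightarrow> real) \<Rightarrow> real^'d \<Rightarrow> real" where
  "partial i f x = deriv (\<lambda>t. f (x + t *\<^sub>R axis i 1)) 0"

abbreviation partials :: "'d::finite list \<Rightarrow> (real^'d \<Rightarrow> real) \<Rightarrow> real^'d \<Rightarrow> real" where
  "partials is f \<equiv> foldr partial is f"

definition smooth :: "(real^'d::finite \<Rightarrow> real) \<Rightarrow> bool" where
  "smooth f \<longleftrightarrow> (\<forall>is x. partials is f differentiable (at x))"

definition compactly_supported :: "(real^'d::finite \<Rightarrow> real) \<Rightarrow> bool" where
  "compactly_supported f \<longleftrightarrow> compact (closure {x. f x \<noteq> 0})"

text \<open>
  Multivector fields and differential forms are given by their components. A \<open>k\<close>-vector field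
  \<open>\<gamma>\<close> is the skew tensor field with
  \<open>\<gamma> x [i\<^sub>1,\<dots>,i\<^sub>k] = \<langle>\<gamma>, dx\<^sup>i\<^sup>1 \<otimes> \<dots> \<otimes> dx\<^sup>i\<^sup>k\<rangle>(x)\<close>, where \<open>\<xi>\<^sub>1 \<and> \<dots> \<and> \<xi>\<^sub>k\<close> is identified with
  \<open>\<Sum>\<sigma>. sgn \<sigma> \<xi>\<^bsub>\<sigma> 1\<^esub> \<otimes> \<dots> \<otimes> \<xi>\<^bsub>\<sigma> k\<^esub>\<close> (no factor \<open>1/k!\<close>); a \<open>k\<close>-form \<open>\<omega>\<close> has
  \<open>\<omega> x [i\<^sub>1,\<dots>,i\<^sub>k] = \<omega>\<^sub>x(\<partial>\<^bsub>i1\<^esub>,\<dots>,\<partial>\<^bsub>ik\<^esub>)\<close>. Components at lists of the wrong length are \<open>0\<close>, so that a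
  field is determined by its components.\<close>

type_synonym 'd tensor_field = "real^'d \<Rightarrow> 'd list \<Rightarrow> real"

definition alternating :: "nat \<Rightarrow> ('i list \<Rightarrow> real) \<Rightarrow> bool" where
  "alternating k T \<longleftrightarrow>
     (\<forall>I. length I \<noteq> k \<longrightarrow> T I = 0) \<and>
     (\<forall>I \<sigma>. length I = k \<longrightarrow> \<sigma> permutes {..<k} \<longrightarrow>
        T (permute_list \<sigma> I) = of_int (sign \<sigma>) * T I)"

definition skew_field :: "nat \<Rightarrow> ('d::finite) tensor_field \<Rightarrow> bool" where
  "skew_field k T \<longleftrightarrow> (\<forall>x. alternating k (T x)) \<and> (\<forall>I. smooth (\<lambda>x. T x I))"

abbreviation "multivector_field \<equiv> skew_field"
abbreviation "differential_form \<equiv> skew_field"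

definition wedge_covectors :: "('i \<Rightarrow> real) list \<Rightarrow> 'i list \<Rightarrow> real" where
  "wedge_covectors \<alpha>s J =
     (if length J = length \<alpha>s
      then \<Sum>\<sigma> | \<sigma> permutes {..<length \<alpha>s}.
             of_int (sign \<sigma>) * (\<Prod>l<length \<alpha>s. (\<alpha>s ! l) (J ! \<sigma> l))
      else 0)"

definition exterior_derivative :: "('d::finite) tensor_field \<Rightarrow> 'd tensor_field" where
  "exterior_derivative \<omega> x J =
     (\<Sum>i<length J. (-1) ^ i * partial (J ! i) (\<lambda>y. \<omega> y (take i J @ drop (Suc i) J)) x)"

definition volume_form :: "('d::finite) tensor_field \<Rightarrow> bool" where
  "volume_form \<Omega> \<longleftrightarrow> differential_form CARD('d) \<Omega> \<and> (\<forall>x. \<exists>I. \<Omega> x I \<noteq> 0)"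

definition constant_form :: "('d::finite) tensor_field \<Rightarrow> bool" where
  "constant_form \<Omega> \<longleftrightarrow> (\<forall>x y. \<Omega> x = \<Omega> y)"

definition contraction :: "nat \<Rightarrow> ('d::finite) tensor_field \<Rightarrow> 'd tensor_field \<Rightarrow> 'd tensor_field" where
  "contraction k \<Omega> \<gamma> x J = (\<Sum>I | length I = k. \<gamma> x I * \<Omega> x (I @ J)) / fact k"

text \<open>The divergence of a \<open>k\<close>-vector field, \<open>k \<ge> 1\<close>. For a volume form \<open>\<Omega>\<close>, contraction with \<open>\<Omega>\<close>
  is a bijection onto forms, so the description is unique.\<close>

definition divergence :: "nat \<Rightarrow> ('d::finite) tensor_field \<Rightarrow> 'd tensor_field \<Rightarrow> 'd tensor_field" where
  "divergence k \<Omega> \<gamma> =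
     (THE \<delta>. multivector_field (k - 1) \<delta> \<and>
             contraction (k - 1) \<Omega> \<delta> = exterior_derivative (contraction k \<Omega> \<gamma>))"

definition integral_top_form :: "('d::{finite,linorder}) tensor_field \<Rightarrow> real" where
  "integral_top_form \<omega> = (LINT x|lborel. \<omega> x (sorted_list_of_set UNIV))"

definition poisson_bracket ::
    "('d::finite) tensor_field \<Rightarrow> (real^'d \<Rightarrow> real) \<Rightarrow> (real^'d \<Rightarrow> real) \<Rightarrow> real^'d \<Rightarrow> real" where
  "poisson_bracket \<pi> f g x = (\<Sum>i\<in>UNIV. \<Sum>j\<in>UNIV. \<pi> x [i, j] * partial i f x * partial j g x)"

definition poisson_bivector :: "('d::finite) tensor_field \<Rightarrow> bool" where
  "poisson_bivector \<pi> \<longleftrightarrow> multivector_field 2 \<pi> \<and>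
     (\<forall>f g h. smooth f \<longrightarrow> smooth g \<longrightarrow> smooth h \<longrightarrow>
        (\<forall>x. poisson_bracket \<pi> (poisson_bracket \<pi> f g) h x
           + poisson_bracket \<pi> (poisson_bracket \<pi> g h) f x
           + poisson_bracket \<pi> (poisson_bracket \<pi> h f) g x = 0))"


section \<open>Admissible graphs\<close>

text \<open>Vertices, edge labels and coordinates are numbered from \<open>0\<close>. A graph with \<open>n\<close> vertices of
  the first type is the list of its \<open>n\<close> labelled stars: \<open>\<Gamma> ! k ! l\<close> is the target of the edge that
  starts at \<open>k\<close> and has label \<open>l\<close>. Distinctness of each star expresses that the edges form a set of
  pairs of vertices.\<close>

datatype vertex = FirstType nat | SecondType nat

type_synonym graph = "vertex list list"

definition vertices :: "nat \<Rightarrow> nat \<Rightarrow> vertex set" where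
  "vertices n m = FirstType ` {..<n} \<union> SecondType ` {..<m}"

definition edges :: "graph \<Rightarrow> (nat \<times> nat) list" where
  "edges \<Gamma> = [(k, l). k \<leftarrow> [0..<length \<Gamma>], l \<leftarrow> [0..<length (\<Gamma> ! k)]]"

definition target :: "graph \<Rightarrow> nat \<times> nat \<Rightarrow> vertex" where
  "target \<Gamma> e = \<Gamma> ! fst e ! snd e"

definition admissible_graphs :: "nat \<Rightarrow> nat \<Rightarrow> graph set" where
  "admissible_graphs n m =
     {\<Gamma>. length \<Gamma> = n \<and>
         (\<forall>k<n. distinct (\<Gamma> ! k) \<and> set (\<Gamma> ! k) \<subseteq> vertices n m - {FirstType k})}"

definition incoming :: "graph \<Rightarrow> vertex \<Rightarrow> (nat \<times> nat) list" where
  "incoming \<Gamma> v = filter (\<lambda>e. target \<Gamma> e = v) (edges \<Gamma>)"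

definition graph_operator ::
    "graph \<Rightarrow> ('d::finite) tensor_field list \<Rightarrow> (real^'d \<Rightarrow> real) list \<Rightarrow> real^'d \<Rightarrow> real" where
  "graph_operator \<Gamma> \<gamma>s fs x =
     (if \<forall>i<length \<Gamma>. multivector_field (length (\<Gamma> ! i)) (\<gamma>s ! i)
      then \<Sum>I \<in> PiE (set (edges \<Gamma>)) (\<lambda>_. UNIV).
             (\<Prod>i<length \<Gamma>. partials (map I (incoming \<Gamma> (FirstType i)))
                (\<lambda>y. (\<gamma>s ! i) y (map (\<lambda>l. I (i, l)) [0..<length (\<Gamma> ! i)])) x) *
             (\<Prod>j<length fs. partials (map I (incoming \<Gamma> (SecondType j))) (fs ! j) x)
      else 0)"


section \<open>The harmonic angle function\<close>

definition angle_ratio :: "complex \<Rightarrow> complex \<Rightarrow> complex" where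
  "angle_ratio z w = ((z - w) * (z - cnj w)) / ((cnj z - w) * (cnj z - cnj w))"

definition harmonic_angle :: "complex \<Rightarrow> complex \<Rightarrow> complex" where
  "harmonic_angle z w = 1 / (2 * \<i>) * Ln (angle_ratio z w)"

text \<open>The harmonic angle depends on the choice of a branch of the logarithm, but its differential does
  not. For a path \<open>(z(t), w(t))\<close> we take the branch that vanishes at the point in question, so that no
  branch cut is met; since \<open>angle_ratio z w\<close> has modulus \<open>1\<close>, the derivative is real.\<close>

definition angle_velocity :: "(real \<Rightarrow> complex) \<Rightarrow> (real \<Rightarrow> complex) \<Rightarrow> real \<Rightarrow> real" where
  "angle_velocity z w t =
     Re (vector_derivative
           (\<lambda>s. 1 / (2 * \<i>) * Ln (angle_ratio (z s) (w s) / angle_ratio (z t) (w t))) (at t))"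


lemma angle_velocity_eq_harmonic_angle:
  assumes "((\<lambda>s. angle_ratio (z s) (w s)) has_vector_derivative r) (at t)"
    and "angle_ratio (z t) (w t) \<notin> \<real>\<^sub>\<le>\<^sub>0"
  shows "angle_velocity z w t = Re (vector_derivative (\<lambda>s. harmonic_angle (z s) (w s)) (at t))"
proof -
  let ?\<rho> = "\<lambda>s. angle_ratio (z s) (w s)"
  have nz: "?\<rho> t \<noteq> 0" using assms(2) by auto
  have 1: "((\<lambda>s. 1 / (2 * \<i>) * Ln (?\<rho> s)) has_vector_derivative 1 / (2 * \<i>) * (r * (1 / ?\<rho> t))) (at t)"
    using field_vector_diff_chain_at[OF assms(1), of Ln "1 / ?\<rho> t"]
      has_field_derivative_Ln[OF assms(2)]
    by (intro has_vector_derivative_mult_right) (simp add: o_def inverse_eq_divide)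
  have "((\<lambda>s. ?\<rho> s / ?\<rho> t) has_vector_derivative r / ?\<rho> t) (at t)"
    using has_vector_derivative_mult_left[OF assms(1), of "1 / ?\<rho> t"] by simp
  then have "((\<lambda>s. Ln (?\<rho> s / ?\<rho> t)) has_vector_derivative r / ?\<rho> t * 1) (at t)"
    using field_vector_diff_chain_at[of "\<lambda>s. ?\<rho> s / ?\<rho> t" "r / ?\<rho> t" t Ln 1]
      has_field_derivative_Ln[of 1] nz
    by (simp add: o_def)
  then have 2: "((\<lambda>s. 1 / (2 * \<i>) * Ln (?\<rho> s / ?\<rho> t)) has_vector_derivative
                  1 / (2 * \<i>) * (r / ?\<rho> t * 1)) (at t)"
    by (rule has_vector_derivative_mult_right)
  show ?thesis
    unfolding angle_velocity_def harmonic_angle_def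
    using vector_derivative_at[OF 1] vector_derivative_at[OF 2] by simp
qed


section \<open>Configuration spaces\<close>

text \<open>A configuration \<open>(p\<^sub>0,\<dots>,p\<^bsub>n-1\<^esub>;q\<^sub>0,\<dots>,q\<^bsub>m-1\<^esub>)\<close> is given by its \<open>2n+m\<close> real coordinates
  \<open>Re p\<^sub>0, Im p\<^sub>0, Re p\<^sub>1, Im p\<^sub>1, \<dots>, q\<^sub>0, \<dots>, q\<^bsub>m-1\<^esub>\<close>, in the order of the product orientation.\<close>

definition position :: "nat \<Rightarrow> (nat \<Rightarrow> real) \<Rightarrow> vertex \<Rightarrow> complex" where
  "position n x v = (case v of FirstType i \<Rightarrow> Complex (x (2 * i)) (x (2 * i + 1))
                             | SecondType j \<Rightarrow> of_real (x (2 * n + j)))"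

definition configurations :: "nat \<Rightarrow> nat \<Rightarrow> (nat \<Rightarrow> real) set" where
  "configurations n m =
     {x. (\<forall>i<n. Im (position n x (FirstType i)) > 0) \<and>
         inj_on (\<lambda>i. position n x (FirstType i)) {..<n} \<and>
         (\<forall>j k. j < k \<longrightarrow> k < m \<longrightarrow> x (2 * n + j) < x (2 * n + k))}"

text \<open>The action of \<open>z \<mapsto> a z + b\<close>.\<close>

definition affine_action :: "nat \<Rightarrow> real \<Rightarrow> real \<Rightarrow> (nat \<Rightarrow> real) \<Rightarrow> nat \<Rightarrow> real" where
  "affine_action n a b x i = a * x i + (if i < 2 * n \<and> odd i then 0 else b)"

text \<open>
  The quotient of \<open>configurations n m\<close> by the affine group has, for \<open>n \<ge> 1\<close>, a global chart: every
  orbit contains exactly one configuration with \<open>p\<^sub>0 = \<i>\<close>, and the remaining coordinates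
  \<open>x\<^sub>2,\<dots>,x\<^bsub>2n+m-1\<^esub>\<close> of that configuration are coordinates on the quotient. The lemmas below check that
  this is a section and that it is positively oriented. The integral over the quotient of (the form
  induced by) a form \<open>\<omega>\<close> on the configuration space is the integral of \<open>\<omega>\<close> restricted to this
  section.\<close>

definition gauge_fix :: "(nat \<Rightarrow> real) \<Rightarrow> nat \<Rightarrow> real" where
  "gauge_fix y = y(0 := 0, 1 := 1)"

definition quotient_integral :: "nat \<Rightarrow> nat \<Rightarrow> ((nat \<Rightarrow> real) \<Rightarrow> nat list \<Rightarrow> real) \<Rightarrow> real" where
  "quotient_integral n m \<omega> =
     (LINT y | PiM {2..<2 * n + m} (\<lambda>_. lborel).
        indicator (configurations n m) (gauge_fix y) * \<omega> (gauge_fix y) [2..<2 * n + m])"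

lemma position_affine_action:
  assumes "v \<in> vertices n m"
  shows "position n (affine_action n a b x) v = of_real a * position n x v + of_real b"
  using assms by (auto simp: vertices_def position_def affine_action_def complex_eq_iff)

lemma affine_action_configurations:
  assumes "x \<in> configurations n m" "a > 0"
  shows "affine_action n a b x \<in> configurations n m"
proof -
  have *: "position n (affine_action n a b x) (FirstType i)
             = of_real a * position n x (FirstType i) + of_real b" if "i < n" for i
    using position_affine_action[of "FirstType i" n m] that by (simp add: vertices_def)
  show ?thesis
    using assms unfolding configurations_def
    by (auto simp: * inj_on_def affine_action_def)
qed

lemma orbit_meets_section_once:
  assumes "x \<in> configurations n m" "n \<ge> 1"
  shows "\<exists>!(a, b). a > 0 \<and> position n (affine_action n a b x) (FirstType 0) = \<i>"
proof -
  have pos: "x 1 > 0" using assms by (auto simp: configurations_def position_def)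
  have *: "position n (affine_action n a b x) (FirstType 0) = \<i> \<longleftrightarrow> a = 1 / x 1 \<and> b = - x 0 / x 1"
    for a b
  proof -
    have "position n (affine_action n a b x) (FirstType 0) = \<i> \<longleftrightarrow> a * x 1 = 1 \<and> a * x 0 + b = 0"
      using assms(2) by (auto simp: position_def affine_action_def complex_eq_iff)
    also have "a * x 1 = 1 \<longleftrightarrow> a = 1 / x 1"
      using pos by (simp add: field_simps)
    also have "a = 1 / x 1 \<and> a * x 0 + b = 0 \<longleftrightarrow> a = 1 / x 1 \<and> b = - x 0 / x 1"
      by (auto simp: add_eq_0_iff)
    finally show ?thesis .
  qed
  show ?thesis using pos by (auto simp: *)
qed

text \<open>The group is oriented by \<open>(a, b) \<mapsto> a \<i> + b\<close>, so its positive frame is \<open>(\<partial>\<^sub>b, \<partial>\<^sub>a)\<close>. At a point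
  of the section, the fundamental vector fields of \<open>\<partial>\<^sub>b\<close> and \<open>\<partial>\<^sub>a\<close> together with the coordinate frame
  of the section form a positive frame for the product orientation.\<close>

lemma section_positively_oriented:
  assumes "x 0 = 0" "x 1 = 1" "n \<ge> 1"
  defines "X \<equiv> \<lambda>j i. if j = 0 then deriv (\<lambda>b. affine_action n 1 b x i) 0
                     else if j = 1 then deriv (\<lambda>a. affine_action n a 0 x i) 1
                     else of_bool (i = j)"
  shows "wedge_covectors (map (\<lambda>i j. X j i) [0..<2 * n + m]) [0..<2 * n + m] > 0"
proof -
  define N where "N = 2 * n + m"
  have d0: "deriv (\<lambda>b. affine_action n 1 b x i) 0 = (if i < 2 * n \<and> odd i then 0 else 1)" for i
    unfolding affine_action_def by (rule DERIV_imp_deriv) (auto intro!: derivative_eq_intros)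
  have d1: "deriv (\<lambda>a. affine_action n a 0 x i) 1 = x i" for i
    unfolding affine_action_def by (rule DERIV_imp_deriv) (auto intro!: derivative_eq_intros)
  have diag: "X i i = 1" for i
    using assms by (auto simp: X_def d0 d1)
  have upper: "X j i = 0" if "i < j" for i j
    using that assms by (auto simp: X_def d1)
  have zero: "(\<Prod>l<N. X (\<sigma> l) l) = 0" if \<sigma>: "\<sigma> permutes {..<N}" "\<sigma> \<noteq> id" for \<sigma>
  proof -
    obtain l where "l < N" "l < \<sigma> l"
      using permutes_natset_le[OF \<sigma>(1)] \<sigma>(2) by (metis lessThan_iff not_le)
    then show ?thesis using upper by auto
  qed
  have "wedge_covectors (map (\<lambda>i j. X j i) [0..<N]) [0..<N]
      = (\<Sum>\<sigma> | \<sigma> permutes {..<N}. of_int (sign \<sigma>) * (\<Prod>l<N. X (\<sigma> l) l))"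
    unfolding wedge_covectors_def
    by (auto intro!: sum.cong prod.cong simp: permutes_in_image)
       (metis lessThan_iff nth_upt permutes_in_image add_0)
  also have "\<dots> = (\<Sum>\<sigma> \<in> {id}. of_int (sign \<sigma>) * (\<Prod>l<N. X (\<sigma> l) l))"
    using zero by (intro sum.mono_neutral_right) (auto simp: permutes_id finite_permutations)
  also have "\<dots> = 1" by (simp add: diag)
  finally show ?thesis by (simp add: N_def)
qed


section \<open>Weights and the star product\<close>

definition angle_form :: "nat \<Rightarrow> graph \<Rightarrow> (nat \<Rightarrow> real) \<Rightarrow> nat \<times> nat \<Rightarrow> nat \<Rightarrow> real" where
  "angle_form n \<Gamma> x e j =
     angle_velocity (\<lambda>s. position n (x(j := s)) (FirstType (fst e)))
                    (\<lambda>s. position n (x(j := s)) (target \<Gamma> e)) (x j)"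

definition weight :: "nat \<Rightarrow> nat \<Rightarrow> graph \<Rightarrow> real" where
  "weight n m \<Gamma> =
     (\<Prod>k<n. 1 / fact (length (\<Gamma> ! k))) * (1 / (2 * pi) ^ (2 * n + m - 2)) *
     quotient_integral n m (\<lambda>x. wedge_covectors (map (angle_form n \<Gamma> x) (edges \<Gamma>)))"

text \<open>The component of \<open>\<U>\<^sub>n\<close> with \<open>m\<close> arguments acts on lists of \<open>m\<close> functions.\<close>

definition formality_component ::
    "nat \<Rightarrow> ('d::finite) tensor_field list \<Rightarrow> (real^'d \<Rightarrow> real) list \<Rightarrow> real^'d \<Rightarrow> real" where
  "formality_component n \<gamma>s fs x =
     (\<Sum>\<Gamma> | \<Gamma> \<in> admissible_graphs n (length fs) \<and> length (edges \<Gamma>) + 2 = 2 * n + length fs.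
        weight n (length fs) \<Gamma> * graph_operator \<Gamma> \<gamma>s fs x)"

text \<open>Formal power series in \<open>\<hbar>\<close> with functions as coefficients are written pointwise.\<close>

definition kontsevich_star ::
    "('d::finite) tensor_field \<Rightarrow> (real^'d \<Rightarrow> real) \<Rightarrow> (real^'d \<Rightarrow> real) \<Rightarrow> real^'d \<Rightarrow> real fps" where
  "kontsevich_star \<pi> f g x =
     fps_const (f x * g x) +
     Abs_fps (\<lambda>n. if n = 0 then 0 else formality_component n (replicate n \<pi>) [f, g] x / fact n)"

definition integral_against ::
    "(real^('d::{finite,linorder}) \<Rightarrow> real fps) \<Rightarrow> 'd tensor_field \<Rightarrow> real fps" where
  "integral_against F \<Omega> = Abs_fps (\<lambda>n. integral_top_form (\<lambda>x I. fps_nth (F x) n * \<Omega> x I))"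

end

theory Submission
  imports Defs "Jordan_Normal_Form.Determinant"
begin

text \<open>
  Place the three functions on the boundary circle \<open>\<real> \<union> {\<infinity>}\<close> of the upper half-plane: the two arguments of the
  star product at the real points \<open>q\<^sub>0 < q\<^sub>1\<close> and the third function at \<open>\<infinity>\<close>. The coefficient of \<open>\<hbar>\<^sup>n\<close> of
  \<open>\<integral> (f * g) h \<Omega>\<close> is then, up to a constant, the sum of \<open>w(\<tau>) B(\<tau>)\<close> over all maps \<open>\<tau>\<close> that assign to each of the
  \<open>2n\<close> edges a target among the \<open>n\<close> vertices of the first type and the three functions
  (\<open>integral_formality_component\<close>). Here \<open>w(\<tau>)\<close> is the integral of the product of the angle forms over
  configurations, and \<open>B(\<tau>)\<close> is the integral over \<open>\<real>\<^sup>d\<close> of a product of derivatives of the components of \<open>\<pi>\<close> and of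
  the three functions. Edges towards \<open>\<infinity>\<close> have angle form \<open>0\<close>.

  Two facts about \<open>B\<close> are used. The sum of \<open>B(\<tau>)\<close> over all targets of one edge, with the other targets fixed, is the
  integral of a derivative and vanishes (\<open>sum_targets\<close>). If \<open>\<tau>\<close> has a loop, then \<open>B(\<tau>) = 0\<close> because \<open>\<pi>\<close> is
  divergence-free (\<open>graph_integral_loop\<close>, \<open>divergence_zero_imp\<close>). By the first fact, the sum does not change when the
  angle form \<open>d\<phi>(z, w)\<close> of each edge is replaced by \<open>d\<phi>(z, w) - d\<phi>(z, q\<^sub>0)\<close>, since the subtracted term does not
  depend on the target \<open>w\<close> (\<open>sum_shifted_row\<close>). Now let \<open>R\<close> be the rotation of the half-plane that sends \<open>q\<^sub>0\<close> to \<open>\<infinity>\<close>.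
  Because \<open>d\<phi>(R z, R w) = d\<phi>(z, w) - d\<phi>(z, q\<^sub>0)\<close> (\<open>angle_row_rotated\<close>), the new weights are the weights of the rotated
  configuration, in which \<open>f\<close> sits at \<open>\<infinity>\<close> and \<open>g\<close>, \<open>h\<close> sit at the two real points
  (\<open>configuration_integral_rotation\<close>). The sum has become the one for \<open>\<integral> (g * h) f \<Omega>\<close>.

  The replacement of the angle forms uses the linearity of the integral, and hence the absolute convergence of all
  integrals involved. An angle form is the sum of two differentials of arguments of affine functions of the
  coordinates, namely \<open>z - w\<close> and \<open>z - cnj w\<close>. A product of \<open>N\<close> such differentials in \<open>N\<close> variables is the pullback of the
  volume form of a torus under a map whose fibres are given by linear equations, so that the integral of its
  absolute value is at most \<open>\<pi>\<^sup>N\<close> (\<open>nn_integral_wedge_d_arg\<close>).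
\<close>

section \<open>Determinants of lists of covectors\<close>

lemma wedge_covectors_det:
  assumes "length js = length \<alpha>s"
  shows "wedge_covectors \<alpha>s js = det (mat (length \<alpha>s) (length \<alpha>s) (\<lambda>(i, j). (\<alpha>s ! i) (js ! j)))"
proof -
  let ?N = "length \<alpha>s"
  have "(\<Prod>i<?N. (\<alpha>s ! i) (js ! \<sigma> i))
      = (\<Prod>i = 0..<?N. mat ?N ?N (\<lambda>(i, j). (\<alpha>s ! i) (js ! j)) $$ (i, \<sigma> i))"
    if "\<sigma> permutes {..<?N}" for \<sigma>
  proof -
    have "\<sigma> i < ?N" if "i < ?N" for i
      using permutes_in_image[OF \<open>\<sigma> permutes _\<close>, of i] that by simp
    then show ?thesis by (simp add: atLeast0LessThan)
  qed
  then show ?thesis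
    unfolding wedge_covectors_def det_def using assms
    by (auto intro!: sum.cong simp: atLeast0LessThan)
qed

lemma wedge_covectors_linear:
  "wedge_covectors (\<alpha>s @ (\<lambda>i. a * \<beta> i + b * \<gamma> i) # \<alpha>s') js
     = a * wedge_covectors (\<alpha>s @ \<beta> # \<alpha>s') js + b * wedge_covectors (\<alpha>s @ \<gamma> # \<alpha>s') js"
proof (cases "length js = length \<alpha>s + Suc (length \<alpha>s')")
  case True
  let ?k = "length \<alpha>s" and ?N = "length \<alpha>s + Suc (length \<alpha>s')"
  let ?P = "\<lambda>\<beta> \<sigma>. \<Prod>l<?N. ((\<alpha>s @ \<beta> # \<alpha>s') ! l) (js ! \<sigma> l)"
  have split: "?P \<beta> \<sigma> = \<beta> (js ! \<sigma> ?k) * (\<Prod>l\<in>{..<?N} - {?k}. ((\<alpha>s @ \<gamma> # \<alpha>s') ! l) (js ! \<sigma> l))"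
    for \<beta> \<gamma> :: "'a \<Rightarrow> real" and \<sigma>
  proof -
    have "?P \<beta> \<sigma> = \<beta> (js ! \<sigma> ?k) * (\<Prod>l\<in>{..<?N} - {?k}. ((\<alpha>s @ \<beta> # \<alpha>s') ! l) (js ! \<sigma> l))"
      by (subst prod.remove[of _ ?k]) auto
    also have "(\<Prod>l\<in>{..<?N} - {?k}. ((\<alpha>s @ \<beta> # \<alpha>s') ! l) (js ! \<sigma> l))
             = (\<Prod>l\<in>{..<?N} - {?k}. ((\<alpha>s @ \<gamma> # \<alpha>s') ! l) (js ! \<sigma> l))"
      by (intro prod.cong) (auto simp: nth_append nth_Cons')
    finally show ?thesis .
  qed
  have "?P (\<lambda>i. a * \<beta> i + b * \<gamma> i) \<sigma> = a * ?P \<beta> \<sigma> + b * ?P \<gamma> \<sigma>" for \<sigma>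
    unfolding split[where \<gamma> = \<gamma>] by (simp add: algebra_simps)
  then show ?thesis
    unfolding wedge_covectors_def using True
    by (simp add: sum_distrib_left sum.distrib algebra_simps)
next
  case False
  then show ?thesis by (simp add: wedge_covectors_def)
qed

lemma wedge_covectors_zero: "(\<lambda>_. 0) \<in> set \<alpha>s \<Longrightarrow> wedge_covectors \<alpha>s js = 0"
  using wedge_covectors_linear[of _ 0 "\<lambda>_. 0" 0 "\<lambda>_. 0"] by (auto dest!: split_list)

lemma wedge_covectors_repeated:
  assumes "i < length \<alpha>s" "j < length \<alpha>s" "i \<noteq> j" "\<alpha>s ! i = \<alpha>s ! j"
  shows "wedge_covectors \<alpha>s js = 0"
proof (cases "length js = length \<alpha>s")
  case True
  show ?thesis unfolding wedge_covectors_det[OF True]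
    by (rule det_identical_rows[OF _ assms(3) assms(1,2)]) (use assms in \<open>auto intro!: eq_vecI\<close>)
qed (simp add: wedge_covectors_def)

lemma wedge_covectors_cong:
  assumes "length \<alpha>s = length \<beta>s"
    and "\<And>l j. l < length \<beta>s \<Longrightarrow> j \<in> set js \<Longrightarrow> (\<alpha>s ! l) j = (\<beta>s ! l) j"
  shows "wedge_covectors \<alpha>s js = wedge_covectors \<beta>s js"
proof (cases "length js = length \<alpha>s")
  case True
  then show ?thesis using assms
    by (subst (1 2) wedge_covectors_det) (auto intro!: arg_cong[of _ _ det] cong_mat)
qed (use assms in \<open>simp add: wedge_covectors_def\<close>)

text \<open>The chain rule for a change of coordinates with Jacobian matrix \<open>J\<close>.\<close>

lemma wedge_covectors_chain:
  assumes "distinct js" "length js = length \<alpha>s"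
  shows "wedge_covectors (map (\<lambda>\<alpha> j. \<Sum>i\<in>set js. \<alpha> i * J i j) \<alpha>s) js
       = wedge_covectors \<alpha>s js * det (mat (length js) (length js) (\<lambda>(i, j). J (js ! i) (js ! j)))"
proof -
  let ?N = "length \<alpha>s"
  let ?A = "mat ?N ?N (\<lambda>(i, j). (\<alpha>s ! i) (js ! j))" and ?B = "mat ?N ?N (\<lambda>(i, j). J (js ! i) (js ! j))"
  have "(\<Sum>i\<in>set js. \<alpha> i * J i j) = (\<Sum>k<?N. \<alpha> (js ! k) * J (js ! k) j)" for \<alpha> j
    using sum.reindex_bij_betw[OF bij_betw_nth[OF assms(1) refl refl], of "\<lambda>i. \<alpha> i * J i j"] assms(2)
    by simp
  then have "mat ?N ?N (\<lambda>(i, j). (map (\<lambda>\<alpha> j. \<Sum>i\<in>set js. \<alpha> i * J i j) \<alpha>s ! i) (js ! j)) = ?A * ?B"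
    by (intro eq_matI) (auto simp: scalar_prod_def atLeast0LessThan)
  then show ?thesis
    using assms(2) by (simp add: wedge_covectors_det det_mult[of _ ?N])
qed

text \<open>Elimination of the coordinate \<open>j\<close> with the help of \<open>\<alpha>\<close>: the new covectors are the restrictions of the old ones to
  the kernel of \<open>\<alpha>\<close>, on which \<open>dx\<^sub>j = - \<Sum>\<^sub>k \<alpha>\<^sub>k/\<alpha>\<^sub>j dx\<^sub>k\<close>.\<close>

lemma wedge_covectors_Schur:
  assumes "\<alpha> j \<noteq> 0" "length js = length \<alpha>s"
  shows "wedge_covectors (\<alpha> # \<alpha>s) (j # js)
       = \<alpha> j * wedge_covectors (map (\<lambda>\<beta> k. \<beta> k - \<beta> j / \<alpha> j * \<alpha> k) \<alpha>s) js"
proof -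
  let ?N = "length \<alpha>s"
  define A where "A = mat (Suc ?N) (Suc ?N) (\<lambda>(i, l). ((\<alpha> # \<alpha>s) ! i) ((j # js) ! l))"
  define U where "U = four_block_mat (1\<^sub>m 1) (mat 1 ?N (\<lambda>(i, l). - \<alpha> (js ! l) / \<alpha> j)) (0\<^sub>m ?N 1) (1\<^sub>m ?N)"
  define C where "C = mat ?N ?N (\<lambda>(i, l). (\<alpha>s ! i) (js ! l) - (\<alpha>s ! i) j / \<alpha> j * \<alpha> (js ! l))"
  have U: "U \<in> carrier_mat (Suc ?N) (Suc ?N)" and A: "A \<in> carrier_mat (Suc ?N) (Suc ?N)"
    by (auto simp: U_def A_def)
  have "A = four_block_mat (mat 1 1 (\<lambda>_. \<alpha> j)) (mat 1 ?N (\<lambda>(i, l). \<alpha> (js ! l)))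
              (mat ?N 1 (\<lambda>(i, l). (\<alpha>s ! i) j)) (mat ?N ?N (\<lambda>(i, l). (\<alpha>s ! i) (js ! l)))"
    by (intro eq_matI) (auto simp: A_def nth_Cons')
  then have "A * U = four_block_mat (mat 1 1 (\<lambda>_. \<alpha> j)) (0\<^sub>m 1 ?N) (mat ?N 1 (\<lambda>(i, l). (\<alpha>s ! i) j)) C"
    unfolding U_def
    apply (simp only:)
    apply (subst mult_four_block_mat[where ?nr1.0 = 1 and ?n1.0 = 1 and ?n2.0 = ?N and ?nr2.0 = ?N and ?nc1.0 = 1 and ?nc2.0 = ?N])
    apply (use assms in \<open>auto intro!: cong_four_block_mat eq_matI simp: C_def scalar_prod_def\<close>)
    done
  moreover have "det U = 1"
    unfolding U_def by (subst det_four_block_mat_lower_left_zero) auto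
  moreover have "det (four_block_mat (mat 1 1 (\<lambda>_. \<alpha> j)) (0\<^sub>m 1 ?N) (mat ?N 1 (\<lambda>(i, l). (\<alpha>s ! i) j)) C) = \<alpha> j * det C"
    by (subst det_four_block_mat_upper_right_zero) (auto simp: C_def det_single)
  ultimately have "det A = \<alpha> j * det C" using det_mult[OF A U] by simp
  then show ?thesis using assms by (simp add: wedge_covectors_det A_def C_def)
       (auto intro!: arg_cong[of _ _ det] cong_mat)
qed

lemma abs_wedge_covectors_reorder:
  assumes "mset js = mset js'"
  shows "\<bar>wedge_covectors \<alpha>s js\<bar> = \<bar>wedge_covectors \<alpha>s js'\<bar>"
proof (cases "length js = length \<alpha>s")
  case len: True
  let ?N = "length \<alpha>s" 
  have len': "length js' = ?N" using assms len mset_eq_length by metis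
  obtain p where p: "p permutes {..<?N}" "permute_list p js' = js"
    using assms mset_eq_permutation len' by metis
  let ?A = "mat ?N ?N (\<lambda>(i, j). (\<alpha>s ! j) (js' ! i))"
  have "wedge_covectors \<alpha>s js = det (mat ?N ?N (\<lambda>(i, j). (\<alpha>s ! j) (js ! i)))"
    unfolding wedge_covectors_det[OF len]
    by (subst det_transpose[symmetric, where n = ?N]) (auto intro!: arg_cong[of _ _ det] eq_matI)
  also have "mat ?N ?N (\<lambda>(i, j). (\<alpha>s ! j) (js ! i)) = mat ?N ?N (\<lambda>(i, j). ?A $$ (p i, j))"
    using permutes_in_image[OF p(1)] permute_list_nth[of p js'] p len'
    by (intro eq_matI) auto
  also have "det \<dots> = of_int (sign p) * det ?A"
    using p(1) by (intro det_permute_rows) (auto simp: atLeast0LessThan)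
  also have "det ?A = wedge_covectors \<alpha>s js'"
    unfolding wedge_covectors_det[OF len']
    by (subst det_transpose[symmetric, where n = ?N]) (auto intro!: arg_cong[of _ _ det] eq_matI)
  finally show ?thesis by (auto simp: abs_mult sign_def)
next
  case False
  moreover have "length js' = length js" using assms mset_eq_length by metis
  ultimately show ?thesis by (simp add: wedge_covectors_def)
qed

lemma borel_measurable_wedge_covectors:
  assumes "\<And>l j. l < length \<alpha>s \<Longrightarrow> j \<in> set js \<Longrightarrow> (\<lambda>x. (\<alpha>s ! l) x j) \<in> borel_measurable M"
  shows "(\<lambda>x. wedge_covectors (map (\<lambda>\<alpha>. \<alpha> x) \<alpha>s) js) \<in> borel_measurable M"
proof (cases "length js = length \<alpha>s")
  case True
  have "(\<lambda>x. (\<alpha>s ! l) x (js ! \<sigma> l)) \<in> borel_measurable M"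
    if "\<sigma> permutes {..<length \<alpha>s}" "l < length \<alpha>s" for \<sigma> l
    using assms[OF that(2)] permutes_in_image[OF that(1), of l] that(2) True by auto
  then show ?thesis unfolding wedge_covectors_def
    by (auto simp: True intro!: borel_measurable_sum borel_measurable_times borel_measurable_prod)
qed (simp add: wedge_covectors_def)

section \<open>Integrability of products of differentials of arguments\<close>

abbreviation lborel_on :: "nat set \<Rightarrow> (nat \<Rightarrow> real) measure" where
  "lborel_on I \<equiv> PiM I (\<lambda>_. lborel)"

interpretation lborel_PiM: product_sigma_finite "\<lambda>_::nat. lborel :: real measure" ..

text \<open>The length of the circle of directions \<open>\<real> \<cdot> (s + \<i>)\<close>, which are taken modulo sign.\<close>

lemma nn_integral_inverse_1_plus_square: "(\<integral>\<^sup>+s. ennreal (1 / (1 + s\<^sup>2)) \<partial>lborel) = ennreal pi"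
proof -
  let ?f = "\<lambda>s::real. ennreal (1 / (1 + s\<^sup>2))"
  have half: "(\<integral>\<^sup>+s. ?f s * indicator {0..} s \<partial>lborel) = ennreal (pi / 2 - arctan 0)"
  proof (rule nn_integral_FTC_atLeast)
    show "(arctan has_real_derivative 1 / (1 + x\<^sup>2)) (at x)" for x
      using DERIV_arctan[of x] by (simp add: inverse_eq_divide)
  qed (auto intro: tendsto_arctan_at_top)
  have "(\<integral>\<^sup>+s. ?f s \<partial>lborel) = (\<integral>\<^sup>+s. ?f s * indicator {0..} s + ?f s * indicator {..0} s \<partial>lborel)"
    by (intro nn_integral_cong_AE eventually_mono[OF AE_lborel_singleton[of 0]])
       (auto split: split_indicator)
  also have "\<dots> = (\<integral>\<^sup>+s. ?f s * indicator {0..} s \<partial>lborel) + (\<integral>\<^sup>+s. ?f s * indicator {..0} s \<partial>lborel)"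
    by (rule nn_integral_add) auto
  also have "(\<integral>\<^sup>+s. ?f s * indicator {..0} s \<partial>lborel) = (\<integral>\<^sup>+s. ?f s * indicator {0..} s \<partial>lborel)"
    by (subst nn_integral_real_affine[where c = "-1" and t = 0])
       (auto intro!: nn_integral_cong split: split_indicator)
  finally show ?thesis unfolding half by (simp flip: ennreal_plus)
qed

text \<open>Constant term and coefficients; the set of coordinates is kept separate, because the elimination below
  removes coordinates from it.\<close>

type_synonym complex_affine = "complex \<times> (nat \<Rightarrow> complex)"

definition affine_value :: "nat set \<Rightarrow> complex_affine \<Rightarrow> (nat \<Rightarrow> real) \<Rightarrow> complex" where
  "affine_value I \<zeta> x = fst \<zeta> + (\<Sum>i\<in>I. snd \<zeta> i * of_real (x i))"

text \<open>The components of the differential of \<open>arg \<zeta>\<close>, as \<open>d(arg \<zeta>) = Im (d\<zeta>/\<zeta>)\<close>.\<close>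

definition d_arg :: "nat set \<Rightarrow> complex_affine \<Rightarrow> (nat \<Rightarrow> real) \<Rightarrow> nat \<Rightarrow> real" where
  "d_arg I \<zeta> x i = Im (snd \<zeta> i / affine_value I \<zeta> x)"

lemma borel_measurable_affine_value [measurable]:
  "affine_value I \<zeta> \<in> borel_measurable (lborel_on I)"
  unfolding affine_value_def by measurable

lemma borel_measurable_d_arg [measurable]:
  "(\<lambda>x. d_arg I \<zeta> x i) \<in> borel_measurable (lborel_on I)"
  unfolding d_arg_def by measurable

lemma AE_affine_nonzero:
  fixes c :: real and I :: "nat set"
  assumes "finite I" "j \<in> I" "b j \<noteq> 0"
  shows "AE y in lborel_on I. c + (\<Sum>i\<in>I. b i * y i) \<noteq> 0"
proof -
  obtain K where K: "I = insert j K" "j \<notin> K" "finite K"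
    using assms by (metis mk_disjoint_insert finite_insert)
  let ?L = "\<lambda>y. c + (\<Sum>i\<in>I. b i * y i)"
  have meas [measurable]: "?L \<in> borel_measurable (lborel_on I)" by measurable
  have upd: "?L (y(j := t)) = (c + (\<Sum>i\<in>K. b i * y i)) + b j * t" for y t
  proof -
    have "(\<Sum>i\<in>K. b i * (y(j := t)) i) = (\<Sum>i\<in>K. b i * y i)" using K(2) by (intro sum.cong) auto
    then show ?thesis using K by simp
  qed
  have "(\<integral>\<^sup>+y. indicator {0} (?L y) \<partial>lborel_on I)
      = (\<integral>\<^sup>+y. (\<integral>\<^sup>+t. indicator {0} (?L (y(j := t))) \<partial>lborel) \<partial>lborel_on K)"
    unfolding K(1) by (rule lborel_PiM.product_nn_integral_insert[OF K(3,2)]) measurable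
  also have "\<dots> = (\<integral>\<^sup>+y. (\<integral>\<^sup>+t. 0 \<partial>(lborel :: real measure)) \<partial>lborel_on K)"
  proof (rule nn_integral_cong)
    fix y
    have "AE t in lborel. ?L (y(j := t)) \<noteq> 0"
      using AE_lborel_singleton[of "- (c + (\<Sum>i\<in>K. b i * y i)) / b j"]
      by eventually_elim (use assms in \<open>auto simp: upd field_simps simp del: fun_upd_apply\<close>)
    then show "(\<integral>\<^sup>+t. indicator {0} (?L (y(j := t))) \<partial>lborel) = (\<integral>\<^sup>+t. 0 \<partial>(lborel :: real measure))"
      by (intro nn_integral_cong_AE) (auto simp: indicator_def)
  qed
  finally have "AE y in lborel_on I. indicator {0} (?L y) = (0::ennreal)"
    by (subst nn_integral_0_iff_AE[symmetric]) auto
  then show ?thesis by (auto simp: indicator_eq_0_iff)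
qed

text \<open>Restriction to a level set of \<open>arg \<zeta>\<close>. With \<open>a\<close> the coefficient of \<open>x\<^sub>j\<close> in \<open>\<zeta>\<close>, the equation
  \<open>\<zeta> \<in> \<real> \<cdot> a (s + \<i>)\<close> is solved by \<open>x\<^sub>j = v s - u\<close>, where \<open>u + \<i> v = \<zeta>/a - x\<^sub>j\<close>; substituting this
  into another affine function gives an affine function of the remaining coordinates.\<close>

definition restrict_level :: "nat \<Rightarrow> complex_affine \<Rightarrow> real \<Rightarrow> complex_affine \<Rightarrow> complex_affine" where
  "restrict_level j \<zeta> s \<xi> =
     (let r = (\<lambda>w. of_real (Im (w / snd \<zeta> j) * s - Re (w / snd \<zeta> j)))
      in (fst \<xi> + snd \<xi> j * r (fst \<zeta>), \<lambda>i. snd \<xi> i + snd \<xi> j * r (snd \<zeta> i)))"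

text \<open>On the level set \<open>\<zeta> \<in> \<real> \<cdot> a (s + \<i>)\<close> the differential of the argument of any \<open>\<xi>\<close> restricts to the
  differential of the argument of the restricted affine function. The value at \<open>j\<close> is the density of
  \<open>d(arg \<zeta>)\<close> with respect to \<open>ds\<close>, divided by the slope \<open>v\<close> of \<open>x\<^sub>j = v s - u\<close>.\<close>

lemma level_set_Schur:
  fixes \<zeta> :: complex_affine and I :: "nat set" and y :: "nat \<Rightarrow> real" and s :: real
  assumes "finite I" "j \<notin> I" and a: "snd \<zeta> j \<noteq> 0"
  defines "w \<equiv> affine_value I \<zeta> y / snd \<zeta> j"
  defines "x \<equiv> y(j := Im w * s - Re w)"
  assumes v: "Im w \<noteq> 0"
  shows "d_arg (insert j I) \<zeta> x j = - 1 / (Im w * (1 + s\<^sup>2))"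
    and "d_arg (insert j I) \<xi> x k - d_arg (insert j I) \<xi> x j / d_arg (insert j I) \<zeta> x j * d_arg (insert j I) \<zeta> x k
           = d_arg I (restrict_level j \<zeta> s \<xi>) y k"
proof -
  let ?a = "snd \<zeta> j" and ?z = "Complex s 1"
  have s: "1 + s\<^sup>2 \<noteq> 0" by (metis add_le_same_cancel1 not_one_le_zero sum_power2_ge_zero one_power2 power_zero_numeral zero_le_power2 le_add_same_cancel1)
  have val: "affine_value (insert j I) \<xi> x = affine_value I \<xi> y + snd \<xi> j * of_real (Im w * s - Re w)" for \<xi>
  proof -
    have "(\<Sum>i\<in>I. snd \<xi> i * complex_of_real (x i)) = (\<Sum>i\<in>I. snd \<xi> i * of_real (y i))"
      using assms by (intro sum.cong) auto
    then show ?thesis using assms(1,2) by (simp add: affine_value_def x_def)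
  qed
  have val\<zeta>: "affine_value (insert j I) \<zeta> x = ?a * (of_real (Im w) * ?z)"
  proof -
    have "affine_value I \<zeta> y = ?a * w" using a by (simp add: w_def)
    then show ?thesis unfolding val by (simp add: complex_eq_iff algebra_simps)
  qed
  have quot: "d_arg (insert j I) \<zeta> x k = (Im (snd \<zeta> k / ?a) * s - Re (snd \<zeta> k / ?a)) / (Im w * (1 + s\<^sup>2))" for k
  proof -
    have "snd \<zeta> k / (?a * (of_real (Im w) * ?z)) = (snd \<zeta> k / ?a) / (of_real (Im w) * ?z)" by simp
    also have "\<dots> = (snd \<zeta> k / ?a) * Complex s (-1) / of_real (Im w * (1 + s\<^sup>2))"
    proof -
      have "?z * Complex s (-1) = of_real (1 + s\<^sup>2)" by (simp add: complex_eq_iff power2_eq_square)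
      then have "of_real (Im w * (1 + s\<^sup>2)) = of_real (Im w) * (?z * Complex s (-1))" by simp
      moreover have "?z \<noteq> 0" "Complex s (-1) \<noteq> 0" by (simp_all add: complex_eq_iff)
      ultimately show ?thesis using v by simp
    qed
    finally have "Im (snd \<zeta> k / (?a * (of_real (Im w) * ?z)))
        = Im (snd \<zeta> k / ?a * Complex s (-1)) / (Im w * (1 + s\<^sup>2))"
      by (simp only: Im_divide_of_real)
    then show ?thesis unfolding d_arg_def val\<zeta> by (simp only: times_complex.sel complex.sel) simp
  qed
  show 1: "d_arg (insert j I) \<zeta> x j = - 1 / (Im w * (1 + s\<^sup>2))"
    unfolding quot using a by simp
  let ?r = "\<lambda>w. complex_of_real (Im (w / ?a) * s - Re (w / ?a))"
  have ratio: "d_arg (insert j I) \<zeta> x k / d_arg (insert j I) \<zeta> x j = - (Im (snd \<zeta> k / ?a) * s - Re (snd \<zeta> k / ?a))"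
  proof -
    have gen: "(r / V) / (- 1 / V) = - r" if "V \<noteq> 0" for r V :: real using that by simp
    show ?thesis unfolding 1 unfolding quot by (rule gen) (use v s in simp)
  qed
  have r_lin: "?r (fst \<zeta>) + (\<Sum>i\<in>I. ?r (snd \<zeta> i) * of_real (y i)) = of_real (Im w * s - Re w)"
  proof -
    define q where "q = (\<lambda>i. snd \<zeta> i / ?a)"
    have w: "w = fst \<zeta> / ?a + (\<Sum>i\<in>I. q i * of_real (y i))"
      unfolding w_def affine_value_def by (simp add: add_divide_distrib sum_divide_distrib q_def)
    show ?thesis unfolding of_real_add[symmetric] of_real_mult[symmetric] of_real_sum[symmetric] of_real_eq_iff
      unfolding w q_def[THEN fun_cong, symmetric]
      by (simp add: sum_subtractf sum_distrib_left sum_distrib_right algebra_simps)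
  qed
  have val\<xi>: "affine_value I (restrict_level j \<zeta> s \<xi>) y = affine_value (insert j I) \<xi> x"
    unfolding val r_lin[symmetric]
    by (simp add: affine_value_def restrict_level_def Let_def sum.distrib sum_subtractf sum_distrib_left algebra_simps)
  show "d_arg (insert j I) \<xi> x k - d_arg (insert j I) \<xi> x j / d_arg (insert j I) \<zeta> x j * d_arg (insert j I) \<zeta> x k
           = d_arg I (restrict_level j \<zeta> s \<xi>) y k"
  proof -
    have "d_arg (insert j I) \<xi> x j / d_arg (insert j I) \<zeta> x j * d_arg (insert j I) \<zeta> x k
        = d_arg (insert j I) \<xi> x j * - (Im (snd \<zeta> k / ?a) * s - Re (snd \<zeta> k / ?a))"
      unfolding ratio[symmetric] by simp
    also have "\<dots> = - Im (snd \<xi> j * ?r (snd \<zeta> k) / affine_value (insert j I) \<xi> x)"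
    proof -
      have gen: "Im (c * of_real r / z) = Im (c / z) * r" for c z :: complex and r :: real
      proof -
        have "c * of_real r / z = c / z * of_real r" by simp
        then have "Im (c * of_real r / z) = Im (c / z * of_real r)" by (simp only:)
        then show ?thesis by (simp only: times_complex.sel Re_complex_of_real Im_complex_of_real)
      qed
      show ?thesis unfolding d_arg_def gen by (rule mult_minus_right)
    qed
    finally show ?thesis
      unfolding d_arg_def val\<xi> by (simp add: restrict_level_def Let_def add_divide_distrib)
  qed
qed

text \<open>The integrand is the density of the pullback of Lebesgue measure on the torus \<open>(\<real>/\<pi>)\<^sup>n\<close> under the map
  \<open>x \<mapsto> (arg \<zeta>\<^sub>1(x), \<dots>, arg \<zeta>\<^sub>n(x))\<close>. The fibres of this map are cut out by linear equations, so it is injective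
  where its Jacobian does not vanish, and the integral is at most the volume \<open>\<pi>\<^sup>n\<close> of the torus. Formally, one
  coordinate after the other is replaced by an argument, with \<open>level_set_Schur\<close>; each replacement is an affine
  substitution in one real variable.\<close>

lemma nn_integral_wedge_d_arg:
  assumes "finite I" "distinct js" "set js = I" "length js = n" "length \<zeta>s = n"
  shows "(\<integral>\<^sup>+x. ennreal \<bar>wedge_covectors (map (\<lambda>\<zeta>. d_arg I \<zeta> x) \<zeta>s) js\<bar> \<partial>lborel_on I)
       \<le> ennreal (pi ^ n)"
  using assms
proof (induction n arbitrary: I js \<zeta>s)
  case 0
  then have [simp]: "I = {}" "js = []" "\<zeta>s = []" by auto
  show ?case
    using lborel_PiM.nn_integral_empty[of "\<lambda>_. 1"] by (simp add: wedge_covectors_def)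
next
  case (Suc n I js \<zeta>s0)
  then obtain \<zeta> \<zeta>s where \<zeta>s0 [simp]: "\<zeta>s0 = \<zeta> # \<zeta>s" by (cases \<zeta>s0) auto
  let ?W = "\<lambda>js x. ennreal \<bar>wedge_covectors (map (\<lambda>\<zeta>. d_arg I \<zeta> x) (\<zeta> # \<zeta>s)) js\<bar>"
  have zero: ?case if "\<And>x k. k \<in> I \<Longrightarrow> d_arg I \<zeta> x k = 0"
  proof -
    have "wedge_covectors (map (\<lambda>\<zeta>. d_arg I \<zeta> x) (\<zeta> # \<zeta>s)) js = wedge_covectors ((\<lambda>_. 0) # map (\<lambda>\<zeta>. d_arg I \<zeta> x) \<zeta>s) js" for x
      by (rule wedge_covectors_cong) (use that Suc.prems in \<open>auto simp: nth_Cons'\<close>)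
    then show ?thesis by (simp add: wedge_covectors_zero)
  qed
  show ?case
  proof (cases "\<exists>j\<in>I. snd \<zeta> j \<noteq> 0")
    case False
    then show ?thesis by (intro zero) (auto simp: d_arg_def)
  next
    case True
    then obtain j where j: "j \<in> I" and a: "snd \<zeta> j \<noteq> 0" by blast
    obtain K where K: "I = insert j K" "j \<notin> K" "finite K"
      using j Suc.prems(1) by (metis mk_disjoint_insert finite_insert)
    let ?a = "snd \<zeta> j" and ?js = "remove1 j js"
    define w where "w = (\<lambda>y. affine_value K \<zeta> y / ?a)"
    define q where "q = (\<lambda>i. snd \<zeta> i / ?a)"
    have Im_w: "Im (w y) = Im (fst \<zeta> / ?a) + (\<Sum>i\<in>K. Im (q i) * y i)" for y
    proof -
      have "w y = fst \<zeta> / ?a + (\<Sum>i\<in>K. q i * of_real (y i))"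
        unfolding w_def affine_value_def by (simp add: add_divide_distrib sum_divide_distrib q_def)
      then show ?thesis by simp
    qed
    show ?thesis
    proof (cases "Im (fst \<zeta> / ?a) = 0 \<and> (\<forall>i\<in>K. Im (q i) = 0)")
      case flat: True
      \<comment> \<open>All values of \<open>\<zeta>\<close> are real multiples of \<open>a\<close>, so its argument is locally constant.\<close>
      show ?thesis
      proof (rule zero)
        fix x k assume "k \<in> I"
        have "Im (w x) = 0" unfolding Im_w using flat by simp
        moreover have "affine_value I \<zeta> x / ?a = w x + of_real (x j)"
          using K a by (simp add: affine_value_def w_def field_simps)
        ultimately have "Im (affine_value I \<zeta> x / ?a) = 0" by simp
        moreover have "Im (q k) = 0" using flat \<open>k \<in> I\<close> K a by (auto simp: q_def)
        ultimately have "Im (q k / (affine_value I \<zeta> x / ?a)) = 0"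
          by (metis Im_complex_of_real Reals_cases complex_is_Real_iff of_real_divide)
        then show "d_arg I \<zeta> x k = 0" using a by (simp add: d_arg_def q_def)
      qed
    next
      case tilted: False
      \<comment> \<open>The coefficient \<open>v\<close> of the substitution \<open>x\<^sub>j = v s - u\<close> vanishes at most on a hyperplane.\<close>
      have AE: "AE y in lborel_on K. Im (w y) \<noteq> 0"
      proof (cases "\<forall>i\<in>K. Im (q i) = 0")
        case True
        then show ?thesis using tilted by (simp add: Im_w)
      next
        case False
        then obtain i where "i \<in> K" "Im (q i) \<noteq> 0" by blast
        from AE_affine_nonzero[OF K(3) this(1), of "\<lambda>i. Im (q i)", OF this(2)]
        show ?thesis unfolding Im_w .
      qed
      have mset: "mset js = mset (j # ?js)" using j Suc.prems by simp
      have js: "distinct ?js" "set ?js = K" "length ?js = n" "length \<zeta>s = n"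
        using Suc.prems j K by (auto simp: length_remove1 set_remove1_eq)
      have meas1 [measurable]: "?W js' \<in> borel_measurable (lborel_on I)" for js'
      proof -
        have "(\<lambda>x. wedge_covectors (map (\<lambda>\<alpha>. \<alpha> x) (map (d_arg I) (\<zeta> # \<zeta>s))) js') \<in> borel_measurable (lborel_on I)"
          by (rule borel_measurable_wedge_covectors) (simp add: nth_Cons' del: list.map)
        then show ?thesis by (simp add: o_def)
      qed
      let ?R = "\<lambda>s y. ennreal \<bar>wedge_covectors (map (\<lambda>\<xi>. d_arg K \<xi> y) (map (restrict_level j \<zeta> s) \<zeta>s)) ?js\<bar>"
      have meas2: "(\<lambda>(y, s). ?R s y) \<in> borel_measurable (lborel_on K \<Otimes>\<^sub>M lborel)"
      proof -
        have "(\<lambda>p. wedge_covectors (map (\<lambda>\<alpha>. \<alpha> p) (map (\<lambda>\<xi> p. d_arg K (restrict_level j \<zeta> (snd p) \<xi>) (fst p)) \<zeta>s)) ?js)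
            \<in> borel_measurable (lborel_on K \<Otimes>\<^sub>M lborel)"
          by (rule borel_measurable_wedge_covectors)
             (simp add: d_arg_def affine_value_def restrict_level_def Let_def)
        then show ?thesis by (simp add: o_def split_beta')
      qed
      have fibre: "(\<integral>\<^sup>+t. ?W js (y(j := t)) \<partial>lborel) = (\<integral>\<^sup>+s. ennreal (1 / (1 + s\<^sup>2)) * ?R s y \<partial>lborel)"
        if v: "Im (w y) \<noteq> 0" and y: "y \<in> space (lborel_on K)" for y
      proof -
        have "(\<lambda>t. y(j := t)) \<in> lborel \<rightarrow>\<^sub>M lborel_on I"
          unfolding K(1) using y by (intro measurable_fun_upd) auto
        then have "(\<lambda>t. ?W js (y(j := t))) \<in> borel_measurable lborel"
          using measurable_compose[OF _ meas1] by blast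
        then have "(\<integral>\<^sup>+t. ?W js (y(j := t)) \<partial>lborel)
            = ennreal \<bar>Im (w y)\<bar> * (\<integral>\<^sup>+s. ?W js (y(j := - Re (w y) + Im (w y) * s)) \<partial>lborel)"
          using v by (intro nn_integral_real_affine) auto
        also have "\<dots> = (\<integral>\<^sup>+s. ennreal \<bar>Im (w y)\<bar> * ?W js (y(j := - Re (w y) + Im (w y) * s)) \<partial>lborel)"
        proof (rule nn_integral_cmult[symmetric])
          have "(\<lambda>s. y(j := - Re (w y) + Im (w y) * s)) \<in> lborel \<rightarrow>\<^sub>M lborel_on I"
            unfolding K(1) using y by (intro measurable_fun_upd) auto
          then show "(\<lambda>s. ?W js (y(j := - Re (w y) + Im (w y) * s))) \<in> borel_measurable lborel"
            using measurable_compose[OF _ meas1] by blast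
        qed
        also have "\<dots> = (\<integral>\<^sup>+s. ennreal (1 / (1 + s\<^sup>2)) * ?R s y \<partial>lborel)"
        proof (rule nn_integral_cong)
          fix s :: real
          let ?x = "y(j := Im (w y) * s - Re (w y))"
          have w_y: "affine_value K \<zeta> y / snd \<zeta> j = w y" by (simp add: w_def)
          then have v': "Im (affine_value K \<zeta> y / snd \<zeta> j) \<noteq> 0" using v by simp
          note Schur = level_set_Schur[OF K(3,2) a v', where s = s, folded K(1), unfolded w_y]
          have s: "1 + s\<^sup>2 > 0" by (simp add: add_pos_nonneg)
          have "\<bar>wedge_covectors (map (\<lambda>\<zeta>. d_arg I \<zeta> ?x) (\<zeta> # \<zeta>s)) js\<bar>
              = \<bar>wedge_covectors (d_arg I \<zeta> ?x # map (\<lambda>\<zeta>. d_arg I \<zeta> ?x) \<zeta>s) (j # ?js)\<bar>"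
            using abs_wedge_covectors_reorder[OF mset] by simp
          also have "\<dots> = \<bar>d_arg I \<zeta> ?x j * wedge_covectors (map (\<lambda>\<xi>. d_arg K \<xi> y) (map (restrict_level j \<zeta> s) \<zeta>s)) ?js\<bar>"
          proof (subst wedge_covectors_Schur)
            show "d_arg I \<zeta> ?x j \<noteq> 0" unfolding Schur(1) using s v by simp
            show "length ?js = length (map (\<lambda>\<zeta>. d_arg I \<zeta> ?x) \<zeta>s)" using js by simp
          qed (simp only: map_map o_def Schur(2))
          also have "\<dots> = 1 / (\<bar>Im (w y)\<bar> * (1 + s\<^sup>2)) * \<bar>wedge_covectors (map (\<lambda>\<xi>. d_arg K \<xi> y) (map (restrict_level j \<zeta> s) \<zeta>s)) ?js\<bar>"
            unfolding Schur(1) using s by (simp only: abs_mult abs_divide abs_minus abs_one abs_of_pos)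
          finally have "\<bar>Im (w y)\<bar> * \<bar>wedge_covectors (map (\<lambda>\<zeta>. d_arg I \<zeta> ?x) (\<zeta> # \<zeta>s)) js\<bar>
              = 1 / (1 + s\<^sup>2) * \<bar>wedge_covectors (map (\<lambda>\<xi>. d_arg K \<xi> y) (map (restrict_level j \<zeta> s) \<zeta>s)) ?js\<bar>"
            using v by simp
          then show "ennreal \<bar>Im (w y)\<bar> * ?W js (y(j := - Re (w y) + Im (w y) * s)) = ennreal (1 / (1 + s\<^sup>2)) * ?R s y"
            using s by (simp add: ennreal_mult[symmetric] algebra_simps del: list.map)
        qed
        finally show ?thesis .
      qed
      interpret K: sigma_finite_measure "lborel_on K"
        by (rule lborel_PiM.sigma_finite[OF K(3)])
      interpret pair_sigma_finite "lborel_on K" "lborel :: real measure" ..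
      have "(\<integral>\<^sup>+x. ?W js x \<partial>lborel_on I) = (\<integral>\<^sup>+y. (\<integral>\<^sup>+t. ?W js (y(j := t)) \<partial>lborel) \<partial>lborel_on K)"
        using lborel_PiM.product_nn_integral_insert[OF K(3,2), folded K(1), OF meas1] .
      also have "\<dots> = (\<integral>\<^sup>+y. (\<integral>\<^sup>+s. ennreal (1 / (1 + s\<^sup>2)) * ?R s y \<partial>lborel) \<partial>lborel_on K)"
        using AE AE_space by (intro nn_integral_cong_AE, eventually_elim) (rule fibre)
      also have "\<dots> = (\<integral>\<^sup>+s. (\<integral>\<^sup>+y. ennreal (1 / (1 + s\<^sup>2)) * ?R s y \<partial>lborel_on K) \<partial>lborel)"
        by (rule Fubini'[symmetric]) (use meas2 in \<open>simp add: split_beta'\<close>)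
      also have "\<dots> \<le> (\<integral>\<^sup>+s. ennreal (1 / (1 + s\<^sup>2)) * ennreal (pi ^ n) \<partial>lborel)"
      proof (rule nn_integral_mono)
        fix s :: real
        have "(\<lambda>y. ?R s y) \<in> borel_measurable (lborel_on K)"
          using measurable_compose[OF measurable_Pair2' meas2, of s] by (simp add: split_beta')
        then have "(\<integral>\<^sup>+y. ennreal (1 / (1 + s\<^sup>2)) * ?R s y \<partial>lborel_on K)
           = ennreal (1 / (1 + s\<^sup>2)) * (\<integral>\<^sup>+y. ?R s y \<partial>lborel_on K)"
          by (rule nn_integral_cmult)
        also have "(\<integral>\<^sup>+y. ?R s y \<partial>lborel_on K) \<le> ennreal (pi ^ n)"
          using Suc.prems by (intro Suc.IH[OF K(3) js(1,2)]) (simp_all add: js(3))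
        finally show "(\<integral>\<^sup>+y. ennreal (1 / (1 + s\<^sup>2)) * ?R s y \<partial>lborel_on K)
          \<le> ennreal (1 / (1 + s\<^sup>2)) * ennreal (pi ^ n)" by (simp add: mult_left_mono)
      qed
      also have "\<dots> = ennreal (pi ^ Suc n)"
        by (subst nn_integral_multc) (simp_all add: nn_integral_inverse_1_plus_square ennreal_mult)
      finally show ?thesis unfolding \<zeta>s0 .
    qed
  qed
qed

section \<open>Moebius substitutions\<close>

text \<open>The substitution \<open>y = a/t\<close>, exhausting the half-line by the intervals \<open>[b/(k + 2), b (k + 2)]\<close>; the shift by \<open>2\<close> keeps
  them nondegenerate.\<close>

lemma nn_integral_inversion:
  fixes h :: "real \<Rightarrow> ennreal"
  assumes [measurable]: "h \<in> borel_measurable borel" and a: "a > 0"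
  shows "(\<integral>\<^sup>+y. h y * indicator {0<..} y \<partial>lborel)
       = (\<integral>\<^sup>+t. h (a / t) * ennreal (a / t\<^sup>2) * indicator {0<..} t \<partial>lborel)"
proof -
  have bounded: "(\<integral>\<^sup>+y. h y * indicator {a / v..a / u} y \<partial>lborel)
      = (\<integral>\<^sup>+t. h (a / t) * ennreal (a / t\<^sup>2) * indicator {u..v} t \<partial>lborel)" if "0 < u" "u < v" for u v
  proof -
    have "(\<integral>\<^sup>+y. h y * indicator {a / v..a / u} y \<partial>lborel)
        = (\<integral>\<^sup>+y. h (- y) * indicator {- (a / u)..- (a / v)} y \<partial>lborel)"
      by (subst nn_integral_real_affine[where c = "-1" and t = 0])
         (auto intro!: nn_integral_cong split: split_indicator)
    also have "\<dots> = (\<integral>\<^sup>+t. h (- (- (a / t))) * ennreal (a / t\<^sup>2) * indicator {u..v} t \<partial>lborel)"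
      by (rule nn_integral_substitution_aux[where g = "\<lambda>t. - (a / t)" and g' = "\<lambda>t. a / t\<^sup>2"])
         (use a that in \<open>auto intro!: derivative_eq_intros continuous_intros simp: power2_eq_square\<close>)
    finally show ?thesis by simp
  qed
  have sup: "(\<integral>\<^sup>+y. g y * indicator {0<..} y \<partial>lborel) = (SUP k. \<integral>\<^sup>+y. g y * indicator {b / (real k + 2)..b * (real k + 2)} y \<partial>lborel)"
    if [measurable]: "g \<in> borel_measurable borel" and b: "b > 0" for g :: "real \<Rightarrow> ennreal" and b :: real
  proof -
    have "(SUP k. g y * indicator {b / (real k + 2)..b * (real k + 2)} y) = g y * indicator {0<..} y" for y
    proof (cases "y > 0")
      case True
      obtain k where k: "max (b / y) (y / b) < real k" using reals_Archimedean2 by blast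
      have "y \<in> {b / (real k + 2)..b * (real k + 2)}"
      proof -
        have "b < real k * y" "y < real k * b" using k True b by (auto simp: field_simps)
        then show ?thesis using True b by (auto simp: field_simps intro!: less_imp_le)
      qed
      then have "g y \<le> (SUP k. g y * indicator {b / (real k + 2)..b * (real k + 2)} y)"
        by (intro SUP_upper2[of k]) auto
      moreover have "(SUP k. g y * indicator {b / (real k + 2)..b * (real k + 2)} y) \<le> g y"
        by (intro SUP_least) (auto split: split_indicator)
      ultimately show ?thesis using True by simp
    next
      case False
      then have "y \<notin> {b / (real k + 2)..b * (real k + 2)}" for k
      proof -
        have "0 < b / (real k + 2)" using b by simp
        then show ?thesis using False by auto
      qed
      then show ?thesis using False by simp
    qed
    then have "(\<integral>\<^sup>+y. g y * indicator {0<..} y \<partial>lborel) = (\<integral>\<^sup>+y. (SUP k. g y * indicator {b / (real k + 2)..b * (real k + 2)} y) \<partial>lborel)"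
      by simp
    also have "\<dots> = (SUP k. \<integral>\<^sup>+y. g y * indicator {b / (real k + 2)..b * (real k + 2)} y \<partial>lborel)"
    proof (rule nn_integral_monotone_convergence_SUP)
      show "incseq (\<lambda>k y. g y * indicator {b / (real k + 2)..b * (real k + 2)} y)"
      proof (intro incseq_SucI le_funI)
        fix k y
        have "{b / (real k + 2)..b * (real k + 2)} \<subseteq> {b / (real (Suc k) + 2)..b * (real (Suc k) + 2)}"
          using b by (auto simp: frac_le)
        then show "g y * indicator {b / (real k + 2)..b * (real k + 2)} y \<le> g y * indicator {b / (real (Suc k) + 2)..b * (real (Suc k) + 2)} y"
          by (intro mult_left_mono) (auto split: split_indicator)
      qed
    qed measurable
    finally show ?thesis .
  qed
  have "(\<integral>\<^sup>+y. h y * indicator {0<..} y \<partial>lborel) = (SUP k. \<integral>\<^sup>+y. h y * indicator {a / (real k + 2)..a * (real k + 2)} y \<partial>lborel)"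
    by (rule sup) (use a in auto)
  also have "\<dots> = (SUP k. \<integral>\<^sup>+t. h (a / t) * ennreal (a / t\<^sup>2) * indicator {1 / (real k + 2)..1 * (real k + 2)} t \<partial>lborel)"
  proof (rule SUP_cong[OF refl])
    fix k :: nat
    have "1 / (real k + 2) < 1 * (real k + 2)"
      by (rule less_trans[of _ 1]) (auto simp: field_simps)
    from bounded[OF _ this]
    show "(\<integral>\<^sup>+y. h y * indicator {a / (real k + 2)..a * (real k + 2)} y \<partial>lborel)
      = (\<integral>\<^sup>+t. h (a / t) * ennreal (a / t\<^sup>2) * indicator {1 / (real k + 2)..1 * (real k + 2)} t \<partial>lborel)"
      by (simp add: divide_divide_eq_right)
  qed
  also have "\<dots> = (\<integral>\<^sup>+t. h (a / t) * ennreal (a / t\<^sup>2) * indicator {0<..} t \<partial>lborel)"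
    by (rule sup[symmetric]) auto
  finally show ?thesis .
qed

text \<open>The rotation of the upper half-plane that fixes \<open>\<i>\<close> and sends the boundary point \<open>q\<close> to \<open>\<infinity>\<close>.\<close>

definition rotation :: "real \<Rightarrow> complex \<Rightarrow> complex" where
  "rotation q z = - (1 + of_real q * z) / (z - of_real q)"

lemma rotation_alt: "z \<noteq> of_real q \<Longrightarrow> rotation q z = - of_real q - of_real (1 + q\<^sup>2) / (z - of_real q)"
  by (simp add: rotation_def field_simps power2_eq_square)

lemma rotation_components:
  assumes "y > 0"
  shows "Re (rotation q (Complex x y)) = - q - (1 + q\<^sup>2) * (x - q) / ((x - q)\<^sup>2 + y\<^sup>2)"
    and "Im (rotation q (Complex x y)) = (1 + q\<^sup>2) * y / ((x - q)\<^sup>2 + y\<^sup>2)"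
proof -
  have "Complex x y \<noteq> of_real q" using assms by (simp add: complex_eq_iff)
  then show "Re (rotation q (Complex x y)) = - q - (1 + q\<^sup>2) * (x - q) / ((x - q)\<^sup>2 + y\<^sup>2)"
    and "Im (rotation q (Complex x y)) = (1 + q\<^sup>2) * y / ((x - q)\<^sup>2 + y\<^sup>2)"
    by (simp_all add: rotation_alt Re_divide Im_divide cmod_power2 power2_eq_square)
qed

text \<open>The rotation is \<open>z \<mapsto> - q - (1 + q\<^sup>2)/(z - q)\<close>, an inversion up to translations and a dilation. In the
  coordinates \<open>s = (x - q)/y\<close> and \<open>y\<close> it acts by \<open>s \<mapsto> - s\<close> and by \<open>y \<mapsto> a/y\<close> with \<open>a = (1 + q\<^sup>2)/(1 + s\<^sup>2)\<close>, so that
  substitutions in one variable suffice.\<close>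

lemma nn_integral_rotation:
  fixes h :: "real \<Rightarrow> real \<Rightarrow> ennreal"
  assumes [measurable]: "(\<lambda>(x, y). h x y) \<in> borel_measurable (borel \<Otimes>\<^sub>M borel)"
  shows "(\<integral>\<^sup>+x. \<integral>\<^sup>+y. h (Re (rotation q (Complex x y))) (Im (rotation q (Complex x y)))
            * ennreal (((1 + q\<^sup>2) / ((x - q)\<^sup>2 + y\<^sup>2))\<^sup>2) * indicator {0<..} y \<partial>lborel \<partial>lborel)
       = (\<integral>\<^sup>+x. \<integral>\<^sup>+y. h x y * indicator {0<..} y \<partial>lborel \<partial>lborel)"
proof -
  define c where "c = 1 + q\<^sup>2"
  have c: "c > 0" by (simp add: c_def add_pos_nonneg)
  have h_meas [measurable (raw)]: "(\<lambda>x. h (f x) (g x)) \<in> borel_measurable M"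
    if "f \<in> borel_measurable M" "g \<in> borel_measurable M" for f g and M :: "'m measure"
    using measurable_compose[OF measurable_Pair[OF that] assms(1)] by simp
  let ?F = "\<lambda>x y. h (- q - c * x / (x\<^sup>2 + y\<^sup>2)) (c * y / (x\<^sup>2 + y\<^sup>2)) * ennreal ((c / (x\<^sup>2 + y\<^sup>2))\<^sup>2) * indicator {0<..} y"
  have "(\<integral>\<^sup>+x. \<integral>\<^sup>+y. h (Re (rotation q (Complex x y))) (Im (rotation q (Complex x y)))
            * ennreal (((1 + q\<^sup>2) / ((x - q)\<^sup>2 + y\<^sup>2))\<^sup>2) * indicator {0<..} y \<partial>lborel \<partial>lborel)
      = (\<integral>\<^sup>+x. \<integral>\<^sup>+y. ?F (x - q) y \<partial>lborel \<partial>lborel)"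
    by (intro nn_integral_cong) (auto simp: rotation_components c_def split: split_indicator)
  also have "\<dots> = (\<integral>\<^sup>+x. \<integral>\<^sup>+y. ?F x y \<partial>lborel \<partial>lborel)"
    by (subst nn_integral_real_affine[where c = 1 and t = q]) simp_all
  also have "\<dots> = (\<integral>\<^sup>+y. \<integral>\<^sup>+x. ?F x y \<partial>lborel \<partial>lborel)"
    by (rule lborel_pair.Fubini'[symmetric]) measurable
  also have "\<dots> = (\<integral>\<^sup>+y. \<integral>\<^sup>+s. ennreal y * ?F (y * s) y * indicator {0<..} y \<partial>lborel \<partial>lborel)"
  proof (rule nn_integral_cong)
    fix y :: real
    show "(\<integral>\<^sup>+x. ?F x y \<partial>lborel) = (\<integral>\<^sup>+s. ennreal y * ?F (y * s) y * indicator {0<..} y \<partial>lborel)"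
    proof (cases "y > 0")
      case True
      then show ?thesis
        by (subst nn_integral_real_affine[where c = y and t = 0]) (simp_all add: nn_integral_cmult)
    qed simp
  qed
  also have "\<dots> = (\<integral>\<^sup>+s. \<integral>\<^sup>+y. ennreal y * ?F (y * s) y * indicator {0<..} y \<partial>lborel \<partial>lborel)"
    by (rule lborel_pair.Fubini') measurable
  also have "\<dots> = (\<integral>\<^sup>+s. \<integral>\<^sup>+t. ennreal t * h (- q - s * t) t * indicator {0<..} t \<partial>lborel \<partial>lborel)"
  proof (rule nn_integral_cong)
    fix s :: real
    define a where "a = c / (1 + s\<^sup>2)"
    have s: "1 + s\<^sup>2 > 0" by (simp add: add_pos_nonneg)
    then have a: "a > 0" using c by (simp add: a_def)
    have "(\<integral>\<^sup>+y. ennreal y * ?F (y * s) y * indicator {0<..} y \<partial>lborel)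
        = (\<integral>\<^sup>+t. (ennreal (a / t) * ?F (a / t * s) (a / t)) * ennreal (a / t\<^sup>2) * indicator {0<..} t \<partial>lborel)"
      by (rule nn_integral_inversion[OF _ a]) measurable
    also have "\<dots> = (\<integral>\<^sup>+t. ennreal t * h (- q - s * t) t * indicator {0<..} t \<partial>lborel)"
    proof (rule nn_integral_cong)
      fix t :: real
      show "(ennreal (a / t) * ?F (a / t * s) (a / t)) * ennreal (a / t\<^sup>2) * indicator {0<..} t
          = ennreal t * h (- q - s * t) t * indicator {0<..} t"
      proof (cases "t > 0")
        case True
        have sq: "(a / t * s)\<^sup>2 + (a / t)\<^sup>2 = c * a / t\<^sup>2"
        proof -
          have "c = a * (1 + s\<^sup>2)" using s by (simp add: a_def)
          then show ?thesis using True by (simp add: field_simps power2_eq_square)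
        qed
        have 1: "c * (a / t * s) / (c * a / t\<^sup>2) = s * t" "c * (a / t) / (c * a / t\<^sup>2) = t"
          "a / t * (c / (c * a / t\<^sup>2))\<^sup>2 * (a / t\<^sup>2) = t"
          using True a c by (simp_all add: field_simps power2_eq_square)
        have "ennreal (a / t) * ennreal ((c / (c * a / t\<^sup>2))\<^sup>2) * ennreal (a / t\<^sup>2) = ennreal t"
          using True a c 1(3) by (simp flip: ennreal_mult)
        moreover have "?F (a / t * s) (a / t)
            = h (- q - s * t) t * ennreal ((c / (c * a / t\<^sup>2))\<^sup>2) * indicator {0<..} (a / t)"
          unfolding sq 1(1,2) ..
        moreover have "x * (u * z * 1) * y * 1 = x * z * y * u" for x y z u :: ennreal
          by (simp add: mult_ac)
        ultimately show ?thesis using True a by (simp del: times_divide_eq_right)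
      qed simp
    qed
    finally show "(\<integral>\<^sup>+y. ennreal y * ?F (y * s) y * indicator {0<..} y \<partial>lborel)
        = (\<integral>\<^sup>+t. ennreal t * h (- q - s * t) t * indicator {0<..} t \<partial>lborel)" .
  qed
  also have "\<dots> = (\<integral>\<^sup>+t. \<integral>\<^sup>+s. ennreal t * h (- q - s * t) t * indicator {0<..} t \<partial>lborel \<partial>lborel)"
    by (rule lborel_pair.Fubini'[symmetric]) measurable
  also have "\<dots> = (\<integral>\<^sup>+y. \<integral>\<^sup>+x. h x y * indicator {0<..} y \<partial>lborel \<partial>lborel)"
  proof (rule nn_integral_cong)
    fix t :: real
    show "(\<integral>\<^sup>+s. ennreal t * h (- q - s * t) t * indicator {0<..} t \<partial>lborel) = (\<integral>\<^sup>+x. h x t * indicator {0<..} t \<partial>lborel)"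
    proof (cases "t > 0")
      case True
      have "(\<integral>\<^sup>+x. h x t \<partial>lborel) = ennreal \<bar>- t\<bar> * (\<integral>\<^sup>+s. h (- q + - t * s) t \<partial>lborel)"
        using True by (intro nn_integral_real_affine) auto
      then show ?thesis using True by (simp add: nn_integral_cmult mult.commute)
    qed simp
  qed
  also have "\<dots> = (\<integral>\<^sup>+x. \<integral>\<^sup>+y. h x y * indicator {0<..} y \<partial>lborel \<partial>lborel)"
    by (rule lborel_pair.Fubini') measurable
  finally show ?thesis .
qed

lemma borel_measurable_rotation [measurable (raw)]:
  assumes [measurable]: "f \<in> borel_measurable M" "g \<in> borel_measurable M" "h \<in> borel_measurable M"
  shows "(\<lambda>x. rotation (f x) (Complex (g x) (h x))) \<in> borel_measurable M"
  unfolding rotation_def Complex_eq by measurable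

section \<open>The rotation of a configuration\<close>

definition rotated_coordinate :: "real \<Rightarrow> (nat \<Rightarrow> real) \<Rightarrow> nat \<Rightarrow> real" where
  "rotated_coordinate q y i =
     (if even i then Re else Im) (rotation q (Complex (y (2 * (i div 2))) (y (2 * (i div 2) + 1))))"

text \<open>The product of \<open>\<bar>d(rotation q)/dz\<bar>\<^sup>2\<close> over the points \<open>p\<^sub>1, \<dots>, p\<^bsub>n-1\<^esub>\<close>. The point \<open>p\<^sub>0 = \<i>\<close> is fixed by the gauge
  and by the rotation.\<close>

definition point_jacobian :: "nat \<Rightarrow> real \<Rightarrow> (nat \<Rightarrow> real) \<Rightarrow> real" where
  "point_jacobian n q y = (\<Prod>k = 1..<n. ((1 + q\<^sup>2) / ((y (2 * k) - q)\<^sup>2 + (y (2 * k + 1))\<^sup>2))\<^sup>2)"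

definition upper_points :: "nat \<Rightarrow> (nat \<Rightarrow> real) set" where
  "upper_points n = {y. \<forall>k\<in>{1..<n}. 0 < y (2 * k + 1)}"

lemma borel_measurable_rotated_coordinate [measurable (raw)]:
  assumes "f \<in> borel_measurable M" "i \<in> {2..<2 * n}" "g \<in> M \<rightarrow>\<^sub>M lborel_on {2..<2 * n}"
  shows "(\<lambda>x. rotated_coordinate (f x) (g x) i) \<in> borel_measurable M"
proof -
  have g: "(\<lambda>x. g x j) \<in> borel_measurable M" if "j \<in> {2..<2 * n}" for j
    using measurable_compose[OF assms(3) measurable_component_singleton[OF that]] by simp
  have "2 * (i div 2) \<in> {2..<2 * n}" "2 * (i div 2) + 1 \<in> {2..<2 * n}"
    using assms(2) by (auto, presburger+)
  then have [measurable]: "(\<lambda>x. g x (2 * (i div 2))) \<in> borel_measurable M" "(\<lambda>x. g x (2 * (i div 2) + 1)) \<in> borel_measurable M"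
    by (auto intro!: g)
  note [measurable] = assms(1)
  have [measurable]: "(\<lambda>x. rotation (f x) (Complex (g x (2 * (i div 2))) (g x (2 * (i div 2) + 1)))) \<in> borel_measurable M"
    by measurable
  show ?thesis unfolding rotated_coordinate_def by (cases "even i") (simp_all only: if_True if_False, measurable)
qed

lemma rotated_coordinate_upd:
  assumes "i < 2 * n"
  shows "rotated_coordinate q (y(2 * n := a, Suc (2 * n) := b)) i = rotated_coordinate q y i"
    and "rotated_coordinate q (y(Suc (2 * n) := b, 2 * n := a)) i = rotated_coordinate q y i"
proof -
  have "2 * (i div 2) < 2 * n" "2 * (i div 2) + 1 < 2 * n" using assms by (auto, presburger+)
  then show "rotated_coordinate q (y(2 * n := a, Suc (2 * n) := b)) i = rotated_coordinate q y i"
    and "rotated_coordinate q (y(Suc (2 * n) := b, 2 * n := a)) i = rotated_coordinate q y i"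
    by (auto simp: rotated_coordinate_def)
qed

lemma point_jacobian_upd:
  "point_jacobian n q (y(2 * n := a, Suc (2 * n) := b)) = point_jacobian n q y"
  "point_jacobian n q (y(Suc (2 * n) := b, 2 * n := a)) = point_jacobian n q y"
  unfolding point_jacobian_def by (auto intro!: prod.cong)

lemma upper_points_upd:
  "y(2 * n := a, Suc (2 * n) := b) \<in> upper_points n \<longleftrightarrow> y \<in> upper_points n"
  "y(Suc (2 * n) := b, 2 * n := a) \<in> upper_points n \<longleftrightarrow> y \<in> upper_points n"
  by (auto simp: upper_points_def)

lemma point_jacobian_nonneg: "0 \<le> point_jacobian n q y"
  unfolding point_jacobian_def by (intro prod_nonneg) auto

lemma point_coords_measurable:
  assumes "k \<in> {1..<n}" "2 * n \<le> m"
  shows "(\<lambda>y. y (2 * k)) \<in> borel_measurable (lborel_on {2..<m})"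
    and "(\<lambda>y. y (Suc (2 * k))) \<in> borel_measurable (lborel_on {2..<m})"
  using measurable_component_singleton[of "2 * k" "{2..<m}" "\<lambda>_. lborel :: real measure"]
    measurable_component_singleton[of "Suc (2 * k)" "{2..<m}" "\<lambda>_. lborel :: real measure"] assms
  by auto

lemma borel_measurable_point_jacobian:
  assumes "2 * n \<le> m" "f \<in> borel_measurable (lborel_on {2..<m})"
  shows "(\<lambda>y. point_jacobian n (f y) y) \<in> borel_measurable (lborel_on {2..<m})"
  unfolding point_jacobian_def
proof (rule borel_measurable_prod)
  fix k assume k: "k \<in> {1..<n}"
  note [measurable] = point_coords_measurable[OF k assms(1)] assms(2)
  show "(\<lambda>y. ((1 + (f y)\<^sup>2) / ((y (2 * k) - f y)\<^sup>2 + (y (2 * k + 1))\<^sup>2))\<^sup>2) \<in> borel_measurable (lborel_on {2..<m})"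
    unfolding Suc_eq_plus1[symmetric] by measurable
qed

lemma sets_upper_points:
  assumes "2 * n \<le> m"
  shows "Measurable.pred (lborel_on {2..<m}) (\<lambda>y. y \<in> upper_points n)"
  unfolding upper_points_def mem_Collect_eq
proof (rule pred_intros_countable_bounded)
  fix k assume k: "k \<in> {1..<n}"
  note [measurable] = point_coords_measurable[OF k assms]
  show "Measurable.pred (lborel_on {2..<m}) (\<lambda>y. 0 < y (2 * k + 1))"
    unfolding Suc_eq_plus1[symmetric] by measurable
qed

lemma nn_integral_rotated_points:
  assumes v: "v \<in> borel_measurable (lborel_on {2..<2 * n})" and "n \<ge> 1"
  shows "(\<integral>\<^sup>+y. v (\<lambda>i\<in>{2..<2 * n}. rotated_coordinate q y i) * ennreal (point_jacobian n q y)
              * indicator (upper_points n) y \<partial>lborel_on {2..<2 * n})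
       = (\<integral>\<^sup>+y. v y * indicator (upper_points n) y \<partial>lborel_on {2..<2 * n})"
  using assms(2,1)
proof (induction n arbitrary: v rule: dec_induct)
  case base
  have "space (lborel_on {2..<2 * 1 :: nat}) = {\<lambda>_. undefined}" by (simp add: space_PiM)
  then show ?case
    by (intro nn_integral_cong) (auto simp: point_jacobian_def upper_points_def restrict_def)
next
  case (step n)
  let ?I = "{2..<2 * n}" and ?J = "{2..<2 * Suc n}"
  let ?M = "lborel_on ?I"
  let ?R = "\<lambda>y. \<lambda>i\<in>?I. rotated_coordinate q y i" and ?R' = "\<lambda>y. \<lambda>i\<in>?J. rotated_coordinate q y i"
  let ?w = "\<lambda>a b. ((1 + q\<^sup>2) / ((a - q)\<^sup>2 + b\<^sup>2))\<^sup>2"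
  have J: "?J = insert (Suc (2 * n)) (insert (2 * n) ?I)" using step.hyps by auto
  note v [measurable] = step.prems
  have two: "(\<integral>\<^sup>+y. f y \<partial>lborel_on ?J)
      = (\<integral>\<^sup>+y. (\<integral>\<^sup>+a. (\<integral>\<^sup>+b. f (y(2 * n := a, Suc (2 * n) := b)) \<partial>lborel) \<partial>lborel) \<partial>?M)"
    if "f \<in> borel_measurable (lborel_on ?J)" for f :: "(nat \<Rightarrow> real) \<Rightarrow> ennreal"
    using that unfolding J
    by (subst lborel_PiM.product_nn_integral_insert, simp, simp, simp, subst lborel_PiM.product_nn_integral_insert) auto
  have upd [measurable]: "(\<lambda>p. (f p)(2 * n := g p, Suc (2 * n) := h p)) \<in> M \<rightarrow>\<^sub>M lborel_on ?J"
    if "f \<in> M \<rightarrow>\<^sub>M ?M" "g \<in> borel_measurable M" "h \<in> borel_measurable M" for f g h and M :: "'m measure"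
    unfolding J using that by (intro measurable_fun_upd) auto
  have R [measurable]: "?R \<in> ?M \<rightarrow>\<^sub>M ?M"
    by (rule measurable_restrict) (auto intro!: borel_measurable_rotated_coordinate)
  have R' [measurable]: "?R' \<in> lborel_on ?J \<rightarrow>\<^sub>M lborel_on ?J"
    by (rule measurable_restrict) (auto intro!: borel_measurable_rotated_coordinate[where n = "Suc n"])
  note [measurable] = sets_upper_points[of n "2 * n"] sets_upper_points[of "Suc n" "2 * Suc n"]
    borel_measurable_point_jacobian[of n "2 * n" "\<lambda>_. q"] borel_measurable_point_jacobian[of "Suc n" "2 * Suc n" "\<lambda>_. q"]
  have R'_upd: "?R' (y(2 * n := a, Suc (2 * n) := b))
      = (?R y)(2 * n := Re (rotation q (Complex a b)), Suc (2 * n) := Im (rotation q (Complex a b)))" for y a b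
    using step.hyps
    by (auto simp: fun_eq_iff rotated_coordinate_upd) (auto simp: rotated_coordinate_def less_Suc_eq)
  have up: "y(2 * n := a, Suc (2 * n) := b) \<in> upper_points (Suc n) \<longleftrightarrow> y \<in> upper_points n \<and> 0 < b" for y a b
    using step.hyps upper_points_upd(1)[of y n a b] by (auto simp: upper_points_def less_Suc_eq)
  have ind: "indicator (upper_points (Suc n)) (y(2 * n := a, Suc (2 * n) := b))
      = (indicator {0<..} b * indicator (upper_points n) y :: ennreal)" for y a b
    by (auto simp: indicator_def up)
  have jac: "point_jacobian (Suc n) q (y(2 * n := a, Suc (2 * n) := b)) = point_jacobian n q y * ?w a b" for y a b
    using step.hyps point_jacobian_upd(1)[of n q y a b] by (simp add: point_jacobian_def)
  define g where "g = (\<lambda>y. \<integral>\<^sup>+a. (\<integral>\<^sup>+b. v (y(2 * n := a, Suc (2 * n) := b)) * indicator {0<..} b \<partial>lborel) \<partial>lborel)"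
  have g [measurable]: "g \<in> borel_measurable ?M" unfolding g_def by measurable
  have "(\<integral>\<^sup>+y. v (?R' y) * ennreal (point_jacobian (Suc n) q y) * indicator (upper_points (Suc n)) y \<partial>lborel_on ?J)
      = (\<integral>\<^sup>+y. (\<integral>\<^sup>+a. (\<integral>\<^sup>+b. v ((?R y)(2 * n := Re (rotation q (Complex a b)), Suc (2 * n) := Im (rotation q (Complex a b))))
           * ennreal (?w a b) * indicator {0<..} b * (ennreal (point_jacobian n q y) * indicator (upper_points n) y) \<partial>lborel) \<partial>lborel) \<partial>?M)"
  proof (subst two)
    show "(\<lambda>y. v (?R' y) * ennreal (point_jacobian (Suc n) q y) * indicator (upper_points (Suc n)) y) \<in> borel_measurable (lborel_on ?J)"
      by measurable
  qed (intro nn_integral_cong, unfold R'_upd jac ind,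
       simp add: ennreal_mult point_jacobian_nonneg mult_ac)
  also have "\<dots> = (\<integral>\<^sup>+y. g (?R y) * (ennreal (point_jacobian n q y) * indicator (upper_points n) y) \<partial>?M)"
  proof (rule nn_integral_cong)
    fix y :: "nat \<Rightarrow> real" assume "y \<in> space ?M"
    then have [measurable]: "?R y \<in> space ?M" using measurable_space[OF R] by blast
    let ?h = "\<lambda>a b. v ((?R y)(2 * n := a, Suc (2 * n) := b))"
    let ?c = "ennreal (point_jacobian n q y) * indicator (upper_points n) y"
    have h [measurable]: "(\<lambda>(a, b). ?h a b) \<in> borel_measurable (borel \<Otimes>\<^sub>M borel)" by measurable
    have "(\<lambda>p. ?h (Re (rotation q (Complex (fst p) (snd p)))) (Im (rotation q (Complex (fst p) (snd p))))) \<in> borel_measurable (borel \<Otimes>\<^sub>M borel)"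
      by measurable
    then have hr [measurable]: "(\<lambda>(a, b). ?h (Re (rotation q (Complex a b))) (Im (rotation q (Complex a b)))) \<in> borel_measurable (borel \<Otimes>\<^sub>M borel)"
      by (simp add: split_beta')
    show "(\<integral>\<^sup>+a. (\<integral>\<^sup>+b. ?h (Re (rotation q (Complex a b))) (Im (rotation q (Complex a b)))
           * ennreal (?w a b) * indicator {0<..} b * ?c \<partial>lborel) \<partial>lborel) = g (?R y) * ?c"
      unfolding g_def nn_integral_rotation[OF h, symmetric, of q]
      by (subst nn_integral_multc, measurable, subst nn_integral_multc, measurable)
  qed
  also have "\<dots> = (\<integral>\<^sup>+y. g y * indicator (upper_points n) y \<partial>?M)"
    using step.IH[OF g] by (simp only: mult.assoc)
  also have "\<dots> = (\<integral>\<^sup>+y. v y * indicator (upper_points (Suc n)) y \<partial>lborel_on ?J)"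
  proof (subst two)
    show "(\<lambda>y. v y * indicator (upper_points (Suc n)) y) \<in> borel_measurable (lborel_on ?J)"
      by measurable
    show "(\<integral>\<^sup>+y. g y * indicator (upper_points n) y \<partial>?M)
      = (\<integral>\<^sup>+y. (\<integral>\<^sup>+a. (\<integral>\<^sup>+b. v (y(2 * n := a, Suc (2 * n) := b)) * indicator (upper_points (Suc n)) (y(2 * n := a, Suc (2 * n) := b)) \<partial>lborel) \<partial>lborel) \<partial>?M)"
    proof (rule nn_integral_cong)
      fix y :: "nat \<Rightarrow> real" assume [measurable]: "y \<in> space ?M"
      show "g y * indicator (upper_points n) y
        = (\<integral>\<^sup>+a. (\<integral>\<^sup>+b. v (y(2 * n := a, Suc (2 * n) := b)) * indicator (upper_points (Suc n)) (y(2 * n := a, Suc (2 * n) := b)) \<partial>lborel) \<partial>lborel)"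
        unfolding ind g_def mult.assoc[symmetric]
        by (subst nn_integral_multc, measurable, subst nn_integral_multc, measurable)
    qed
  qed
  finally show ?case .
qed

text \<open>The rotation about \<open>\<i>\<close> that sends \<open>q\<^sub>0\<close> to \<open>\<infinity>\<close>. It sends \<open>q\<^sub>1\<close> and \<open>\<infinity>\<close> to two real numbers, in this order, and
  these become the new \<open>q\<^sub>0\<close> and \<open>q\<^sub>1\<close>: the three boundary points are permuted cyclically.\<close>

definition rotated_configuration :: "nat \<Rightarrow> (nat \<Rightarrow> real) \<Rightarrow> nat \<Rightarrow> real" where
  "rotated_configuration n y =
     (\<lambda>i\<in>{2..<2 * n + 2}.
        if i < 2 * n then rotated_coordinate (y (2 * n)) y i
        else if i = 2 * n then - (1 + y (2 * n) * y (2 * n + 1)) / (y (2 * n + 1) - y (2 * n))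
        else - y (2 * n))"

text \<open>The second factor is the Jacobian of \<open>(q\<^sub>0, q\<^sub>1) \<mapsto> (- (1 + q\<^sub>0 q\<^sub>1)/(q\<^sub>1 - q\<^sub>0), - q\<^sub>0)\<close>.\<close>

definition rotation_jacobian :: "nat \<Rightarrow> (nat \<Rightarrow> real) \<Rightarrow> real" where
  "rotation_jacobian n y =
     point_jacobian n (y (2 * n)) y * ((1 + (y (2 * n))\<^sup>2) / (y (2 * n + 1) - y (2 * n))\<^sup>2)"

text \<open>The gauge-fixed configurations without the condition that the points are distinct, which only removes a set
  preserved by the rotation.\<close>

definition gauge_domain :: "nat \<Rightarrow> (nat \<Rightarrow> real) set" where
  "gauge_domain n = {y \<in> upper_points n. y (2 * n) < y (2 * n + 1)}"

lemma boundary_coords_measurable: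
  fixes n :: nat
  assumes "n \<ge> 1"
  shows "(\<lambda>y. y (2 * n)) \<in> borel_measurable (lborel_on {2..<2 * n + 2})"
    and "(\<lambda>y. y (2 * n + 1)) \<in> borel_measurable (lborel_on {2..<2 * n + 2})"
  using measurable_component_singleton[of "2 * n" "{2..<2 * n + 2}" "\<lambda>_. lborel :: real measure"]
    measurable_component_singleton[of "2 * n + 1" "{2..<2 * n + 2}" "\<lambda>_. lborel :: real measure"] assms
  by auto

lemma measurable_rotated_configuration:
  assumes "n \<ge> 1"
  shows "rotated_configuration n \<in> lborel_on {2..<2 * n + 2} \<rightarrow>\<^sub>M lborel_on {2..<2 * n + 2}"
proof -
  let ?M = "lborel_on {2..<2 * n + 2}"
  note [measurable] = boundary_coords_measurable[OF assms]
  have "rotated_coordinate (y (2 * n)) y i = rotated_coordinate (y (2 * n)) (restrict y {2..<2 * n}) i"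
    if "i \<in> {2..<2 * n}" for i and y :: "nat \<Rightarrow> real"
  proof -
    have "2 * (i div 2) \<in> {2..<2 * n}" "2 * (i div 2) + 1 \<in> {2..<2 * n}" using that by (auto, presburger+)
    then show ?thesis by (simp add: rotated_coordinate_def)
  qed
  moreover have "(\<lambda>y. restrict y {2..<2 * n}) \<in> ?M \<rightarrow>\<^sub>M lborel_on {2..<2 * n}"
    by (rule measurable_restrict_subset) auto
  ultimately have rot: "(\<lambda>y. rotated_coordinate (y (2 * n)) y i) \<in> borel_measurable ?M" if "i \<in> {2..<2 * n}" for i
    using that borel_measurable_rotated_coordinate[OF boundary_coords_measurable(1)[OF assms], of i n "\<lambda>y. restrict y {2..<2 * n}"]
    by (simp del: atLeastLessThan_iff)
  show ?thesis
    unfolding rotated_configuration_def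
  proof (rule measurable_restrict)
    fix i assume i: "i \<in> {2..<2 * n + 2}"
    consider "i < 2 * n" | "i = 2 * n" | "i \<noteq> 2 * n" "\<not> i < 2 * n" by blast
    then show "(\<lambda>y. if i < 2 * n then rotated_coordinate (y (2 * n)) y i
        else if i = 2 * n then - (1 + y (2 * n) * y (2 * n + 1)) / (y (2 * n + 1) - y (2 * n))
        else - y (2 * n)) \<in> ?M \<rightarrow>\<^sub>M lborel"
    proof cases
      case 1
      then show ?thesis using rot i by simp
    next
      case 2
      then show ?thesis by (simp only: less_irrefl if_False if_True measurable_lborel2) measurable
    next
      case 3
      then show ?thesis by (simp only: if_False measurable_lborel2) measurable
    qed
  qed
qed

lemma measurable_gauge_domain:
  "n \<ge> 1 \<Longrightarrow> Measurable.pred (lborel_on {2..<2 * n + 2}) (\<lambda>y. y \<in> gauge_domain n)"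
  using sets_upper_points[of n "2 * n + 2"] boundary_coords_measurable[of n]
  unfolding gauge_domain_def mem_Collect_eq by measurable

lemma borel_measurable_rotation_jacobian:
  assumes "n \<ge> 1"
  shows "rotation_jacobian n \<in> borel_measurable (lborel_on {2..<2 * n + 2})"
proof -
  note [measurable] = boundary_coords_measurable[OF assms]
    borel_measurable_point_jacobian[of n "2 * n + 2" "\<lambda>y. y (2 * n)", OF _ boundary_coords_measurable(1)[OF assms]]
  show ?thesis unfolding rotation_jacobian_def by measurable
qed

text \<open>For fixed \<open>q\<^sub>0\<close> each point in the half-plane moves by one and the same rotation, and the boundary points are
  related by an inversion: \<open>- (1 + q\<^sub>0 q\<^sub>1)/(q\<^sub>1 - q\<^sub>0) = - q\<^sub>0 - (1 + q\<^sub>0\<^sup>2)/u\<close> with \<open>u = q\<^sub>1 - q\<^sub>0\<close>.\<close>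

lemma nn_integral_rotated_configuration:
  assumes v: "v \<in> borel_measurable (lborel_on {2..<2 * n + 2})" and n: "n \<ge> 1"
  shows "(\<integral>\<^sup>+y. v (rotated_configuration n y) * ennreal (rotation_jacobian n y) * indicator (gauge_domain n) y
            \<partial>lborel_on {2..<2 * n + 2})
       = (\<integral>\<^sup>+y. v y * indicator (gauge_domain n) y \<partial>lborel_on {2..<2 * n + 2})"
proof -
  let ?I = "{2..<2 * n}" and ?J = "{2..<2 * n + 2}"
  let ?M = "lborel_on ?I" and ?N = "lborel_on ?J"
  have J: "?J = insert (2 * n) (insert (Suc (2 * n)) ?I)" using n by auto
  note [measurable] = v measurable_rotated_configuration[OF n] measurable_gauge_domain[OF n]
    borel_measurable_rotation_jacobian[OF n] sets_upper_points[of n "2 * n"]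
  let ?upd = "\<lambda>y a b. y(Suc (2 * n) := b, 2 * n := a)"
  have two: "(\<integral>\<^sup>+y. f y \<partial>?N) = (\<integral>\<^sup>+a. (\<integral>\<^sup>+b. (\<integral>\<^sup>+y. f (?upd y a b) \<partial>?M) \<partial>lborel) \<partial>lborel)"
    if f: "f \<in> borel_measurable ?N" for f :: "(nat \<Rightarrow> real) \<Rightarrow> ennreal"
  proof -
    have "(\<integral>\<^sup>+y. f y \<partial>?N) = (\<integral>\<^sup>+a. (\<integral>\<^sup>+y. f (y(2 * n := a)) \<partial>PiM (insert (Suc (2 * n)) ?I) (\<lambda>_. lborel)) \<partial>lborel)"
      using f unfolding J by (intro lborel_PiM.product_nn_integral_insert_rev) auto
    also have "\<dots> = (\<integral>\<^sup>+a. (\<integral>\<^sup>+b. (\<integral>\<^sup>+y. f (?upd y a b) \<partial>?M) \<partial>lborel) \<partial>lborel)"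
    proof (rule nn_integral_cong)
      fix a
      have "(\<lambda>y. y(2 * n := a)) \<in> PiM (insert (Suc (2 * n)) ?I) (\<lambda>_. lborel) \<rightarrow>\<^sub>M ?N"
        unfolding J by (intro measurable_fun_upd) auto
      then show "(\<integral>\<^sup>+y. f (y(2 * n := a)) \<partial>PiM (insert (Suc (2 * n)) ?I) (\<lambda>_. lborel)) = (\<integral>\<^sup>+b. (\<integral>\<^sup>+y. f (?upd y a b) \<partial>?M) \<partial>lborel)"
        using f by (intro lborel_PiM.product_nn_integral_insert_rev) (auto intro: measurable_compose)
    qed
    finally show ?thesis .
  qed
  have upd [measurable]: "(\<lambda>p. ?upd (f p) (g p) (h p)) \<in> M \<rightarrow>\<^sub>M ?N"
    if "f \<in> M \<rightarrow>\<^sub>M ?M" "g \<in> borel_measurable M" "h \<in> borel_measurable M" for f g h and M :: "'m measure"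
    unfolding J using that by (intro measurable_fun_upd) auto
  interpret M: sigma_finite_measure ?M by (rule lborel_PiM.sigma_finite) simp
  define G where "G = (\<lambda>s t. \<integral>\<^sup>+y. v (?upd y s t) * indicator (upper_points n) y \<partial>?M)"
  have [measurable]: "(\<lambda>p. G (g p) (h p)) \<in> borel_measurable M"
    if [measurable]: "g \<in> borel_measurable M" "h \<in> borel_measurable M" for g h and M :: "'m measure"
    unfolding G_def by measurable
  have dom: "indicator (gauge_domain n) (?upd y a b) = (indicator (upper_points n) y * indicator {a<..} b :: ennreal)" for y a b
    by (auto simp: gauge_domain_def indicator_def upper_points_upd)
  have jac: "ennreal (rotation_jacobian n (?upd y a b)) = ennreal (point_jacobian n a y) * ennreal ((1 + a\<^sup>2) / (b - a)\<^sup>2)" for y a b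
    by (subst ennreal_mult[symmetric]) (simp_all add: rotation_jacobian_def point_jacobian_upd point_jacobian_nonneg)
  have rot: "rotated_configuration n (?upd y a b)
      = ?upd (\<lambda>i\<in>?I. rotated_coordinate a y i) (- (1 + a * b) / (b - a)) (- a)" for y a b
    using n by (auto simp: fun_eq_iff rotated_configuration_def rotated_coordinate_upd)
  have "(\<integral>\<^sup>+y. v (rotated_configuration n y) * ennreal (rotation_jacobian n y) * indicator (gauge_domain n) y \<partial>?N)
      = (\<integral>\<^sup>+a. (\<integral>\<^sup>+b. (\<integral>\<^sup>+y. v (?upd (\<lambda>i\<in>?I. rotated_coordinate a y i) (- (1 + a * b) / (b - a)) (- a))
           * ennreal (point_jacobian n a y) * indicator (upper_points n) y
           * (ennreal ((1 + a\<^sup>2) / (b - a)\<^sup>2) * indicator {a<..} b) \<partial>?M) \<partial>lborel) \<partial>lborel)"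
    by (subst two, measurable, intro nn_integral_cong, unfold rot dom jac) (simp only: mult_ac)
  also have "\<dots> = (\<integral>\<^sup>+a. (\<integral>\<^sup>+b. G (- (1 + a * b) / (b - a)) (- a) * (ennreal ((1 + a\<^sup>2) / (b - a)\<^sup>2) * indicator {a<..} b) \<partial>lborel) \<partial>lborel)"
  proof (intro nn_integral_cong)
    fix a b :: real
    have R [measurable]: "(\<lambda>y. \<lambda>i\<in>?I. rotated_coordinate a y i) \<in> ?M \<rightarrow>\<^sub>M ?M"
      by (rule measurable_restrict) (auto intro!: borel_measurable_rotated_coordinate)
    note [measurable] = borel_measurable_point_jacobian[of n "2 * n" "\<lambda>_. a"]
    let ?v = "\<lambda>y. v (?upd y (- (1 + a * b) / (b - a)) (- a))"
    have [measurable]: "?v \<in> borel_measurable ?M" by measurable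
    show "(\<integral>\<^sup>+y. ?v (\<lambda>i\<in>?I. rotated_coordinate a y i)
           * ennreal (point_jacobian n a y) * indicator (upper_points n) y
           * (ennreal ((1 + a\<^sup>2) / (b - a)\<^sup>2) * indicator {a<..} b) \<partial>?M)
       = G (- (1 + a * b) / (b - a)) (- a) * (ennreal ((1 + a\<^sup>2) / (b - a)\<^sup>2) * indicator {a<..} b)"
      unfolding G_def nn_integral_rotated_points[OF \<open>?v \<in> _\<close> n, of a, symmetric]
      by (rule nn_integral_multc) measurable
  qed
  also have "\<dots> = (\<integral>\<^sup>+a. (\<integral>\<^sup>+s. G s (- a) * indicator {..<- a} s \<partial>lborel) \<partial>lborel)"
  proof (rule nn_integral_cong)
    fix a :: real
    let ?c = "1 + a\<^sup>2"
    have c: "?c > 0" by (simp add: add_pos_nonneg)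
    have "(\<integral>\<^sup>+b. G (- (1 + a * b) / (b - a)) (- a) * (ennreal (?c / (b - a)\<^sup>2) * indicator {a<..} b) \<partial>lborel)
       = (\<integral>\<^sup>+u. G (- (1 + a * (a + u)) / u) (- a) * (ennreal (?c / u\<^sup>2) * indicator {a<..} (a + u)) \<partial>lborel)"
      by (subst nn_integral_real_affine[where c = 1 and t = a]) simp_all
    also have "\<dots> = (\<integral>\<^sup>+u. G (- a - ?c / u) (- a) * ennreal (?c / u\<^sup>2) * indicator {0<..} u \<partial>lborel)"
    proof (rule nn_integral_cong)
      fix u :: real
      have "- (1 + a * (a + u)) / u = - a - ?c / u" if "u > 0"
        using that by (simp add: field_simps power2_eq_square)
      then show "G (- (1 + a * (a + u)) / u) (- a) * (ennreal (?c / u\<^sup>2) * indicator {a<..} (a + u))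
          = G (- a - ?c / u) (- a) * ennreal (?c / u\<^sup>2) * indicator {0<..} u"
        by (auto simp: indicator_def)
    qed
    also have "\<dots> = (\<integral>\<^sup>+u. G (- a - u) (- a) * indicator {0<..} u \<partial>lborel)"
      by (rule nn_integral_inversion[OF _ c, symmetric]) measurable
    also have "\<dots> = (\<integral>\<^sup>+s. G s (- a) * indicator {..<- a} s \<partial>lborel)"
      by (subst (2) nn_integral_real_affine[where c = "-1" and t = "- a"])
         (auto intro!: nn_integral_cong simp: indicator_def)
    finally show "(\<integral>\<^sup>+b. G (- (1 + a * b) / (b - a)) (- a) * (ennreal (?c / (b - a)\<^sup>2) * indicator {a<..} b) \<partial>lborel)
       = (\<integral>\<^sup>+s. G s (- a) * indicator {..<- a} s \<partial>lborel)" .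
  qed
  also have "\<dots> = (\<integral>\<^sup>+a. (\<integral>\<^sup>+s. (if s < - a then G s (- a) else 0) \<partial>lborel) \<partial>lborel)"
    by (intro nn_integral_cong) (simp add: indicator_def)
  also have "\<dots> = (\<integral>\<^sup>+t. (\<integral>\<^sup>+s. (if s < t then G s t else 0) \<partial>lborel) \<partial>lborel)"
    by (subst nn_integral_real_affine[where c = "-1" and t = 0]) (simp_all cong: if_cong)
  also have "\<dots> = (\<integral>\<^sup>+s. (\<integral>\<^sup>+t. (if s < t then G s t else 0) \<partial>lborel) \<partial>lborel)"
    by (rule lborel_pair.Fubini') measurable
  also have "\<dots> = (\<integral>\<^sup>+s. (\<integral>\<^sup>+t. G s t * indicator {s<..} t \<partial>lborel) \<partial>lborel)"
    by (intro nn_integral_cong) (simp add: indicator_def)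
  also have "\<dots> = (\<integral>\<^sup>+y. v y * indicator (gauge_domain n) y \<partial>?N)"
    unfolding G_def
    by (subst two, measurable, intro nn_integral_cong, unfold dom mult.assoc[symmetric])
       (subst nn_integral_multc, measurable)
  finally show ?thesis .
qed

section \<open>The differential of the harmonic angle\<close>

text \<open>The partial derivative of \<open>position n x v\<close> with respect to \<open>x\<^sub>j\<close>; it does not depend on \<open>x\<close>.\<close>

definition velocity :: "nat \<Rightarrow> nat \<Rightarrow> vertex \<Rightarrow> complex" where
  "velocity n j v = (case v of FirstType i \<Rightarrow> if j = 2 * i then 1 else if j = 2 * i + 1 then \<i> else 0
                             | SecondType i \<Rightarrow> if j = 2 * n + i then 1 else 0)"

text \<open>The differential of \<open>arg ((z - w) (z - cnj w))\<close>, which is the harmonic angle up to a constant.\<close>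

definition angle_variation :: "complex \<Rightarrow> complex \<Rightarrow> complex \<Rightarrow> complex \<Rightarrow> real" where
  "angle_variation z w dz dw = Im ((dz - dw) / (z - w) + (dz - cnj dw) / (z - cnj w))"

lemma position_upd: "position n (x(j := s)) v = position n x v + of_real (s - x j) * velocity n j v"
  by (auto simp: position_def velocity_def complex_eq_iff split: vertex.splits)

lemma angle_form_eq:
  assumes "position n x (FirstType (fst e)) \<noteq> position n x (target \<Gamma> e)"
    and "position n x (FirstType (fst e)) \<noteq> cnj (position n x (target \<Gamma> e))"
  shows "angle_form n \<Gamma> x e j
       = angle_variation (position n x (FirstType (fst e))) (position n x (target \<Gamma> e))
           (velocity n j (FirstType (fst e))) (velocity n j (target \<Gamma> e))"
proof -
  define z w dz dw where "z = position n x (FirstType (fst e))" and "w = position n x (target \<Gamma> e)"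
    and "dz = velocity n j (FirstType (fst e))" and "dw = velocity n j (target \<Gamma> e)"
  define Z W where "Z = (\<lambda>s. z + of_real (s - x j) * dz)" and "W = (\<lambda>s. w + of_real (s - x j) * dw)"
  have ZW: "Z (x j) = z" "W (x j) = w" by (simp_all add: Z_def W_def)
  have dZ: "(Z has_vector_derivative dz) (at (x j))" "((\<lambda>s. cnj (Z s)) has_vector_derivative cnj dz) (at (x j))"
    "(W has_vector_derivative dw) (at (x j))" "((\<lambda>s. cnj (W s)) has_vector_derivative cnj dw) (at (x j))"
    unfolding Z_def W_def by (auto intro!: derivative_eq_intros)
  have nz: "z - w \<noteq> 0" "z - cnj w \<noteq> 0" "cnj z - w \<noteq> 0" "cnj z - cnj w \<noteq> 0"
    using assms by (auto simp: z_def w_def complex_eq_iff)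
  let ?\<rho> = "\<lambda>s. angle_ratio (Z s) (W s)"
  define N D N' D' where "N = (z - w) * (z - cnj w)" and "D = (cnj z - w) * (cnj z - cnj w)"
    and "N' = (z - w) * (dz - cnj dw) + (dz - dw) * (z - cnj w)"
    and "D' = (cnj z - w) * (cnj dz - cnj dw) + (cnj dz - dw) * (cnj z - cnj w)"
  have ND: "N \<noteq> 0" "D \<noteq> 0" using nz by (simp_all add: N_def D_def)
  have dN: "((\<lambda>s. (Z s - W s) * (Z s - cnj (W s))) has_vector_derivative N') (at (x j))"
    using has_vector_derivative_mult[OF has_vector_derivative_diff[OF dZ(1,3)] has_vector_derivative_diff[OF dZ(1,4)]]
    by (simp add: N'_def ZW)
  have dD: "((\<lambda>s. (cnj (Z s) - W s) * (cnj (Z s) - cnj (W s))) has_vector_derivative D') (at (x j))"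
    using has_vector_derivative_mult[OF has_vector_derivative_diff[OF dZ(2,3)] has_vector_derivative_diff[OF dZ(2,4)]]
    by (simp add: D'_def ZW)
  have "(?\<rho> has_vector_derivative (N' * D - N * D') / (D * D)) (at (x j))"
  proof -
    have "((\<lambda>s. inverse ((cnj (Z s) - W s) * (cnj (Z s) - cnj (W s)))) has_vector_derivative D' * (- (inverse D * 1 * inverse D))) (at (x j))"
    proof -
      have "(inverse has_field_derivative - (inverse D * 1 * inverse D)) (at D)"
        using ND by (auto intro!: derivative_eq_intros)
      then show ?thesis
        using field_vector_diff_chain_at[OF dD, of inverse "- (inverse D * 1 * inverse D)"]
        by (simp only: o_def ZW D_def)
    qed
    from has_vector_derivative_mult[OF dN this]
    have "((\<lambda>s. (Z s - W s) * (Z s - cnj (W s)) * inverse ((cnj (Z s) - W s) * (cnj (Z s) - cnj (W s))))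
      has_vector_derivative N * (D' * (- (inverse D * 1 * inverse D))) + N' * inverse D) (at (x j))"
      by (simp add: N_def D_def ZW)
    moreover have "N * (D' * (- (inverse D * 1 * inverse D))) + N' * inverse D = (N' * D - N * D') / (D * D)"
      using ND by (simp add: field_simps)
    ultimately show ?thesis by (simp only: angle_ratio_def divide_inverse)
  qed
  then have "((\<lambda>s. ?\<rho> s / ?\<rho> (x j)) has_vector_derivative (N' * D - N * D') / (D * D) / ?\<rho> (x j)) (at (x j))"
    by (rule has_vector_derivative_divide)
  moreover have \<rho>: "?\<rho> (x j) = N / D" by (simp add: angle_ratio_def ZW N_def D_def)
  moreover have "(N' * D - N * D') / (D * D) / (N / D) = N' / N - D' / D"
    using ND by (simp add: field_simps)
  ultimately have d: "((\<lambda>s. ?\<rho> s / ?\<rho> (x j)) has_vector_derivative N' / N - D' / D) (at (x j))"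
    by (simp only:)
  have "((\<lambda>s. Ln (?\<rho> s / ?\<rho> (x j))) has_vector_derivative (N' / N - D' / D) * 1) (at (x j))"
    using field_vector_diff_chain_at[OF d, of Ln 1] has_field_derivative_Ln[of 1] ND \<rho> by (simp add: o_def)
  then have 1: "((\<lambda>s. 1 / (2 * \<i>) * Ln (?\<rho> s / ?\<rho> (x j))) has_vector_derivative 1 / (2 * \<i>) * ((N' / N - D' / D) * 1)) (at (x j))"
    by (rule has_vector_derivative_mult_right)
  have "angle_form n \<Gamma> x e j = angle_velocity Z W (x j)"
    unfolding angle_form_def position_upd Z_def W_def z_def w_def dz_def dw_def ..
  also have "\<dots> = Re (1 / (2 * \<i>) * (N' / N - D' / D))"
    unfolding angle_velocity_def using vector_derivative_at[OF 1] by simp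
  also have "D' / D = cnj (N' / N)" by (simp add: N'_def D'_def N_def D_def mult.commute add.commute)
  also have "N' / N = (dz - dw) / (z - w) + (dz - cnj dw) / (z - cnj w)"
    using nz by (simp add: N'_def N_def field_simps)
  also have "Re (1 / (2 * \<i>) * (\<dots> - cnj \<dots>)) = Im \<dots>"
  proof -
    have "c - cnj c = 2 * \<i> * of_real (Im c)" for c by (simp add: complex_eq_iff)
    then have "1 / (2 * \<i>) * (c - cnj c) = of_real (Im c)" for c by simp
    then show ?thesis by (simp only: Re_complex_of_real)
  qed
  finally show ?thesis by (simp add: angle_variation_def z_def w_def dz_def dw_def)
qed

text \<open>The three functions in the cyclicity identity sit at three points of the circle \<open>\<real> \<union> {\<infinity>}\<close>: the third one,
  \<open>SecondType 2\<close>, at \<open>\<infinity>\<close>, and the harmonic angle towards \<open>\<infinity>\<close> is constant. For a loop \<open>v = FirstType k\<close> the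
  value is \<open>0\<close>: the first fraction is \<open>0/0 = 0\<close>, the second one is real.\<close>

definition angle_row :: "nat \<Rightarrow> nat \<Rightarrow> vertex \<Rightarrow> (nat \<Rightarrow> real) \<Rightarrow> nat \<Rightarrow> real" where
  "angle_row n k v y j =
     (if v = SecondType 2 then 0
      else angle_variation (position n (gauge_fix y) (FirstType k)) (position n (gauge_fix y) v)
             (velocity n j (FirstType k)) (velocity n j v))"

text \<open>Here \<open>p\<^sub>0\<close> is special, because its two coordinates are fixed by the gauge.\<close>

lemma sum_velocity:
  assumes "v \<in> vertices n 2" "n \<ge> 1"
  shows "(\<Sum>i\<in>{2..<2 * n + 2}. velocity n i v * of_real (f i)) = (if v = FirstType 0 then 0 else position n f v)"
proof (cases v)
  case (FirstType k)
  then have k: "k < n" using assms by (auto simp: vertices_def)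
  have "(\<Sum>i\<in>{2..<2 * n + 2}. velocity n i v * of_real (f i))
      = (\<Sum>i\<in>{2..<2 * n + 2}. (if i = 2 * k then of_real (f i) else 0) + (if i = 2 * k + 1 then \<i> * of_real (f i) else 0))"
    by (intro sum.cong) (auto simp: velocity_def FirstType)
  also have "\<dots> = (if v = FirstType 0 then 0 else position n f v)"
    using k by (auto simp: sum.distrib FirstType position_def complex_eq_iff)
  finally show ?thesis .
next
  case (SecondType k)
  then have k: "k < 2" using assms by (auto simp: vertices_def)
  have "(\<Sum>i\<in>{2..<2 * n + 2}. velocity n i v * of_real (f i))
      = (\<Sum>i\<in>{2..<2 * n + 2}. if i = 2 * n + k then of_real (f i) else 0)"
    by (intro sum.cong) (auto simp: velocity_def SecondType)
  also have "\<dots> = of_real (f (2 * n + k))"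
    using k assms by (subst sum.delta) auto
  finally show ?thesis by (simp add: SecondType position_def)
qed

lemma position_gauge_fix:
  assumes "v \<in> vertices n 2" "n \<ge> 1"
  shows "position n (gauge_fix y) v
       = position n (gauge_fix (\<lambda>_. 0)) v + (\<Sum>i\<in>{2..<2 * n + 2}. velocity n i v * of_real (y i))"
  unfolding sum_velocity[OF assms]
  using assms by (auto simp: position_def gauge_fix_def vertices_def complex_eq_iff split: vertex.splits)

lemma angle_variation_sum:
  "angle_variation z w (\<Sum>i\<in>I. dz i * of_real (f i)) (\<Sum>i\<in>I. dw i * of_real (f i))
     = (\<Sum>i\<in>I. angle_variation z w (dz i) (dw i) * f i)"
proof -
  have "(\<Sum>i\<in>I. angle_variation z w (dz i) (dw i) * f i)
      = Im (\<Sum>i\<in>I. ((dz i - dw i) / (z - w) + (dz i - cnj (dw i)) / (z - cnj w)) * of_real (f i))"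
    by (simp add: angle_variation_def)
  also have "(\<Sum>i\<in>I. ((dz i - dw i) / (z - w) + (dz i - cnj (dw i)) / (z - cnj w)) * of_real (f i))
      = ((\<Sum>i\<in>I. dz i * of_real (f i)) - (\<Sum>i\<in>I. dw i * of_real (f i))) / (z - w)
      + ((\<Sum>i\<in>I. dz i * of_real (f i)) - cnj (\<Sum>i\<in>I. dw i * of_real (f i))) / (z - cnj w)"
    by (simp add: sum_subtractf[symmetric] sum_divide_distrib sum.distrib[symmetric] algebra_simps
      diff_divide_distrib add_divide_distrib)
  finally show ?thesis unfolding angle_variation_def by simp
qed

section \<open>Linear combinations of differentials of arguments\<close>

text \<open>The span of the differentials of arguments. It contains the rows of the matrices whose determinants define the
  weights, and it is closed under the differences that arise when the base point of the angle is moved.\<close>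

inductive arg_combination :: "nat set \<Rightarrow> ((nat \<Rightarrow> real) \<Rightarrow> nat \<Rightarrow> real) \<Rightarrow> bool" for I where
  d_arg: "arg_combination I (d_arg I \<zeta>)"
| linear: "arg_combination I \<beta> \<Longrightarrow> arg_combination I \<gamma> \<Longrightarrow> arg_combination I (\<lambda>x i. a * \<beta> x i + b * \<gamma> x i)"

lemma arg_combination_zero: "arg_combination I (\<lambda>x i. 0)"
  using arg_combination.linear[OF arg_combination.d_arg arg_combination.d_arg, of I 0 _ 0] by simp

lemma arg_combination_diff:
  "arg_combination I \<beta> \<Longrightarrow> arg_combination I \<gamma> \<Longrightarrow> arg_combination I (\<lambda>x i. \<beta> x i - \<gamma> x i)"
  using arg_combination.linear[of I \<beta> \<gamma> 1 "-1"] by simp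

lemma integrable_wedge_arg_combination:
  assumes "finite I" "distinct js" "set js = I" "length \<beta>s = length js" "\<forall>\<beta>\<in>set \<beta>s. arg_combination I \<beta>"
  shows "integrable (lborel_on I) (\<lambda>x. wedge_covectors (map (\<lambda>\<beta>. \<beta> x) \<beta>s) js)"
proof -
  let ?M = "lborel_on I"
  have base: "integrable ?M (\<lambda>x. wedge_covectors (map (\<lambda>\<zeta>. d_arg I \<zeta> x) \<zeta>s) js)" if "length \<zeta>s = length js" for \<zeta>s
  proof (rule integrableI_bounded)
    have "(\<lambda>x. wedge_covectors (map (\<lambda>\<alpha>. \<alpha> x) (map (d_arg I) \<zeta>s)) js) \<in> borel_measurable ?M"
      by (rule borel_measurable_wedge_covectors) simp
    then show "(\<lambda>x. wedge_covectors (map (\<lambda>\<zeta>. d_arg I \<zeta> x) \<zeta>s) js) \<in> borel_measurable ?M"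
      by (simp add: o_def)
    show "(\<integral>\<^sup>+x. ennreal (norm (wedge_covectors (map (\<lambda>\<zeta>. d_arg I \<zeta> x) \<zeta>s) js)) \<partial>?M) < \<infinity>"
      using nn_integral_wedge_d_arg[OF assms(1-3) refl that] by (simp add: le_less_trans)
  qed
  have "integrable ?M (\<lambda>x. wedge_covectors (map (\<lambda>\<zeta>. d_arg I \<zeta> x) \<zeta>s @ map (\<lambda>\<beta>. \<beta> x) \<beta>s) js)"
    if "length \<zeta>s + length \<beta>s = length js" "\<forall>\<beta>\<in>set \<beta>s. arg_combination I \<beta>" for \<zeta>s \<beta>s
    using that
  proof (induction \<beta>s arbitrary: \<zeta>s)
    case Nil
    then show ?case using base[of \<zeta>s] by simp
  next
    case (Cons \<beta> \<beta>s)
    from Cons.prems(2) have "arg_combination I \<beta>" by simp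
    then show ?case
    proof (induction rule: arg_combination.induct)
      case (d_arg \<zeta>)
      then show ?case using Cons.IH[of "\<zeta>s @ [\<zeta>]"] Cons.prems by simp
    next
      case (linear \<beta> \<gamma> a b)
      then show ?case by (simp add: wedge_covectors_linear)
    qed
  qed
  from this[of "[]" \<beta>s] show ?thesis using assms by simp
qed

lemma arg_combination_angle_row:
  assumes "k < n" "v \<in> vertices n 3"
  shows "arg_combination {2..<2 * n + 2} (angle_row n k v)"
proof (cases "v = SecondType 2")
  case True
  then show ?thesis using arg_combination_zero by (simp add: angle_row_def[abs_def])
next
  case False
  then have v: "v \<in> vertices n 2" "FirstType k \<in> vertices n 2" and n: "n \<ge> 1"
    using assms by (auto simp: vertices_def less_Suc_eq numeral_3_eq_3 numeral_2_eq_2)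
  let ?I = "{2..<2 * n + 2}" and ?p = "position n (gauge_fix (\<lambda>_. 0))"
  let ?\<zeta> = "(?p (FirstType k) - ?p v, \<lambda>i. velocity n i (FirstType k) - velocity n i v)"
  let ?\<xi> = "(?p (FirstType k) - cnj (?p v), \<lambda>i. velocity n i (FirstType k) - cnj (velocity n i v))"
  have "affine_value ?I ?\<zeta> y = position n (gauge_fix y) (FirstType k) - position n (gauge_fix y) v"
    "affine_value ?I ?\<xi> y = position n (gauge_fix y) (FirstType k) - cnj (position n (gauge_fix y) v)" for y
    unfolding position_gauge_fix[OF v(1) n, of y] position_gauge_fix[OF v(2) n, of y]
    by (simp_all add: affine_value_def sum_subtractf left_diff_distrib)
  then have "angle_row n k v = (\<lambda>y i. 1 * d_arg ?I ?\<zeta> y i + 1 * d_arg ?I ?\<xi> y i)"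
    using False by (simp add: fun_eq_iff angle_row_def angle_variation_def d_arg_def)
  then show ?thesis
    using arg_combination.linear[OF arg_combination.d_arg[of ?I ?\<zeta>] arg_combination.d_arg[of ?I ?\<xi>], of 1 1]
    by (simp only:)
qed

section \<open>The rotation acts on angle forms\<close>

text \<open>The velocity of \<open>rotation q z\<close> when \<open>q\<close> and \<open>z\<close> move with velocities \<open>dq\<close> and \<open>dz\<close>.\<close>

definition rotation_velocity :: "real \<Rightarrow> complex \<Rightarrow> real \<Rightarrow> complex \<Rightarrow> complex" where
  "rotation_velocity q z dq dz =
     - of_real dq - of_real (2 * q * dq) / (z - of_real q)
     + of_real (1 + q\<^sup>2) * (dz - of_real dq) / (z - of_real q)\<^sup>2"

lemma cnj_rotation: "cnj (rotation q z) = rotation q (cnj z)"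
  by (simp add: rotation_def)

lemma cnj_rotation_velocity: "cnj (rotation_velocity q z dq dz) = rotation_velocity q (cnj z) dq (cnj dz)"
  by (simp add: rotation_velocity_def)

text \<open>The logarithmic derivative of \<open>rotation q z - rotation q w = (1 + q\<^sup>2) (z - w)/((z - q) (w - q))\<close>.\<close>

lemma rotation_log_derivative:
  assumes "z \<noteq> of_real q" "w \<noteq> of_real q" "z \<noteq> w"
  shows "(rotation_velocity q z dq dz - rotation_velocity q w dq dw) / (rotation q z - rotation q w)
       = (dz - dw) / (z - w) - (dz - of_real dq) / (z - of_real q) - (dw - of_real dq) / (w - of_real q)
         + of_real (2 * q * dq / (1 + q\<^sup>2))"
proof -
  define Z W A B c e where "Z = z - of_real q" and "W = w - of_real q" and "A = dz - of_real dq"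
    and "B = dw - of_real dq" and "c = complex_of_real (1 + q\<^sup>2)" and "e = complex_of_real (2 * q * dq)"
  have nz: "Z \<noteq> 0" "W \<noteq> 0" "Z - W \<noteq> 0" using assms by (auto simp: Z_def W_def)
  have "1 + q\<^sup>2 > 0" by (simp add: add_pos_nonneg)
  then have c: "c \<noteq> 0" unfolding c_def by (metis less_irrefl of_real_eq_0_iff)
  have 1: "rotation q z - rotation q w = c * (Z - W) / (Z * W)"
    unfolding rotation_alt[OF assms(1)] rotation_alt[OF assms(2)] Z_def[symmetric] W_def[symmetric] c_def[symmetric]
    using nz by (simp add: field_simps)
  have 2: "rotation_velocity q z dq dz - rotation_velocity q w dq dw
      = (e * (Z - W) * Z * W + c * (A * W\<^sup>2 - B * Z\<^sup>2)) / (Z * W)\<^sup>2"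
    unfolding rotation_velocity_def Z_def[symmetric] W_def[symmetric] A_def[symmetric] B_def[symmetric] c_def[symmetric] e_def[symmetric]
    using nz by (simp add: divide_simps) (simp add: algebra_simps power2_eq_square)
  have AB: "(dz - dw) / (z - w) = (A - B) / (Z - W)" by (simp add: A_def B_def Z_def W_def)
  have 3: "(dz - dw) / (z - w) - (dz - of_real dq) / (z - of_real q) - (dw - of_real dq) / (w - of_real q)
      = (A * W\<^sup>2 - B * Z\<^sup>2) / (Z * W * (Z - W))"
  proof -
    have "(a - b) / (u - v) - a / u - b / v = (a * v\<^sup>2 - b * u\<^sup>2) / (u * v * (u - v))"
      if "u \<noteq> 0" "v \<noteq> 0" "u - v \<noteq> 0" for a b u v :: complex
      using that by (simp add: divide_simps) (simp add: algebra_simps power2_eq_square)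
    from this[OF nz] show ?thesis
      unfolding AB unfolding Z_def[symmetric] W_def[symmetric] A_def[symmetric] B_def[symmetric] .
  qed
  have 4: "complex_of_real (2 * q * dq / (1 + q\<^sup>2)) = e / c" by (simp add: e_def c_def)
  have "(e * (Z - W) * Z * W + c * (A * W\<^sup>2 - B * Z\<^sup>2)) / (Z * W)\<^sup>2 / (c * (Z - W) / (Z * W))
      = (A * W\<^sup>2 - B * Z\<^sup>2) / (Z * W * (Z - W)) + e / c"
  proof -
    have "(e * (Z - W) * Z * W + c * R) / (Z * W)\<^sup>2 / (c * (Z - W) / (Z * W)) = R / (Z * W * (Z - W)) + e / c" for R
      using nz c by (simp add: divide_simps) (simp add: algebra_simps power2_eq_square)
    then show ?thesis .
  qed
  then show ?thesis unfolding 1 2 3 4 .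
qed

text \<open>In the sum over \<open>w\<close> and \<open>cnj w\<close> the terms \<open>d log (w - q)\<close> and \<open>d log (cnj w - q)\<close> are conjugate, so that their
  imaginary parts cancel, and \<open>2 d arg (z - q)\<close> is the angle towards \<open>q\<close>.\<close>

lemma angle_variation_rotation:
  assumes "z \<noteq> of_real q" "w \<noteq> of_real q" "z \<noteq> w" "z \<noteq> cnj w"
  shows "angle_variation (rotation q z) (rotation q w) (rotation_velocity q z dq dz) (rotation_velocity q w dq dw)
       = angle_variation z w dz dw - angle_variation z (of_real q) dz (of_real dq)"
proof -
  have "cnj w \<noteq> of_real q" using assms(2) by (metis complex_cnj_cnj complex_cnj_complex_of_real)
  note * = rotation_log_derivative[OF assms(1,2,3), of dq dz dw] rotation_log_derivative[OF assms(1) this assms(4), of dq dz "cnj dw"]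
  have "(cnj dw - of_real dq) / (cnj w - of_real q) = cnj ((dw - of_real dq) / (w - of_real q))" by simp
  then have "Im ((cnj dw - of_real dq) / (cnj w - of_real q)) = - Im ((dw - of_real dq) / (w - of_real q))" by (simp only: cnj.sel)
  then show ?thesis
    unfolding angle_variation_def cnj_rotation cnj_rotation_velocity * complex_cnj_complex_of_real
      plus_complex.sel minus_complex.sel Im_complex_of_real by linarith
qed

text \<open>The limit \<open>w \<rightarrow> \<infinity>\<close> of the previous lemma: \<open>rotation q\<close> sends \<open>\<infinity>\<close> to \<open>- q\<close>.\<close>

lemma angle_variation_rotation_infinity:
  assumes "z \<noteq> of_real q"
  shows "angle_variation (rotation q z) (of_real (- q)) (rotation_velocity q z dq dz) (of_real (- dq))
       = - angle_variation z (of_real q) dz (of_real dq)"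
proof -
  define Z A c e where "Z = z - of_real q" and "A = dz - of_real dq"
    and "c = complex_of_real (1 + q\<^sup>2)" and "e = complex_of_real (2 * q * dq)"
  have Z: "Z \<noteq> 0" using assms by (simp add: Z_def)
  have "1 + q\<^sup>2 > 0" by (simp add: add_pos_nonneg)
  then have c: "c \<noteq> 0" unfolding c_def by (metis less_irrefl of_real_eq_0_iff)
  have "rotation q z - of_real (- q) = - c / Z"
    unfolding rotation_alt[OF assms] Z_def[symmetric] c_def[symmetric] by simp
  moreover have "rotation_velocity q z dq dz - of_real (- dq) = - e / Z + c * A / Z\<^sup>2"
    unfolding rotation_velocity_def by (simp add: Z_def c_def e_def A_def)
  moreover have "(- e / Z + c * A / Z\<^sup>2) / (- c / Z) = e / c - A / Z"
    using Z c by (simp add: field_simps power2_eq_square)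
  moreover have "e / c = of_real (2 * q * dq / (1 + q\<^sup>2))" by (simp add: e_def c_def)
  ultimately have "(rotation_velocity q z dq dz - of_real (- dq)) / (rotation q z - of_real (- q))
      = of_real (2 * q * dq / (1 + q\<^sup>2)) - (dz - of_real dq) / (z - of_real q)"
    by (simp only: A_def Z_def)
  then show ?thesis
    unfolding angle_variation_def complex_cnj_complex_of_real
    by (simp only: plus_complex.sel minus_complex.sel Im_complex_of_real)
qed

text \<open>The vertex at which the function of \<open>v\<close> sits after the rotation: the first function goes to \<open>\<infinity>\<close>, the second and
  the third one take the first and the second real point.\<close>

definition cyclic_vertex :: "vertex \<Rightarrow> vertex" where
  "cyclic_vertex v = (case v of FirstType k \<Rightarrow> FirstType k
     | SecondType j \<Rightarrow> SecondType (if j = 0 then 2 else if j = 1 then 0 else if j = 2 then 1 else j))"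

text \<open>The Jacobian matrix of \<open>rotated_configuration n\<close>.\<close>

definition rotation_matrix :: "nat \<Rightarrow> (nat \<Rightarrow> real) \<Rightarrow> nat \<Rightarrow> nat \<Rightarrow> real" where
  "rotation_matrix n y i j =
     (let q = y (2 * n); dq = Re (velocity n j (SecondType 0));
          D = (\<lambda>v. rotation_velocity q (position n (gauge_fix y) v) dq (velocity n j v))
      in if i < 2 * n then (if even i then Re else Im) (D (FirstType (i div 2)))
         else if i = 2 * n then Re (D (SecondType 1)) else - dq)"

lemma rotation_imaginary_unit: "rotation q \<i> = \<i>"
proof -
  have "\<i> - of_real q \<noteq> 0" by (simp add: complex_eq_iff)
  then show ?thesis by (simp add: rotation_def divide_eq_eq algebra_simps)
qed

lemma rotation_velocity_imaginary_unit: "rotation_velocity q \<i> dq 0 = 0"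
proof -
  have nz: "\<i> - of_real q \<noteq> 0" by (simp add: complex_eq_iff)
  have zero: "(\<i> - of_real q)\<^sup>2 + of_real (2 * q) * (\<i> - of_real q) + of_real (1 + q\<^sup>2) = 0"
    by (simp add: power2_eq_square algebra_simps)
  have "- d - e * d / Z + C * (0 - d) / Z\<^sup>2 = - d * (Z\<^sup>2 + e * Z + C) / Z\<^sup>2" if "Z \<noteq> 0" for d e C Z :: complex
    using that by (simp add: divide_simps) (simp add: algebra_simps power2_eq_square)
  from this[OF nz, of "of_real dq" "of_real (2 * q)" "of_real (1 + q\<^sup>2)"]
  show ?thesis unfolding rotation_velocity_def of_real_mult[of "2 * q" dq] zero by simp
qed

lemma position_rotated:
  assumes "n \<ge> 1" "y \<in> gauge_domain n"
  defines "q \<equiv> y (2 * n)"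
  shows "k < n \<Longrightarrow> position n (gauge_fix (rotated_configuration n y)) (FirstType k)
           = rotation q (position n (gauge_fix y) (FirstType k))"
    and "position n (gauge_fix (rotated_configuration n y)) (SecondType 0)
           = rotation q (position n (gauge_fix y) (SecondType 1))"
    and "position n (gauge_fix (rotated_configuration n y)) (SecondType 1) = of_real (- q)"
proof -
  show "position n (gauge_fix (rotated_configuration n y)) (FirstType k)
           = rotation q (position n (gauge_fix y) (FirstType k))" if "k < n"
  proof (cases "k = 0")
    case True
    have "Complex 0 1 = \<i>" by (simp add: complex_eq_iff)
    then show ?thesis using rotation_imaginary_unit by (simp add: True position_def gauge_fix_def)
  next
    case False
    then show ?thesis using that
      by (simp add: position_def gauge_fix_def rotated_configuration_def rotated_coordinate_def q_def)
  qed
  have "y (2 * n) < y (2 * n + 1)" using assms by (auto simp: gauge_domain_def)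
  then show "position n (gauge_fix (rotated_configuration n y)) (SecondType 0)
           = rotation q (position n (gauge_fix y) (SecondType 1))"
    using assms(1) by (simp add: position_def gauge_fix_def rotated_configuration_def rotation_def q_def)
  show "position n (gauge_fix (rotated_configuration n y)) (SecondType 1) = of_real (- q)"
    using assms(1) by (simp add: position_def gauge_fix_def rotated_configuration_def q_def)
qed

lemma velocity_rotated:
  fixes y :: "nat \<Rightarrow> real"
  assumes "n \<ge> 1" "j \<in> {2..<2 * n + 2}"
  defines "q \<equiv> y (2 * n)" and "dq \<equiv> Re (velocity n j (SecondType 0))"
  shows "k < n \<Longrightarrow> (\<Sum>i\<in>{2..<2 * n + 2}. velocity n i (FirstType k) * of_real (rotation_matrix n y i j))
           = rotation_velocity q (position n (gauge_fix y) (FirstType k)) dq (velocity n j (FirstType k))"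
    and "(\<Sum>i\<in>{2..<2 * n + 2}. velocity n i (SecondType 0) * of_real (rotation_matrix n y i j))
           = rotation_velocity q (position n (gauge_fix y) (SecondType 1)) dq (velocity n j (SecondType 1))"
    and "(\<Sum>i\<in>{2..<2 * n + 2}. velocity n i (SecondType 1) * of_real (rotation_matrix n y i j)) = of_real (- dq)"
proof -
  have v: "SecondType 0 \<in> vertices n 2" "SecondType 1 \<in> vertices n 2" by (auto simp: vertices_def)
  let ?f = "\<lambda>i. rotation_matrix n y i j"
  have positions: "position n ?f (FirstType k) = Complex (?f (2 * k)) (?f (2 * k + 1))"
    "position n ?f (SecondType k) = of_real (?f (2 * n + k))" for k by (simp_all add: position_def)
  show "(\<Sum>i\<in>{2..<2 * n + 2}. velocity n i (FirstType k) * of_real (rotation_matrix n y i j))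
           = rotation_velocity q (position n (gauge_fix y) (FirstType k)) dq (velocity n j (FirstType k))" if k: "k < n"
  proof (cases "k = 0")
    case True
    have "Complex 0 1 = \<i>" by (simp add: complex_eq_iff)
    then have "position n (gauge_fix y) (FirstType k) = \<i>" "velocity n j (FirstType k) = 0"
      using assms by (simp_all add: True position_def gauge_fix_def velocity_def)
    moreover have "FirstType k \<in> vertices n 2" using k by (auto simp: vertices_def)
    ultimately show ?thesis using assms(1) True by (subst sum_velocity) (simp_all add: rotation_velocity_imaginary_unit)
  next
    case False
    have "FirstType k \<in> vertices n 2" using k by (auto simp: vertices_def)
    then show ?thesis using False k assms(1)
      by (subst sum_velocity) (simp_all only: positions, simp_all add: rotation_matrix_def Let_def q_def dq_def)
  qed
  show "(\<Sum>i\<in>{2..<2 * n + 2}. velocity n i (SecondType 0) * of_real (rotation_matrix n y i j))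
           = rotation_velocity q (position n (gauge_fix y) (SecondType 1)) dq (velocity n j (SecondType 1))"
  proof -
    have "Im (velocity n j (SecondType 1)) = 0" by (simp add: velocity_def)
    then have "rotation_velocity q (position n (gauge_fix y) (SecondType 1)) dq (velocity n j (SecondType 1)) \<in> \<real>"
      unfolding rotation_velocity_def position_def using complex_is_Real_iff
      by (auto intro!: Reals_diff Reals_add Reals_mult Reals_divide Reals_minus Reals_power)
    then show ?thesis using v assms(1)
      by (subst sum_velocity) (simp_all only: positions, simp_all add: rotation_matrix_def Let_def q_def dq_def)
  qed
  show "(\<Sum>i\<in>{2..<2 * n + 2}. velocity n i (SecondType 1) * of_real (rotation_matrix n y i j)) = of_real (- dq)"
    using v assms(1)
    by (subst sum_velocity) (simp_all only: positions, simp_all add: rotation_matrix_def Let_def q_def dq_def)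
qed

lemma configurations_imp_gauge_domain:
  assumes "n \<ge> 1" "gauge_fix y \<in> configurations n 2"
  shows "y \<in> gauge_domain n"
proof -
  have "0 < y (2 * l + 1)" if "l \<in> {1..<n}" for l
    using assms(2) that by (auto simp: configurations_def position_def gauge_fix_def)
  moreover have "\<forall>i j. i < j \<longrightarrow> j < 2 \<longrightarrow> gauge_fix y (2 * n + i) < gauge_fix y (2 * n + j)"
    using assms(2) by (simp add: configurations_def)
  from this[rule_format, of 0 1] have "gauge_fix y (2 * n + 0) < gauge_fix y (2 * n + 1)" by simp
  ultimately show ?thesis using assms(1) by (simp add: gauge_domain_def upper_points_def gauge_fix_def)
qed

text \<open>Moving the boundary point \<open>q\<close> to \<open>\<infinity>\<close> subtracts from each angle the angle towards \<open>q\<close>.\<close>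

lemma angle_row_rotated:
  assumes n: "n \<ge> 1" and conf: "gauge_fix y \<in> configurations n 2" and k: "k < n"
    and v: "v \<in> vertices n 3" "v \<noteq> FirstType k" and j: "j \<in> {2..<2 * n + 2}"
  shows "angle_row n k v y j - angle_row n k (SecondType 0) y j
       = (\<Sum>i\<in>{2..<2 * n + 2}. angle_row n k (cyclic_vertex v) (rotated_configuration n y) i * rotation_matrix n y i j)"
proof -
  define q dq where "q = y (2 * n)" and "dq = Re (velocity n j (SecondType 0))"
  let ?p = "position n (gauge_fix y)" and ?p' = "position n (gauge_fix (rotated_configuration n y))"
  let ?I = "{2..<2 * n + 2}"
  have upper: "Im (?p (FirstType l)) > 0" if "l < n" for l
    using conf that by (auto simp: configurations_def)
  have y: "y \<in> gauge_domain n" using configurations_imp_gauge_domain[OF n conf] .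
  have q: "?p (SecondType 0) = of_real q" "velocity n j (SecondType 0) = of_real dq"
    using n by (simp_all add: position_def gauge_fix_def q_def velocity_def dq_def)
  have zq: "?p (FirstType l) \<noteq> of_real q" if "l < n" for l
    using upper[OF that] by (auto simp: complex_eq_iff)
  note pos = position_rotated[OF n y, folded q_def]
  note vel = velocity_rotated[OF n j, where y = y, folded q_def dq_def]
  have row: "(\<Sum>i\<in>?I. angle_row n k u (rotated_configuration n y) i * rotation_matrix n y i j)
      = angle_variation (?p' (FirstType k)) (?p' u)
          (\<Sum>i\<in>?I. velocity n i (FirstType k) * of_real (rotation_matrix n y i j))
          (\<Sum>i\<in>?I. velocity n i u * of_real (rotation_matrix n y i j))" if "u \<noteq> SecondType 2" for u
    unfolding angle_variation_sum using that by (simp add: angle_row_def)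
  have inj: "?p (FirstType l) = ?p (FirstType k) \<Longrightarrow> l = k" if "l < n" for l
    using conf k that by (auto simp: configurations_def inj_on_def)
  consider (first) l where "v = FirstType l" "l < n" "l \<noteq> k" | (zero) "v = SecondType 0"
    | (one) "v = SecondType 1" | (two) "v = SecondType 2"
    using v by (auto simp: vertices_def less_Suc_eq numeral_3_eq_3)
  then show ?thesis
  proof cases
    case first
    have "?p (FirstType k) \<noteq> cnj (?p (FirstType l))" using upper[OF k] upper[OF first(2)] by (auto simp: complex_eq_iff)
    moreover have "?p (FirstType k) \<noteq> ?p (FirstType l)" using inj first by metis
    ultimately show ?thesis
      using angle_variation_rotation[OF zq[OF k] zq[OF first(2)], of dq "velocity n j (FirstType k)" "velocity n j (FirstType l)"]
      by (simp only: first(1) cyclic_vertex_def vertex.case row pos(1)[OF k] pos(1)[OF first(2)] vel(1)[OF k] vel(1)[OF first(2)] vertex.distinct not_False_eq_True)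
         (simp add: angle_row_def q)
  next
    case zero
    then show ?thesis by (simp add: cyclic_vertex_def angle_row_def)
  next
    case one
    have real: "?p (SecondType 1) = of_real (y (2 * n + 1))" using n by (simp add: position_def gauge_fix_def)
    have "?p (FirstType k) \<noteq> ?p (SecondType 1)" "?p (FirstType k) \<noteq> cnj (?p (SecondType 1))"
      using upper[OF k] unfolding real by (auto simp: complex_eq_iff)
    moreover have "?p (SecondType 1) \<noteq> of_real q" using y unfolding real by (auto simp: gauge_domain_def q_def)
    moreover have "cyclic_vertex v = SecondType 0" by (simp add: one cyclic_vertex_def)
    ultimately have "(\<Sum>i\<in>?I. angle_row n k (cyclic_vertex v) (rotated_configuration n y) i * rotation_matrix n y i j)
       = angle_variation (?p (FirstType k)) (?p (SecondType 1)) (velocity n j (FirstType k)) (velocity n j (SecondType 1))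
       - angle_variation (?p (FirstType k)) (of_real q) (velocity n j (FirstType k)) (of_real dq)"
      using zq[OF k] by (simp only:, subst row, simp, unfold pos(1)[OF k] pos(2) vel(1)[OF k] vel(2))
        (rule angle_variation_rotation)
    then show ?thesis by (simp add: one angle_row_def q)
  next
    case two
    have c: "cyclic_vertex v = SecondType 1" by (simp add: two cyclic_vertex_def)
    have "(\<Sum>i\<in>?I. angle_row n k (cyclic_vertex v) (rotated_configuration n y) i * rotation_matrix n y i j)
       = - angle_variation (?p (FirstType k)) (of_real q) (velocity n j (FirstType k)) (of_real dq)"
      unfolding c by (subst row, simp, unfold pos(1)[OF k] pos(3) vel(1)[OF k] vel(3))
        (rule angle_variation_rotation_infinity[OF zq[OF k]])
    then show ?thesis by (simp add: two angle_row_def q)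
  qed
qed


section \<open>The Jacobian determinant\<close>

lemma det_2x2:
  fixes f :: "nat \<times> nat \<Rightarrow> 'a :: idom"
  shows "det (mat 2 2 f) = f (0, 0) * f (1, 1) - f (0, 1) * f (1, 0)"
proof -
  let ?M = "\<lambda>a. mat 1 1 (\<lambda>_. a)"
  have "mat 2 2 f = four_block_mat (?M (f (0, 0))) (?M (f (0, 1))) (?M (f (1, 0))) (?M (f (1, 1)))"
  proof (rule eq_matI)
    fix i j assume "i < dim_row (four_block_mat (?M (f (0, 0))) (?M (f (0, 1))) (?M (f (1, 0))) (?M (f (1, 1))))"
      "j < dim_col (four_block_mat (?M (f (0, 0))) (?M (f (0, 1))) (?M (f (1, 0))) (?M (f (1, 1))))"
    then have "i = 0 \<or> i = 1" "j = 0 \<or> j = 1" by auto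
    then show "mat 2 2 f $$ (i, j) = four_block_mat (?M (f (0, 0))) (?M (f (0, 1))) (?M (f (1, 0))) (?M (f (1, 1))) $$ (i, j)"
      by auto
  qed auto
  moreover have "det (four_block_mat (?M (f (0, 0))) (?M (f (0, 1))) (?M (f (1, 0))) (?M (f (1, 1)))) = det (?M (f (0, 0)) * ?M (f (1, 1)) - ?M (f (0, 1)) * ?M (f (1, 0)))"
    by (rule det_four_block_mat[where n = 1]) (auto intro!: eq_matI simp: scalar_prod_def)
  moreover have "?M (f (0, 0)) * ?M (f (1, 1)) - ?M (f (0, 1)) * ?M (f (1, 0)) = ?M (f (0, 0) * f (1, 1) - f (0, 1) * f (1, 0))"
    by (intro eq_matI) (auto simp: scalar_prod_def)
  ultimately show ?thesis by (simp add: det_single)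
qed

lemma det_block_diagonal:
  fixes B :: "nat \<Rightarrow> nat \<Rightarrow> nat \<Rightarrow> 'a :: idom"
  shows "det (mat (2 * m) (2 * m) (\<lambda>(a, b). if a div 2 = b div 2 then B (a div 2) (a mod 2) (b mod 2) else 0))
       = (\<Prod>k<m. B k 0 0 * B k 1 1 - B k 0 1 * B k 1 0)"
proof (induction m)
  case (Suc m)
  let ?f = "\<lambda>(a, b). if a div 2 = b div 2 then B (a div 2) (a mod 2) (b mod 2) else 0"
  have "mat (2 * Suc m) (2 * Suc m) ?f
      = four_block_mat (mat (2 * m) (2 * m) ?f) (0\<^sub>m (2 * m) 2) (0\<^sub>m 2 (2 * m)) (mat 2 2 (\<lambda>(a, b). B m a b))"
  proof (rule eq_matI)
    let ?R = "four_block_mat (mat (2 * m) (2 * m) ?f) (0\<^sub>m (2 * m) 2) (0\<^sub>m 2 (2 * m)) (mat 2 2 (\<lambda>(a, b). B m a b))"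
    fix i j assume "i < dim_row ?R" "j < dim_col ?R"
    then have "i < 2 * m \<and> i div 2 < m \<or> i = 2 * m \<or> i = 2 * m + 1" "j < 2 * m \<and> j div 2 < m \<or> j = 2 * m \<or> j = 2 * m + 1"
      by auto
    then show "mat (2 * Suc m) (2 * Suc m) ?f $$ (i, j) = ?R $$ (i, j)"
      by (elim disjE) auto
  qed auto
  then show ?case
    by (simp add: det_four_block_mat_upper_right_zero[where n = "2 * m" and m = 2] Suc.IH det_2x2)
qed simp

text \<open>The points in the half-plane contribute conformal blocks of size two. The derivatives of the new boundary points in
  the coordinates of the inner points vanish, so the matrix is block triangular.\<close>

lemma det_rotation_matrix:
  assumes n: "n \<ge> 1" and y: "y \<in> gauge_domain n"
  shows "det (mat (2 * n) (2 * n) (\<lambda>(a, b). rotation_matrix n y (a + 2) (b + 2))) = rotation_jacobian n y"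
proof -
  define q where "q = y (2 * n)"
  let ?p = "position n (gauge_fix y)" and ?f = "\<lambda>(a, b). rotation_matrix n y (a + 2) (b + 2)"
  define m where "m = n - 1"
  have m: "n = Suc m" using n by (simp add: m_def)
  define d where "d = (\<lambda>k. of_real (1 + q\<^sup>2) / (?p (FirstType (Suc k)) - of_real q)\<^sup>2)"
  define B where "B = (\<lambda>(k::nat) (r::nat) (s::nat). (if r = 0 then Re else Im) (d k * (if s = 0 then 1 else \<i>)) :: real)"
  have "mat (2 * n) (2 * n) ?f
      = four_block_mat (mat (2 * m) (2 * m) (\<lambda>(a, b). if a div 2 = b div 2 then B (a div 2) (a mod 2) (b mod 2) else 0))
          (mat (2 * m) 2 (\<lambda>(a, b). ?f (a, b + 2 * m))) (0\<^sub>m 2 (2 * m)) (mat 2 2 (\<lambda>(a, b). ?f (a + 2 * m, b + 2 * m)))"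
    (is "_ = four_block_mat ?A _ _ ?D")
  proof (rule eq_matI)
    fix a b assume "a < dim_row (four_block_mat ?A (mat (2 * m) 2 (\<lambda>(a, b). ?f (a, b + 2 * m))) (0\<^sub>m 2 (2 * m)) ?D)"
      "b < dim_col (four_block_mat ?A (mat (2 * m) 2 (\<lambda>(a, b). ?f (a, b + 2 * m))) (0\<^sub>m 2 (2 * m)) ?D)"
    then have ab: "a < 2 * n" "b < 2 * n" by (auto simp: m)
    have dq: "velocity n (Suc (Suc b)) (SecondType 0) = 0" if "b < 2 * m" using that by (simp add: velocity_def m)
    have dv: "velocity n (Suc (Suc b)) (FirstType (Suc k)) = (if b div 2 = k then if b mod 2 = 0 then 1 else \<i> else 0)" for k
    proof -
      have "Suc (Suc b) = 2 * Suc k \<longleftrightarrow> b div 2 = k \<and> b mod 2 = 0" by presburger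
      moreover have "Suc (Suc b) = 2 * Suc k + 1 \<longleftrightarrow> b div 2 = k \<and> b mod 2 = 1" by presburger
      ultimately show ?thesis unfolding velocity_def by auto
    qed
    have up: "?f (a, b) = (if a div 2 = b div 2 then B (a div 2) (a mod 2) (b mod 2) else 0)" if "a < 2 * m" "b < 2 * m"
    proof -
      have "?f (a, b) = (if even a then Re else Im) (rotation_velocity q (?p (FirstType (Suc (a div 2)))) 0 (velocity n (b + 2) (FirstType (Suc (a div 2)))))"
      proof -
        have "a + 2 < 2 * n" using that m by simp
        then show ?thesis using that by (simp add: rotation_matrix_def Let_def dq q_def)
      qed
      also have "rotation_velocity q (?p (FirstType (Suc (a div 2)))) 0 (velocity n (b + 2) (FirstType (Suc (a div 2))))
          = d (a div 2) * (if b div 2 = a div 2 then if b mod 2 = 0 then 1 else \<i> else 0)"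
        by (simp only: add_2_eq_Suc' dv rotation_velocity_def d_def) simp
      finally show ?thesis
        by (auto simp: B_def)
    qed
    have low: "?f (a, b) = 0" if "\<not> a < 2 * m" "b < 2 * m"
      using that ab by (auto simp: rotation_matrix_def Let_def dq m rotation_velocity_def velocity_def)
    show "mat (2 * n) (2 * n) ?f $$ (a, b)
       = four_block_mat ?A (mat (2 * m) 2 (\<lambda>(a, b). ?f (a, b + 2 * m))) (0\<^sub>m 2 (2 * m)) ?D $$ (a, b)"
      using ab up low by (auto simp: m)
  qed (auto simp: m)
  then have "det (mat (2 * n) (2 * n) ?f) = det ?A * det ?D"
    by (simp add: det_four_block_mat_lower_left_zero[where n = "2 * m" and m = 2])
  moreover have "det ?D = (1 + q\<^sup>2) / (y (2 * n + 1) - q)\<^sup>2"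
  proof -
    have lt: "y (2 * n) < y (2 * n + 1)" using y by (simp add: gauge_domain_def)
    have "rotation_matrix n y (2 * n + 1) (2 * n) = - 1" "rotation_matrix n y (2 * n + 1) (2 * n + 1) = 0"
      by (simp_all add: rotation_matrix_def Let_def velocity_def)
    moreover have "rotation_matrix n y (2 * n) (2 * n + 1) = (1 + q\<^sup>2) / (y (2 * n + 1) - q)\<^sup>2"
    proof -
      have "?p (SecondType 1) = of_real (y (2 * n + 1))" using n by (simp add: position_def gauge_fix_def)
      then have "rotation_matrix n y (2 * n) (2 * n + 1)
          = Re (of_real (1 + q\<^sup>2) / (of_real (y (2 * n + 1)) - of_real q)\<^sup>2)"
        by (simp add: rotation_matrix_def Let_def velocity_def rotation_velocity_def q_def)
      also have "of_real (1 + q\<^sup>2) / (of_real (y (2 * n + 1)) - of_real q)\<^sup>2 = complex_of_real ((1 + q\<^sup>2) / (y (2 * n + 1) - q)\<^sup>2)"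
        by simp
      finally show ?thesis by simp
    qed
    ultimately show ?thesis unfolding det_2x2 by (simp add: m)
  qed
  moreover have "det ?A = point_jacobian n q y"
  proof -
    have "B k 0 0 * B k 1 1 - B k 0 1 * B k 1 0 = ((1 + q\<^sup>2) / ((y (2 * Suc k) - q)\<^sup>2 + (y (2 * Suc k + 1))\<^sup>2))\<^sup>2" for k
    proof -
      have "B k 0 0 * B k 1 1 - B k 0 1 * B k 1 0 = (cmod (d k))\<^sup>2"
        unfolding cmod_power2 by (simp add: B_def power2_eq_square)
      also have "cmod (d k) = (1 + q\<^sup>2) / (cmod (?p (FirstType (Suc k)) - of_real q))\<^sup>2"
      proof -
        have "cmod (of_real (1 + q\<^sup>2)) = 1 + q\<^sup>2" unfolding norm_of_real by simp
        then show ?thesis unfolding d_def norm_divide norm_power by simp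
      qed
      also have "(cmod (?p (FirstType (Suc k)) - of_real q))\<^sup>2 = (y (2 * Suc k) - q)\<^sup>2 + (y (2 * Suc k + 1))\<^sup>2"
        by (simp add: cmod_power2 position_def gauge_fix_def)
      finally show ?thesis .
    qed
    then have "det ?A = (\<Prod>k<m. ((1 + q\<^sup>2) / ((y (2 * Suc k) - q)\<^sup>2 + (y (2 * Suc k + 1))\<^sup>2))\<^sup>2)"
      unfolding det_block_diagonal by simp
    also have "\<dots> = point_jacobian n q y"
      unfolding point_jacobian_def m
      by (subst prod.reindex_bij_witness[where j = Suc and i = "\<lambda>k. k - 1" and T = "{1..<Suc m}"
            and h = "\<lambda>k. ((1 + q\<^sup>2) / ((y (2 * k) - q)\<^sup>2 + (y (2 * k + 1))\<^sup>2))\<^sup>2"]) auto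
    finally show ?thesis .
  qed
  ultimately show ?thesis by (simp add: rotation_jacobian_def q_def)
qed

section \<open>Weight integrals and their cyclic symmetry\<close>

text \<open>The edge list of every graph with \<open>n\<close> stars of length two, the only graphs that matter for a bivector field.\<close>

definition star_edges :: "nat \<Rightarrow> (nat \<times> nat) list" where
  "star_edges n = [(k, l). k \<leftarrow> [0..<n], l \<leftarrow> [0..<2]]"

lemma set_star_edges: "set (star_edges n) = {..<n} \<times> {..<2}"
  by (auto simp: star_edges_def)

lemma length_star_edges: "length (star_edges n) = 2 * n"
  by (induction n) (simp_all add: star_edges_def)

lemma distinct_star_edges: "distinct (star_edges n)"
  by (induction n) (auto simp: star_edges_def numeral_2_eq_2)

definition configuration_form ::
    "nat \<Rightarrow> (nat \<times> nat \<Rightarrow> (nat \<Rightarrow> real) \<Rightarrow> nat \<Rightarrow> real) \<Rightarrow> (nat \<Rightarrow> real) \<Rightarrow> real" where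
  "configuration_form n \<rho> y =
     indicator (configurations n 2) (gauge_fix y) * wedge_covectors (map (\<lambda>e. \<rho> e y) (star_edges n)) [2..<2 * n + 2]"

text \<open>The integral in the weight, up to normalisation, with arbitrary one-forms \<open>\<rho> e\<close> in place of the angle forms.\<close>

definition configuration_integral ::
    "nat \<Rightarrow> (nat \<times> nat \<Rightarrow> (nat \<Rightarrow> real) \<Rightarrow> nat \<Rightarrow> real) \<Rightarrow> real" where
  "configuration_integral n \<rho> = (LINT y | lborel_on {2..<2 * n + 2}. configuration_form n \<rho> y)"

lemma measurable_configurations:
  assumes n: "n \<ge> 1"
  shows "Measurable.pred (lborel_on {2..<2 * n + 2}) (\<lambda>y. gauge_fix y \<in> configurations n 2)"
proof -
  let ?M = "lborel_on {2..<2 * n + 2}"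
  have coord: "(\<lambda>y. gauge_fix y i) \<in> borel_measurable ?M" if "i < 2 * n + 2" for i
  proof (cases "i \<in> {2..<2 * n + 2}")
    case True
    then have "(\<lambda>y. gauge_fix y i) = (\<lambda>y. y i)" by (auto simp: gauge_fix_def)
    then show ?thesis using measurable_component_singleton[OF True, of "\<lambda>_. lborel :: real measure"] by simp
  next
    case False
    then have "i = 0 \<or> i = 1" using that by auto
    then have "(\<lambda>y::nat \<Rightarrow> real. gauge_fix y i) = (\<lambda>_. real i)" by (auto simp: gauge_fix_def)
    then show ?thesis by simp
  qed
  have pred_ne: "Measurable.pred ?M (\<lambda>y. f y \<noteq> g y)" and pred_lt: "Measurable.pred ?M (\<lambda>y. f y < g y)"
    if "f \<in> borel_measurable ?M" "g \<in> borel_measurable ?M" for f g :: "(nat \<Rightarrow> real) \<Rightarrow> real"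
    using borel_measurable_neq[OF that] borel_measurable_less[OF that] by (simp_all add: pred_def)
  have conf: "gauge_fix y \<in> configurations n 2 \<longleftrightarrow>
      (\<forall>k<n. 0 < gauge_fix y (2 * k + 1)) \<and>
      (\<forall>k<n. \<forall>l<n. k \<noteq> l \<longrightarrow> gauge_fix y (2 * k) \<noteq> gauge_fix y (2 * l) \<or> gauge_fix y (2 * k + 1) \<noteq> gauge_fix y (2 * l + 1)) \<and>
      gauge_fix y (2 * n) < gauge_fix y (2 * n + 1)" for y
  proof -
    have "(\<forall>j k. j < k \<longrightarrow> k < 2 \<longrightarrow> gauge_fix y (2 * n + j) < gauge_fix y (2 * n + k))
       \<longleftrightarrow> gauge_fix y (2 * n) < gauge_fix y (2 * n + 1)"
      by (auto simp: less_2_cases_iff)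
    then show ?thesis unfolding configurations_def by (auto simp: position_def inj_on_def)
  qed
  have 1: "Measurable.pred ?M (\<lambda>y. \<forall>k<n. 0 < gauge_fix y (2 * k + 1))"
  proof (rule pred_intros_countable)
    fix k show "Measurable.pred ?M (\<lambda>y. k < n \<longrightarrow> 0 < gauge_fix y (2 * k + 1))"
    proof (cases "k < n")
      case True
      then have [measurable]: "(\<lambda>y. gauge_fix y (2 * k + 1)) \<in> borel_measurable ?M" by (intro coord) auto
      show ?thesis by measurable
    qed simp
  qed
  have 2: "Measurable.pred ?M (\<lambda>y. \<forall>k<n. \<forall>l<n. k \<noteq> l \<longrightarrow> gauge_fix y (2 * k) \<noteq> gauge_fix y (2 * l) \<or> gauge_fix y (2 * k + 1) \<noteq> gauge_fix y (2 * l + 1))"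
  proof (rule pred_intros_countable)
    fix k
    have "Measurable.pred ?M (\<lambda>y. k < n \<longrightarrow> l < n \<longrightarrow> k \<noteq> l \<longrightarrow> gauge_fix y (2 * k) \<noteq> gauge_fix y (2 * l) \<or> gauge_fix y (2 * k + 1) \<noteq> gauge_fix y (2 * l + 1))" for l
    proof (cases "k < n \<and> l < n")
      case True
      have "Measurable.pred ?M (\<lambda>y. gauge_fix y (2 * k) \<noteq> gauge_fix y (2 * l) \<or> gauge_fix y (2 * k + 1) \<noteq> gauge_fix y (2 * l + 1))"
        using True by (intro pred_intros_logic(5) pred_ne coord) linarith+
      then show ?thesis using True by simp
    qed auto
    then have "Measurable.pred ?M (\<lambda>y. \<forall>l. k < n \<longrightarrow> l < n \<longrightarrow> k \<noteq> l \<longrightarrow> gauge_fix y (2 * k) \<noteq> gauge_fix y (2 * l) \<or> gauge_fix y (2 * k + 1) \<noteq> gauge_fix y (2 * l + 1))"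
      by (rule pred_intros_countable)
    then show "Measurable.pred ?M (\<lambda>y. k < n \<longrightarrow> (\<forall>l<n. k \<noteq> l \<longrightarrow> gauge_fix y (2 * k) \<noteq> gauge_fix y (2 * l) \<or> gauge_fix y (2 * k + 1) \<noteq> gauge_fix y (2 * l + 1)))"
      by (simp only: all_simps imp_conjL)
  qed
  have "Measurable.pred ?M (\<lambda>y. gauge_fix y (2 * n) < gauge_fix y (2 * n + 1))"
    by (intro pred_lt coord) linarith+
  then show ?thesis unfolding conf by (intro pred_intros_logic(3) 1 2)
qed

lemma integrable_configuration_form:
  assumes n: "n \<ge> 1" and \<rho>: "\<And>e. e \<in> set (star_edges n) \<Longrightarrow> arg_combination {2..<2 * n + 2} (\<rho> e)"
  shows "integrable (lborel_on {2..<2 * n + 2}) (configuration_form n \<rho>)"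
proof -
  let ?M = "lborel_on {2..<2 * n + 2}"
  have "integrable ?M (\<lambda>y. wedge_covectors (map (\<lambda>\<beta>. \<beta> y) (map \<rho> (star_edges n))) [2..<2 * n + 2])"
    by (rule integrable_wedge_arg_combination) (use \<rho> in \<open>auto simp: length_star_edges\<close>)
  then have int: "integrable ?M (\<lambda>y. wedge_covectors (map (\<lambda>e. \<rho> e y) (star_edges n)) [2..<2 * n + 2])"
    by (simp add: o_def)
  note [measurable] = measurable_configurations[OF n] borel_measurable_integrable[OF int]
  show ?thesis unfolding configuration_form_def
    by (rule Bochner_Integration.integrable_bound[OF int])
       (measurable, auto simp: indicator_def)
qed

lemma configuration_integral_linear:
  assumes n: "n \<ge> 1" and \<rho>: "\<And>e. e \<in> set (star_edges n) \<Longrightarrow> arg_combination {2..<2 * n + 2} (\<rho> e)"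
    and \<beta>: "arg_combination {2..<2 * n + 2} \<beta>" "arg_combination {2..<2 * n + 2} \<gamma>" and e: "e \<in> set (star_edges n)"
  shows "configuration_integral n (\<rho>(e := \<lambda>y j. \<beta> y j - \<gamma> y j))
       = configuration_integral n (\<rho>(e := \<beta>)) - configuration_integral n (\<rho>(e := \<gamma>))"
proof -
  obtain es es' where es: "star_edges n = es @ e # es'" "e \<notin> set es" "e \<notin> set es'"
    using e distinct_star_edges[of n] by (auto dest!: split_list)
  have "map (\<lambda>e'. (\<rho>(e := \<delta>)) e' y) (star_edges n) = map (\<lambda>e. \<rho> e y) es @ \<delta> y # map (\<lambda>e. \<rho> e y) es'" for \<delta> y
    using es by auto
  note list = this
  have "wedge_covectors (\<alpha>s @ (\<lambda>j. \<beta> y j - \<gamma> y j) # \<alpha>s') js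
      = wedge_covectors (\<alpha>s @ \<beta> y # \<alpha>s') js - wedge_covectors (\<alpha>s @ \<gamma> y # \<alpha>s') js" for y \<alpha>s \<alpha>s' js
    using wedge_covectors_linear[of \<alpha>s 1 "\<beta> y" "-1" "\<gamma> y" \<alpha>s' js] by simp
  then have diff: "configuration_form n (\<rho>(e := \<lambda>y j. \<beta> y j - \<gamma> y j))
      = (\<lambda>y. configuration_form n (\<rho>(e := \<beta>)) y - configuration_form n (\<rho>(e := \<gamma>)) y)"
    unfolding configuration_form_def list by (simp only: right_diff_distrib)
  have "integrable (lborel_on {2..<2 * n + 2}) (configuration_form n (\<rho>(e := \<delta>)))"
    if "arg_combination {2..<2 * n + 2} \<delta>" for \<delta>
    using n \<rho> that by (intro integrable_configuration_form) auto
  then show ?thesis unfolding configuration_integral_def diff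
    using \<beta> by (intro Bochner_Integration.integral_diff) auto
qed

lemma rotation_inj:
  assumes "z \<noteq> of_real q" "w \<noteq> of_real q" "rotation q z = rotation q w"
  shows "z = w"
proof -
  have "1 + q\<^sup>2 > 0" by (simp add: add_pos_nonneg)
  then have "complex_of_real (1 + q\<^sup>2) \<noteq> 0" by (metis less_irrefl of_real_eq_0_iff)
  moreover have "of_real (1 + q\<^sup>2) / (z - of_real q) = of_real (1 + q\<^sup>2) / (w - of_real q)"
    using assms(3) unfolding rotation_alt[OF assms(1)] rotation_alt[OF assms(2)] by simp
  ultimately show ?thesis using assms by (simp add: frac_eq_eq)
qed

lemma rotated_configuration_in_configurations:
  assumes n: "n \<ge> 1" and y: "y \<in> gauge_domain n"
  shows "gauge_fix (rotated_configuration n y) \<in> configurations n 2 \<longleftrightarrow> gauge_fix y \<in> configurations n 2"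
proof -
  define q where "q = y (2 * n)"
  let ?p = "position n (gauge_fix y)" and ?p' = "position n (gauge_fix (rotated_configuration n y))"
  note pos = position_rotated[OF n y, folded q_def]
  have upper: "Im (?p (FirstType k)) > 0" if "k < n" for k
    using y that by (cases "k = 0") (auto simp: gauge_domain_def upper_points_def position_def gauge_fix_def)
  have nq: "?p (FirstType k) \<noteq> of_real q" if "k < n" for k
    using upper[OF that] by (auto simp: complex_eq_iff)
  have upper': "Im (?p' (FirstType k)) > 0" if k: "k < n" for k
  proof -
    let ?z = "?p (FirstType k)"
    have "Im (rotation q (Complex (Re ?z) (Im ?z))) = (1 + q\<^sup>2) * Im ?z / ((Re ?z - q)\<^sup>2 + (Im ?z)\<^sup>2)"
      by (rule rotation_components(2)[OF upper[OF k]])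
    also have "\<dots> > 0" using upper[OF k] by (intro divide_pos_pos mult_pos_pos add_nonneg_pos add_pos_nonneg) auto
    finally show ?thesis by (simp add: pos(1)[OF k])
  qed
  have "inj_on (\<lambda>k. ?p' (FirstType k)) {..<n} \<longleftrightarrow> inj_on (\<lambda>k. ?p (FirstType k)) {..<n}"
    using rotation_inj[OF nq nq] by (auto simp: inj_on_def pos(1))
  moreover have lt: "y (2 * n) < y (2 * n + 1)" using y by (simp add: gauge_domain_def)
  then have "gauge_fix y (2 * n) < gauge_fix y (2 * n + 1)" using n by (simp add: gauge_fix_def)
  moreover have "gauge_fix (rotated_configuration n y) (2 * n) < gauge_fix (rotated_configuration n y) (2 * n + 1)"
  proof -
    have "- (1 + y (2 * n) * y (2 * n + 1)) / (y (2 * n + 1) - y (2 * n)) < - y (2 * n)"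
    proof -
      have "0 < 1 + y (2 * n) * y (2 * n)" by (simp add: add_pos_nonneg)
      then show ?thesis using lt by (simp add: field_simps)
    qed
    then show ?thesis using n by (simp add: gauge_fix_def rotated_configuration_def)
  qed
  moreover have "x \<in> configurations n 2 \<longleftrightarrow> (\<forall>k<n. Im (position n x (FirstType k)) > 0) \<and>
      inj_on (\<lambda>k. position n x (FirstType k)) {..<n} \<and> x (2 * n) < x (2 * n + 1)" for x
  proof -
    have "(\<forall>j k. j < k \<longrightarrow> k < 2 \<longrightarrow> x (2 * n + j) < x (2 * n + k)) \<longleftrightarrow> x (2 * n) < x (2 * n + 1)"
      by (auto simp: less_2_cases_iff)
    then show ?thesis unfolding configurations_def by simp
  qed
  ultimately show ?thesis using upper upper' by blast
qed

text \<open>The signed version follows from an equality of measures, which needs the substitution rule for indicators only.\<close>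

lemma integral_rotated_configuration:
  fixes F :: "(nat \<Rightarrow> real) \<Rightarrow> real"
  assumes n: "n \<ge> 1" and F: "F \<in> borel_measurable (lborel_on {2..<2 * n + 2})"
  shows "(LINT y | lborel_on {2..<2 * n + 2}. rotation_jacobian n y * indicator (gauge_domain n) y * F (rotated_configuration n y))
       = (LINT y | lborel_on {2..<2 * n + 2}. indicator (gauge_domain n) y * F y)"
proof -
  let ?M = "lborel_on {2..<2 * n + 2}" and ?D = "gauge_domain n"
  note [measurable] = F measurable_rotated_configuration[OF n] measurable_gauge_domain[OF n]
    borel_measurable_rotation_jacobian[OF n]
  let ?N = "density ?M (\<lambda>y. ennreal (rotation_jacobian n y * indicator ?D y))"
  have jac: "rotation_jacobian n y \<ge> 0" for y
    by (simp add: rotation_jacobian_def point_jacobian_nonneg)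
  have eq: "distr ?N ?M (rotated_configuration n) = density ?M (\<lambda>y. ennreal (indicator ?D y))"
  proof (rule measure_eqI)
    fix A assume "A \<in> sets (distr ?N ?M (rotated_configuration n))"
    then have A [measurable]: "A \<in> sets ?M" by simp
    have "emeasure (distr ?N ?M (rotated_configuration n)) A = (\<integral>\<^sup>+y. indicator A y \<partial>distr ?N ?M (rotated_configuration n))"
      using A by (intro nn_integral_indicator[symmetric]) (simp only: sets_distr)
    also have "\<dots> = (\<integral>\<^sup>+y. indicator A (rotated_configuration n y) \<partial>?N)"
      by (rule nn_integral_distr) measurable
    also have "\<dots> = (\<integral>\<^sup>+y. ennreal (rotation_jacobian n y * indicator ?D y) * indicator A (rotated_configuration n y) \<partial>?M)"
      by (rule nn_integral_density) measurable
    also have "\<dots> = (\<integral>\<^sup>+y. indicator A (rotated_configuration n y) * ennreal (rotation_jacobian n y) * indicator ?D y \<partial>?M)"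
      by (intro nn_integral_cong) (auto simp: indicator_def)
    also have "\<dots> = (\<integral>\<^sup>+y. indicator A y * indicator ?D y \<partial>?M)"
      by (rule nn_integral_rotated_configuration[OF _ n]) measurable
    also have "\<dots> = emeasure (density ?M (\<lambda>y. ennreal (indicator ?D y))) A"
      by (subst emeasure_density, measurable, intro nn_integral_cong) (auto simp: indicator_def)
    finally show "emeasure (distr ?N ?M (rotated_configuration n)) A = emeasure (density ?M (\<lambda>y. ennreal (indicator ?D y))) A" .
  qed simp
  have "(LINT y|?M. rotation_jacobian n y * indicator ?D y * F (rotated_configuration n y)) = (LINT y|?N. F (rotated_configuration n y))"
  proof (rule integral_real_density[symmetric])
    show "(\<lambda>y. rotation_jacobian n y * indicator ?D y) \<in> borel_measurable ?M" by measurable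
    show "(\<lambda>y. F (rotated_configuration n y)) \<in> borel_measurable ?M"
      by (rule measurable_compose[OF measurable_rotated_configuration[OF n] F])
  qed (use jac in simp)
  also have "\<dots> = (LINT y|distr ?N ?M (rotated_configuration n). F y)"
    by (rule integral_distr[symmetric]) measurable
  also have "\<dots> = (LINT y|?M. indicator ?D y * F y)"
    unfolding eq
  proof (rule integral_real_density)
    show "(indicator ?D :: _ \<Rightarrow> real) \<in> borel_measurable ?M" by measurable
  qed (simp_all add: F del: add_2_eq_Suc')
  finally show ?thesis .
qed

abbreviation relative_row :: "nat \<Rightarrow> (nat \<times> nat \<Rightarrow> vertex) \<Rightarrow> nat \<times> nat \<Rightarrow> (nat \<Rightarrow> real) \<Rightarrow> nat \<Rightarrow> real" where
  "relative_row n \<tau> e \<equiv> (\<lambda>y j. angle_row n (fst e) (\<tau> e) y j - angle_row n (fst e) (SecondType 0) y j)"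

text \<open>Subtracting from all angles the angle towards the first function amounts to permuting the three functions
  cyclically. Loops are excluded: their row vanishes before the subtraction and after the rotation.\<close>

lemma configuration_integral_rotation:
  assumes n: "n \<ge> 1"
    and \<tau>: "\<And>k l. (k, l) \<in> set (star_edges n) \<Longrightarrow> \<tau> (k, l) \<in> vertices n 3 - {FirstType k}"
  shows "configuration_integral n (relative_row n \<tau>)
       = configuration_integral n (\<lambda>e. angle_row n (fst e) (cyclic_vertex (\<tau> e)))"
proof -
  let ?M = "lborel_on {2..<2 * n + 2}"
  let ?F = "configuration_form n (\<lambda>e. angle_row n (fst e) (cyclic_vertex (\<tau> e)))"
  have \<sigma>: "cyclic_vertex v \<in> vertices n 3" if "v \<in> vertices n 3" for v
    using that by (auto simp: vertices_def cyclic_vertex_def)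
  have "integrable ?M ?F"
  proof (rule integrable_configuration_form[OF n])
    fix e assume e: "e \<in> set (star_edges n)"
    obtain k l where [simp]: "e = (k, l)" by fastforce
    from e have "k < n" by (simp add: set_star_edges)
    moreover have "\<tau> e \<in> vertices n 3" using \<tau>[of k l] e by simp
    ultimately show "arg_combination {2..<2 * n + 2} (angle_row n (fst e) (cyclic_vertex (\<tau> e)))"
      by (simp only: fst_conv \<open>e = (k, l)\<close>) (rule arg_combination_angle_row[OF _ \<sigma>])
  qed
  then have F: "?F \<in> borel_measurable ?M" by (rule borel_measurable_integrable)
  have "configuration_form n (relative_row n \<tau>) y
      = rotation_jacobian n y * indicator (gauge_domain n) y * ?F (rotated_configuration n y)" for y
  proof (cases "gauge_fix y \<in> configurations n 2")
    case conf: True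
    let ?js = "[2..<2 * n + 2]"
    have len: "length ?js = 2 * n" by (simp only: length_upt diff_add_inverse2)
    have nth: "?js ! i = i + 2" if "i < 2 * n" for i
      using that by (subst nth_upt) auto
    have y: "y \<in> gauge_domain n" using configurations_imp_gauge_domain[OF n conf] .
    let ?\<alpha>s = "map (\<lambda>e. angle_row n (fst e) (cyclic_vertex (\<tau> e)) (rotated_configuration n y)) (star_edges n)"
    have "wedge_covectors (map (\<lambda>e j. angle_row n (fst e) (\<tau> e) y j - angle_row n (fst e) (SecondType 0) y j) (star_edges n)) ?js
        = wedge_covectors (map (\<lambda>\<alpha> j. \<Sum>i\<in>set ?js. \<alpha> i * rotation_matrix n y i j) ?\<alpha>s) ?js"
    proof (rule wedge_covectors_cong)
      fix l j assume l: "l < length (map (\<lambda>\<alpha> j. \<Sum>i\<in>set ?js. \<alpha> i * rotation_matrix n y i j) ?\<alpha>s)" and j: "j \<in> set ?js"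
      obtain a b where e: "star_edges n ! l = (a, b)" by fastforce
      have l': "l < length (star_edges n)" using l by (simp only: length_map)
      then have "(a, b) \<in> set (star_edges n)" using e by (metis nth_mem)
      then have "a < n" "\<tau> (a, b) \<in> vertices n 3" "\<tau> (a, b) \<noteq> FirstType a" using \<tau> by (auto simp: set_star_edges)
      from angle_row_rotated[OF n conf this, of j] j
      have "angle_row n a (\<tau> (a, b)) y j - angle_row n a (SecondType 0) y j
          = (\<Sum>i\<in>set ?js. angle_row n a (cyclic_vertex (\<tau> (a, b))) (rotated_configuration n y) i * rotation_matrix n y i j)"
        by (simp only: set_upt)
      then show "(map (\<lambda>e j. angle_row n (fst e) (\<tau> e) y j - angle_row n (fst e) (SecondType 0) y j) (star_edges n) ! l) j
          = (map (\<lambda>\<alpha> j. \<Sum>i\<in>set ?js. \<alpha> i * rotation_matrix n y i j) ?\<alpha>s ! l) j"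
        by (simp only: nth_map length_map l' e fst_conv)
    qed (simp only: length_map)
    also have "\<dots> = wedge_covectors ?\<alpha>s ?js * det (mat (length ?js) (length ?js) (\<lambda>(i, j). rotation_matrix n y (?js ! i) (?js ! j)))"
      by (rule wedge_covectors_chain) (simp_all only: distinct_upt len length_map length_star_edges)
    also have "mat (length ?js) (length ?js) (\<lambda>(i, j). rotation_matrix n y (?js ! i) (?js ! j))
        = mat (2 * n) (2 * n) (\<lambda>(a, b). rotation_matrix n y (a + 2) (b + 2))"
      unfolding len by (rule cong_mat) (simp_all only: nth split)
    also have "det \<dots> = rotation_jacobian n y" by (rule det_rotation_matrix[OF n y])
    finally show ?thesis using conf y rotated_configuration_in_configurations[OF n y]
      by (simp add: configuration_form_def del: upt_Suc upt_conv_Cons)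
  next
    case False
    then show ?thesis using rotated_configuration_in_configurations[OF n, of y]
      by (cases "y \<in> gauge_domain n") (simp_all add: configuration_form_def)
  qed
  then have eq: "configuration_form n (relative_row n \<tau>)
      = (\<lambda>y. rotation_jacobian n y * indicator (gauge_domain n) y * ?F (rotated_configuration n y))" by (rule ext)
  have "configuration_integral n (relative_row n \<tau>)
      = (LINT y | ?M. indicator (gauge_domain n) y * ?F y)"
    unfolding configuration_integral_def eq by (rule integral_rotated_configuration[OF n F])
  also have "(\<lambda>y. indicator (gauge_domain n) y * ?F y) = ?F"
    using configurations_imp_gauge_domain[OF n] by (auto simp: configuration_form_def indicator_def fun_eq_iff)
  finally show ?thesis unfolding configuration_integral_def .
qed

section \<open>Calculus of smooth functions\<close>

lemma smooth_imp_differentiable: "smooth f \<Longrightarrow> f differentiable (at x)"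
  unfolding smooth_def by (metis foldr_Nil id_apply)

lemma smooth_imp_continuous: "smooth f \<Longrightarrow> continuous_on S f"
  by (meson continuous_at_imp_continuous_on differentiable_imp_continuous_within smooth_imp_differentiable)

lemma smooth_partial: "smooth f \<Longrightarrow> smooth (partial i f)"
  unfolding smooth_def
proof (intro allI)
  fix js x assume "\<forall>is x. partials is f differentiable (at x)"
  then have "partials (js @ [i]) f differentiable (at x)" by blast
  then show "partials js (partial i f) differentiable (at x)" by simp
qed

lemma smooth_partials: "smooth f \<Longrightarrow> smooth (partials is f)"
  by (induction "is") (auto intro: smooth_partial)

text \<open>Smoothness is the largest property of functions that implies differentiability and passes to partial derivatives.\<close>

lemma smooth_coinduct:
  assumes "S f" and "\<And>f x. S f \<Longrightarrow> f differentiable (at x)" and "\<And>f i. S f \<Longrightarrow> S (partial i f)"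
  shows "smooth f"
proof -
  have "S (partials is f)" for "is" by (induction "is") (auto intro: assms)
  then show ?thesis using assms(2) by (auto simp: smooth_def)
qed

lemma has_real_derivative_partial:
  assumes "\<And>x. f differentiable (at x)"
  shows "((\<lambda>t. f (x + t *\<^sub>R axis i 1)) has_real_derivative partial i f (x + t *\<^sub>R axis i 1)) (at t)"
proof -
  have *: "((\<lambda>t. f (z + t *\<^sub>R axis i 1)) has_real_derivative frechet_derivative f (at (z + t *\<^sub>R axis i 1)) (axis i 1)) (at t)" for z t
  proof -
    have "(f has_derivative frechet_derivative f (at (z + t *\<^sub>R axis i 1))) (at (z + t *\<^sub>R axis i 1))"
      using assms frechet_derivative_works by blast
    moreover have "((\<lambda>t. z + t *\<^sub>R axis i 1) has_derivative (\<lambda>s. s *\<^sub>R axis i 1)) (at t)"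
      by (auto intro!: derivative_eq_intros)
    ultimately have "((\<lambda>t. f (z + t *\<^sub>R axis i 1)) has_derivative (\<lambda>s. frechet_derivative f (at (z + t *\<^sub>R axis i 1)) (s *\<^sub>R axis i 1))) (at t)"
      using has_derivative_compose by blast
    moreover have "linear (frechet_derivative f (at (z + t *\<^sub>R axis i 1)))"
      using assms linear_frechet_derivative by blast
    ultimately show ?thesis
      unfolding has_field_derivative_def by (simp add: linear_cmul mult_commute_abs)
  qed
  have "partial i f (x + t *\<^sub>R axis i 1) = frechet_derivative f (at (x + t *\<^sub>R axis i 1)) (axis i 1)"
    unfolding partial_def using DERIV_imp_deriv[OF *[of "x + t *\<^sub>R axis i 1" 0]] by simp
  then show ?thesis using *[of x t] by simp
qed

lemma partial_eqI:
  assumes "((\<lambda>t. f (x + t *\<^sub>R axis i 1)) has_real_derivative D) (at 0)"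
  shows "partial i f x = D"
  unfolding partial_def using DERIV_imp_deriv[OF assms] .

lemma partial_add:
  assumes "\<And>x. f differentiable (at x)" "\<And>x. g differentiable (at x)"
  shows "partial i (\<lambda>x. f x + g x) = (\<lambda>x. partial i f x + partial i g x)"
proof
  fix x
  note d = has_real_derivative_partial[OF assms(1), where t = 0 and x = x and i = i]
    has_real_derivative_partial[OF assms(2), where t = 0 and x = x and i = i]
  show "partial i (\<lambda>x. f x + g x) x = partial i f x + partial i g x"
    using DERIV_add[OF d] by (intro partial_eqI) simp
qed

lemma partial_mult:
  assumes "\<And>x. f differentiable (at x)" "\<And>x. g differentiable (at x)"
  shows "partial i (\<lambda>x. f x * g x) = (\<lambda>x. partial i f x * g x + f x * partial i g x)"
proof
  fix x
  note d = has_real_derivative_partial[OF assms(1), where t = 0 and x = x and i = i]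
    has_real_derivative_partial[OF assms(2), where t = 0 and x = x and i = i]
  show "partial i (\<lambda>x. f x * g x) x = partial i f x * g x + f x * partial i g x"
    using DERIV_mult[OF d] by (intro partial_eqI) (simp add: mult.commute)
qed

lemma partial_const [simp]: "partial i (\<lambda>x. c) = (\<lambda>x. 0)"
  by (rule ext, rule partial_eqI) simp

lemma smooth_const: "smooth (\<lambda>x. c)"
  by (rule smooth_coinduct[where S = "\<lambda>f. \<exists>c. f = (\<lambda>_. c)"]) auto

text \<open>The algebra generated by the smooth functions. By the sum and product rules it is closed under partial derivatives,
  hence it consists of smooth functions.\<close>

inductive smooth_algebra :: "(real^'d::finite \<Rightarrow> real) \<Rightarrow> bool" where
  base: "smooth f \<Longrightarrow> smooth_algebra f"
| add: "smooth_algebra f \<Longrightarrow> smooth_algebra g \<Longrightarrow> smooth_algebra (\<lambda>x. f x + g x)"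
| mult: "smooth_algebra f \<Longrightarrow> smooth_algebra g \<Longrightarrow> smooth_algebra (\<lambda>x. f x * g x)"

lemma smooth_algebra_differentiable: "smooth_algebra f \<Longrightarrow> f differentiable (at x)"
  by (induction arbitrary: x rule: smooth_algebra.induct)
     (auto intro: smooth_imp_differentiable derivative_intros)

lemma smooth_algebra_partial: "smooth_algebra f \<Longrightarrow> smooth_algebra (partial i f)"
proof (induction rule: smooth_algebra.induct)
  case (add f g)
  then show ?case by (simp add: partial_add smooth_algebra_differentiable smooth_algebra.add)
next
  case (mult f g)
  then show ?case by (simp add: partial_mult smooth_algebra_differentiable smooth_algebra.add smooth_algebra.mult)
qed (auto intro: smooth_algebra.base smooth_partial)

lemma smooth_algebra_imp_smooth: "smooth_algebra f \<Longrightarrow> smooth f"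
  by (rule smooth_coinduct[of smooth_algebra]) (auto intro: smooth_algebra_differentiable smooth_algebra_partial)

lemma smooth_add: "smooth f \<Longrightarrow> smooth g \<Longrightarrow> smooth (\<lambda>x. f x + g x)"
  and smooth_mult: "smooth f \<Longrightarrow> smooth g \<Longrightarrow> smooth (\<lambda>x. f x * g x)"
  by (auto intro: smooth_algebra_imp_smooth smooth_algebra.intros)

lemma smooth_sum: "(\<And>a. a \<in> A \<Longrightarrow> smooth (f a)) \<Longrightarrow> smooth (\<lambda>x. \<Sum>a\<in>A. f a x)"
  by (induction A rule: infinite_finite_induct) (auto intro: smooth_add smooth_const)

lemma smooth_prod: "(\<And>a. a \<in> A \<Longrightarrow> smooth (f a)) \<Longrightarrow> smooth (\<lambda>x. \<Prod>a\<in>A. f a x)"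
  by (induction A rule: infinite_finite_induct) (auto intro: smooth_mult smooth_const)

lemma partial_sum:
  assumes "\<And>a. a \<in> A \<Longrightarrow> smooth (f a)"
  shows "partial i (\<lambda>x. \<Sum>a\<in>A. f a x) = (\<lambda>x. \<Sum>a\<in>A. partial i (f a) x)"
  using assms
  by (induction A rule: infinite_finite_induct)
     (simp_all add: partial_add smooth_imp_differentiable smooth_sum)

lemma partials_sum:
  assumes "\<And>a. a \<in> A \<Longrightarrow> smooth (f a)"
  shows "partials is (\<lambda>x. \<Sum>a\<in>A. f a x) = (\<lambda>x. \<Sum>a\<in>A. partials is (f a) x)"
  by (induction "is") (simp_all add: partial_sum smooth_partials assms)

lemma partial_prod:
  assumes "finite A" "\<And>a. a \<in> A \<Longrightarrow> smooth (f a)"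
  shows "partial i (\<lambda>x. \<Prod>a\<in>A. f a x) = (\<lambda>x. \<Sum>b\<in>A. \<Prod>a\<in>A. (if a = b then partial i (f a) else f a) x)"
  using assms
proof (induction A rule: finite_induct)
  case (insert c A)
  have "(\<Prod>a\<in>A. (if a = c then partial i (f a) else f a) x) = (\<Prod>a\<in>A. f a x)" for x
    using insert.hyps by (intro prod.cong) auto
  moreover have "(if c = b then partial i (f c) else f c) = f c" if "b \<in> A" for b using insert.hyps that by auto
  ultimately show ?case
    using insert by (simp add: partial_mult smooth_imp_differentiable smooth_prod sum_distrib_left)
qed simp

text \<open>Both mixed derivatives are limits of the second difference quotient.\<close>

lemma second_difference:
  fixes f :: "real^'d::finite \<Rightarrow> real"
  assumes f: "smooth f" and h: "h > 0"
  obtains p where "norm (p - x) \<le> 2 * h"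
    and "f (x + h *\<^sub>R axis i 1 + h *\<^sub>R axis j 1) - f (x + h *\<^sub>R axis i 1) - f (x + h *\<^sub>R axis j 1) + f x
           = h * h * partial j (partial i f) p"
proof -
  have df: "g differentiable (at z)" if "smooth g" for g :: "real^'d \<Rightarrow> real" and z using smooth_imp_differentiable[OF that] .
  let ?i = "axis i 1 :: real^'d" and ?j = "axis j 1 :: real^'d"
  define u where "u = (\<lambda>s. f ((x + h *\<^sub>R ?j) + s *\<^sub>R ?i) - f (x + s *\<^sub>R ?i))"
  define u' where "u' = (\<lambda>s. partial i f ((x + h *\<^sub>R ?j) + s *\<^sub>R ?i) - partial i f (x + s *\<^sub>R ?i))"
  have "(u has_real_derivative u' s) (at s)" for s
    unfolding u_def u'_def by (intro DERIV_diff has_real_derivative_partial df f)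
  with h obtain s where s: "0 < s" "s < h" "u h - u 0 = (h - 0) * u' s"
    using MVT2[of 0 h u u'] by blast
  have "((\<lambda>t. partial i f ((x + s *\<^sub>R ?i) + t *\<^sub>R ?j)) has_real_derivative partial j (partial i f) ((x + s *\<^sub>R ?i) + t *\<^sub>R ?j)) (at t)" for t
    by (intro has_real_derivative_partial df smooth_partial f)
  with h obtain t where t: "0 < t" "t < h"
    "partial i f ((x + s *\<^sub>R ?i) + h *\<^sub>R ?j) - partial i f ((x + s *\<^sub>R ?i) + 0 *\<^sub>R ?j) = (h - 0) * partial j (partial i f) ((x + s *\<^sub>R ?i) + t *\<^sub>R ?j)"
    using MVT2[of 0 h "\<lambda>t. partial i f ((x + s *\<^sub>R ?i) + t *\<^sub>R ?j)" "\<lambda>t. partial j (partial i f) ((x + s *\<^sub>R ?i) + t *\<^sub>R ?j)"]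
    by blast
  show ?thesis
  proof
    have "norm (s *\<^sub>R ?i + t *\<^sub>R ?j) \<le> norm (s *\<^sub>R ?i) + norm (t *\<^sub>R ?j)" by (rule norm_triangle_ineq)
    also have "\<dots> = s + t" using s t by simp
    finally show "norm ((x + s *\<^sub>R ?i) + t *\<^sub>R ?j - x) \<le> 2 * h" using s t by simp
    have "u' s = h * partial j (partial i f) ((x + s *\<^sub>R ?i) + t *\<^sub>R ?j)"
      using t(3) by (simp add: u'_def add.commute add.left_commute)
    then show "f (x + h *\<^sub>R ?i + h *\<^sub>R ?j) - f (x + h *\<^sub>R ?i) - f (x + h *\<^sub>R ?j) + f x
        = h * h * partial j (partial i f) ((x + s *\<^sub>R ?i) + t *\<^sub>R ?j)"
      using s(3) by (simp add: u_def add.commute add.left_commute)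
  qed
qed

lemma partial_commute:
  fixes f :: "real^'d::finite \<Rightarrow> real"
  assumes f: "smooth f"
  shows "partial i (partial j f) = partial j (partial i f)"
proof
  fix x
  let ?A = "partial j (partial i f)" and ?B = "partial i (partial j f)"
  have cont: "isCont ?A x" "isCont ?B x"
    using smooth_imp_differentiable[OF smooth_partial[OF smooth_partial[OF f]]] differentiable_imp_continuous_within by blast+
  show "?B x = ?A x"
  proof (rule ccontr)
    assume ne: "?B x \<noteq> ?A x"
    define \<epsilon> where "\<epsilon> = \<bar>?B x - ?A x\<bar> / 2"
    have \<epsilon>: "\<epsilon> > 0" using ne by (simp add: \<epsilon>_def)
    obtain \<delta>1 where \<delta>1: "\<delta>1 > 0" "\<And>p. dist p x < \<delta>1 \<Longrightarrow> dist (?A p) (?A x) < \<epsilon>"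
      using cont(1) \<epsilon> unfolding continuous_at_eps_delta by blast
    obtain \<delta>2 where \<delta>2: "\<delta>2 > 0" "\<And>p. dist p x < \<delta>2 \<Longrightarrow> dist (?B p) (?B x) < \<epsilon>"
      using cont(2) \<epsilon> unfolding continuous_at_eps_delta by blast
    define h where "h = min \<delta>1 \<delta>2 / 3"
    have h: "h > 0" "2 * h < \<delta>1" "2 * h < \<delta>2" using \<delta>1(1) \<delta>2(1) by (auto simp: h_def min_def)
    obtain p where p: "norm (p - x) \<le> 2 * h"
      "f (x + h *\<^sub>R axis i 1 + h *\<^sub>R axis j 1) - f (x + h *\<^sub>R axis i 1) - f (x + h *\<^sub>R axis j 1) + f x = h * h * ?A p"
      using second_difference[OF f h(1)] by blast
    obtain p' where p': "norm (p' - x) \<le> 2 * h"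
      "f (x + h *\<^sub>R axis j 1 + h *\<^sub>R axis i 1) - f (x + h *\<^sub>R axis j 1) - f (x + h *\<^sub>R axis i 1) + f x = h * h * ?B p'"
      using second_difference[OF f h(1)] by blast
    have swap: "x + h *\<^sub>R axis j 1 + h *\<^sub>R axis i 1 = x + h *\<^sub>R axis i 1 + h *\<^sub>R axis j 1" by (simp add: add_ac)
    have "h * h * ?A p = h * h * ?B p'" using p(2) p'(2) unfolding swap by linarith
    then have "?A p = ?B p'" using h by simp
    moreover have "\<bar>?A p - ?A x\<bar> < \<epsilon>" using \<delta>1(2)[of p] p(1) h by (simp add: dist_norm)
    moreover have "\<bar>?B p' - ?B x\<bar> < \<epsilon>" using \<delta>2(2)[of p'] p'(1) h by (simp add: dist_norm)
    ultimately have "\<bar>?B x - ?A x\<bar> < \<epsilon> + \<epsilon>" by linarith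
    then show False by (simp add: \<epsilon>_def)
  qed
qed

lemma partials_remove1:
  assumes "smooth f" "i \<in> set is"
  shows "partials is f = partial i (partials (remove1 i is) f)"
  using assms(2)
proof (induction "is")
  case (Cons j "is")
  then show ?case
    using partial_commute[OF smooth_partials[OF assms(1)], of i j] by auto
qed simp

lemma partials_mset_cong:
  assumes "smooth f" "mset is = mset js"
  shows "partials is f = partials js f"
  using assms(2)
proof (induction "is" arbitrary: js)
  case (Cons i "is")
  have i: "i \<in> set js" using Cons.prems by (metis list.set_intros(1) set_mset_mset)
  have "mset is = mset (remove1 i js)" using Cons.prems by (simp add: flip: Cons.prems)
  then show ?case using Cons.IH[of "remove1 i js"] partials_remove1[OF assms(1) i] by simp
qed simp

section \<open>Integration by parts\<close>

definition supported_on :: "(real^'d::finite) set \<Rightarrow> (real^'d \<Rightarrow> real) \<Rightarrow> bool" where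
  "supported_on K f \<longleftrightarrow> (\<forall>x. x \<notin> K \<longrightarrow> f x = 0)"

lemma compactly_supported_obtains:
  assumes "compactly_supported f"
  obtains K where "compact K" "supported_on K f"
  using assms closure_subset[of "{x. f x \<noteq> 0}"] unfolding compactly_supported_def supported_on_def by blast

lemma supported_on_partial:
  fixes f :: "real^'d::finite \<Rightarrow> real"
  assumes "closed K" "supported_on K f"
  shows "supported_on K (partial i f)"
  unfolding supported_on_def
proof (intro allI impI)
  fix x :: "real^'d" assume "x \<notin> K"
  then obtain e where e: "e > 0" "ball x e \<subseteq> - K"
    using assms(1) open_contains_ball[of "- K"] by auto
  have "((\<lambda>t. f (x + t *\<^sub>R axis i 1)) has_real_derivative 0) (at 0)"
  proof (rule has_field_derivative_transform_within[OF DERIV_const[of 0] e(1)])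
    fix t :: real assume "dist t 0 < e"
    then have "x + t *\<^sub>R axis i 1 \<in> ball x e" by (simp add: dist_norm)
    then show "0 = f (x + t *\<^sub>R axis i 1)" using e(2) assms(2) by (auto simp: supported_on_def)
  qed simp
  then show "partial i f x = 0" by (rule partial_eqI)
qed

lemma supported_on_partials:
  "closed K \<Longrightarrow> supported_on K f \<Longrightarrow> supported_on K (partials is f)"
  by (induction "is") (auto intro: supported_on_partial)

lemma integrable_supported_on:
  fixes f :: "real^'d::finite \<Rightarrow> real"
  assumes "continuous_on UNIV f" "compact K" "supported_on K f"
  shows "integrable lborel f"
proof -
  have "integrable lborel (\<lambda>x. indicator K x *\<^sub>R f x)"
    using assms by (intro borel_integrable_compact) (auto intro: continuous_on_subset)
  also have "(\<lambda>x. indicator K x *\<^sub>R f x) = f"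
    using assms(3) by (auto simp: supported_on_def indicator_def fun_eq_iff)
  finally show ?thesis .
qed

text \<open>The derivative is the dominated limit of the difference quotients \<open>m (f (x + e/m) - f x)\<close>, whose integrals vanish
  because Lebesgue measure is invariant under translations.\<close>

lemma integral_partial_eq_0:
  fixes f :: "real^'d::finite \<Rightarrow> real"
  assumes f: "smooth f" and K: "compact K" "supported_on K f"
  shows "(LINT x|lborel. partial i f x) = 0"
proof -
  let ?e = "axis i 1 :: real^'d"
  have cont: "continuous_on UNIV f" "continuous_on UNIV (partial i f)"
    using f smooth_partial by (auto intro: smooth_imp_continuous)
  have int: "integrable lborel f" by (rule integrable_supported_on[OF cont(1) K])
  have supp': "supported_on K (partial i f)"
    by (rule supported_on_partial) (use K compact_imp_closed in auto)
  have "bounded (partial i f ` K)"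
    using K(1) cont(2) by (intro compact_imp_bounded compact_continuous_image) (auto intro: continuous_on_subset)
  then obtain C where C: "\<And>x. x \<in> K \<Longrightarrow> norm (partial i f x) \<le> C" "C > 0"
    unfolding bounded_pos by auto
  then have C': "\<bar>partial i f x\<bar> \<le> C" for x
    using supp' by (cases "x \<in> K") (auto simp: supported_on_def)
  define D where "D = (\<lambda>(m::nat) x. (f (x + (1 / Suc m) *\<^sub>R ?e) - f x) / (1 / Suc m))"
  define L where "L = (\<lambda>(x, t). x - t *\<^sub>R ?e) ` (K \<times> {0..1})"
  have L: "compact L" unfolding L_def
    by (intro compact_continuous_image compact_Times K) (auto intro!: continuous_intros simp: split_beta')
  have KL: "x \<in> L" if "x + t *\<^sub>R ?e \<in> K" "0 \<le> t" "t \<le> 1" for x t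
  proof -
    have "x = (\<lambda>(x, t). x - t *\<^sub>R ?e) (x + t *\<^sub>R ?e, t)" by simp
    then show ?thesis unfolding L_def using that by (intro image_eqI) auto
  qed
  have shift: "integrable lborel (\<lambda>x. f (x + c))" "(LINT x|lborel. f (x + c)) = (LINT x|lborel. f x)" for c
  proof -
    have "integrable (distr lborel borel ((+) c)) f" using int by (simp add: lborel_distr_plus)
    then show "integrable lborel (\<lambda>x. f (x + c))"
      using integrable_distr_eq[of "(+) c" lborel borel f] cont(1)
      by (simp add: borel_measurable_continuous_onI add.commute)
    have "(LINT x|distr lborel borel ((+) c). f x) = (LINT x|lborel. f (c + x))"
      by (rule integral_distr) (use cont(1) in \<open>auto intro: borel_measurable_continuous_onI\<close>)
    then show "(LINT x|lborel. f (x + c)) = (LINT x|lborel. f x)" by (simp add: lborel_distr_plus add.commute)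
  qed
  have "(LINT x|lborel. D m x) = 0" for m
    unfolding D_def using shift int by simp
  moreover have "(\<lambda>m. LINT x|lborel. D m x) \<longlonglongrightarrow> (LINT x|lborel. partial i f x)"
  proof (rule integral_dominated_convergence[where w = "\<lambda>x. C * indicator L x"])
    show "partial i f \<in> borel_measurable lborel" using cont(2) by (simp add: borel_measurable_continuous_onI)
    show "D m \<in> borel_measurable lborel" for m
      unfolding D_def using borel_measurable_integrable[OF shift(1)] borel_measurable_integrable[OF int] by measurable
    show "integrable lborel (\<lambda>x. C * indicator L x)"
      using L by (intro integrable_mult_right integrable_real_indicator) (use emeasure_bounded_finite[OF compact_imp_bounded[OF L]] in \<open>auto intro: borel_compact\<close>)
    show "AE x in lborel. (\<lambda>m. D m x) \<longlonglongrightarrow> partial i f x"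
    proof (rule AE_I2)
      fix x
      have "((\<lambda>t. f (x + t *\<^sub>R ?e)) has_real_derivative partial i f x) (at 0)"
        using has_real_derivative_partial[OF smooth_imp_differentiable[OF f], where x = x and t = 0 and i = i] by simp
      then have "((\<lambda>h. (f (x + h *\<^sub>R ?e) - f x) / h) \<longlongrightarrow> partial i f x) (at 0)"
        by (simp add: DERIV_def)
      moreover have "filterlim (\<lambda>m. 1 / real (Suc m)) (at 0) sequentially"
        unfolding filterlim_at using LIMSEQ_Suc[OF lim_1_over_n] by auto
      ultimately show "(\<lambda>m. D m x) \<longlonglongrightarrow> partial i f x"
        unfolding D_def using filterlim_compose[of "\<lambda>h. (f (x + h *\<^sub>R ?e) - f x) / h" _ "at 0" "\<lambda>m. 1 / real (Suc m)"] by blast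
    qed
    show "AE x in lborel. norm (D m x) \<le> C * indicator L x" for m
    proof (rule AE_I2)
      fix x
      let ?h = "1 / real (Suc m)"
      obtain t where t: "0 < t" "t < ?h" "f (x + ?h *\<^sub>R ?e) - f (x + 0 *\<^sub>R ?e) = (?h - 0) * partial i f (x + t *\<^sub>R ?e)"
        using MVT2[of 0 ?h "\<lambda>t. f (x + t *\<^sub>R ?e)" "\<lambda>t. partial i f (x + t *\<^sub>R ?e)"]
          has_real_derivative_partial[OF smooth_imp_differentiable[OF f]] by auto
      have D: "D m x = partial i f (x + t *\<^sub>R ?e)" using t(3) by (simp add: D_def field_simps)
      have "?h \<le> 1" by simp
      show "norm (D m x) \<le> C * indicator L x"
      proof (cases "x \<in> L")
        case True
        then show ?thesis using C' by (simp add: D)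
      next
        case False
        then have "x + t *\<^sub>R ?e \<notin> K" using KL[of x t] t \<open>?h \<le> 1\<close> by auto
        then show ?thesis using supp' by (simp add: D supported_on_def C(2) less_imp_le)
      qed
    qed
  qed
  ultimately show ?thesis by (simp add: LIMSEQ_const_iff)
qed

section \<open>Divergence-free bivector fields\<close>

lemma alternating_transpose:
  assumes "alternating k T" "i < j" "j < length I"
  shows "T (I[i := I ! j, j := I ! i]) = - T I"
proof (cases "length I = k")
  case True
  let ?\<sigma> = "Transposition.transpose i j"
  have \<sigma>: "?\<sigma> permutes {..<k}" using assms True by (intro permutes_swap_id) auto
  have "permute_list ?\<sigma> I = I[i := I ! j, j := I ! i]"
    using assms by (intro nth_equalityI) (auto simp: permute_list_def nth_list_update Transposition.transpose_def)
  then show ?thesis using assms(1) \<sigma> True sign_swap_id[of i j] assms(2)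
    unfolding alternating_def by (metis (no_types, lifting) less_irrefl mult_minus1 of_int_1 of_int_minus)
next
  case False
  then show ?thesis using assms(1) unfolding alternating_def by simp
qed

lemma alternating_repeated:
  assumes "alternating k T" "\<not> distinct I"
  shows "T I = 0"
proof -
  obtain i j where ij: "i < j" "j < length I" "I ! i = I ! j"
    using assms(2) by (metis distinct_conv_nth linorder_neqE_nat)
  then have "I[i := I ! j, j := I ! i] = I"
    by (metis list_update_id)
  then show ?thesis using alternating_transpose[OF assms(1) ij(1,2)] by simp
qed

lemma alternating_move:
  assumes "alternating k T"
  shows "T (xs @ ys @ a # zs) = (-1) ^ length ys * T (xs @ a # ys @ zs)"
proof (induction ys arbitrary: xs)
  case (Cons y ys)
  have "T (xs @ (y # ys) @ a # zs) = (-1) ^ length ys * T ((xs @ [y]) @ a # ys @ zs)"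
    using Cons.IH[of "xs @ [y]"] by simp
  also have "T ((xs @ [y]) @ a # ys @ zs) = - T (xs @ a # y # ys @ zs)"
    using alternating_transpose[OF assms, of "length xs" "Suc (length xs)" "xs @ a # y # ys @ zs"]
    by (simp add: nth_append list_update_append)
  finally show ?case by simp
qed simp

text \<open>The form \<open>dx\<^sup>c \<and> \<Omega>\<close> vanishes, because its degree exceeds the dimension.\<close>

lemma top_form_wedge_covector:
  fixes \<Omega> :: "'d::finite list \<Rightarrow> real"
  assumes \<Omega>: "alternating CARD('d) \<Omega>" and K: "length K = Suc CARD('d)"
  shows "(\<Sum>l<length K. (-1) ^ l * of_bool (K ! l = c) * \<Omega> (take l K @ drop (Suc l) K)) = 0"
proof -
  have "card (set K) \<le> CARD('d)" by (intro card_mono) auto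
  then have "\<not> distinct K" using K distinct_card[of K] by auto
  then obtain xs ys zs a where K': "K = xs @ a # ys @ a # zs"
    using not_distinct_decomp[of K] by auto
  let ?s = "length xs" and ?t = "length xs + Suc (length ys)"
  let ?f = "\<lambda>l. (-1) ^ l * of_bool (K ! l = c) * \<Omega> (take l K @ drop (Suc l) K)"
  have "?f l = 0" if l: "l < length K" "l \<noteq> ?s" "l \<noteq> ?t" for l
  proof -
    have "\<not> distinct (take l K @ drop (Suc l) K)"
    proof -
      consider "l < ?s" | "?s < l" "l < ?t" | "?t < l" using l by linarith
      then show ?thesis
      proof cases
        case 1
        then have "drop (Suc l) K = drop (Suc l) xs @ a # ys @ a # zs" by (simp add: K')
        then show ?thesis by simp
      next
        case 2
        have "a \<in> set (take l K)"
          using 2 by (simp add: K' take_Cons')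
        moreover have "a \<in> set (drop (Suc l) K)"
          using 2 by (auto simp: K' drop_Cons' not_less)
        ultimately show ?thesis by auto
      next
        case 3
        then have "take l K = xs @ a # ys @ a # take (l - Suc ?t) zs"
          by (simp add: K' take_Cons' Suc_diff_Suc)
        then show ?thesis by simp
      qed
    qed
    then show ?thesis using alternating_repeated[OF \<Omega>] by simp
  qed
  then have "(\<Sum>l<length K. ?f l) = (\<Sum>l\<in>{?s, ?t}. ?f l)"
    by (intro sum.mono_neutral_right) (auto simp: K')
  also have "\<dots> = ?f ?s + ?f ?t" by simp
  also have "\<dots> = 0"
  proof -
    have "take ?s K @ drop (Suc ?s) K = xs @ ys @ a # zs" by (simp add: K')
    moreover have "take ?t K @ drop (Suc ?t) K = xs @ a # ys @ zs" by (simp add: K')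
    moreover have "K ! ?s = a" "K ! ?t = a" by (simp_all add: K' nth_append)
    ultimately show ?thesis
      using alternating_move[OF \<Omega>, of xs ys a zs] by (simp add: power_add)
  qed
  finally show ?thesis .
qed

lemma sum_lists_length_Suc:
  fixes f :: "'a::finite list \<Rightarrow> real"
  shows "(\<Sum>I | length I = Suc k. f I) = (\<Sum>a\<in>UNIV. \<Sum>I | length I = k. f (a # I))"
proof -
  have "{I :: 'a list. length I = Suc k} = (\<lambda>(a, I). a # I) ` (UNIV \<times> {I. length I = k})"
    by (auto simp: length_Suc_conv image_iff)
  moreover have "inj_on (\<lambda>(a, I). a # I) (UNIV \<times> {I :: 'a list. length I = k})" by (auto simp: inj_on_def)
  ultimately show ?thesis by (simp add: sum.reindex sum.cartesian_product split_beta')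
qed

text \<open>The identity \<open>(dx\<^sup>c \<and> \<Omega>)(\<partial>\<^sub>a, \<partial>\<^sub>b, J) = 0\<close>, multiplied by \<open>\<partial>\<^sub>c \<pi>\<^bsup>ab\<^esup>/2\<close> and summed over \<open>a\<close>, \<open>b\<close>, \<open>c\<close>.\<close>

lemma exterior_derivative_contraction:
  fixes \<pi> \<Omega> :: "('d::finite) tensor_field"
  assumes \<pi>: "multivector_field 2 \<pi>" and \<Omega>: "differential_form CARD('d) \<Omega>" "constant_form \<Omega>"
  shows "exterior_derivative (contraction 2 \<Omega> \<pi>) x J
       = (\<Sum>a\<in>UNIV. (\<Sum>b\<in>UNIV. partial b (\<lambda>y. \<pi> y [a, b]) x) * \<Omega> x (a # J))"
proof -
  have alt: "alternating CARD('d) (\<Omega> x)" using \<Omega>(1) by (simp add: skew_field_def)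
  have sm: "smooth (\<lambda>y. \<pi> y I)" for I using \<pi> by (simp add: skew_field_def)
  have \<Omega>_const: "\<Omega> y = \<Omega> x" for y using \<Omega>(2) by (simp add: constant_form_def)
  let ?P = "\<lambda>c a b. partial c (\<lambda>y. \<pi> y [a, b]) x"
  have skew: "?P c a b = - ?P c b a" for c a b
  proof -
    have "\<pi> y [a, b] = - \<pi> y [b, a]" for y
      using alternating_transpose[of 2 "\<pi> y" 0 1 "[b, a]"] \<pi> by (simp add: skew_field_def)
    then have "?P c a b = partial c (\<lambda>y. (-1) * \<pi> y [b, a]) x" by simp
    also have "\<dots> = - ?P c b a"
      by (subst partial_mult) (simp_all add: smooth_imp_differentiable smooth_const sm)
    finally show ?thesis .
  qed
  have contr: "contraction 2 \<Omega> \<pi> = (\<lambda>y J. \<Sum>a\<in>UNIV. \<Sum>b\<in>UNIV. \<pi> y [a, b] * (\<Omega> x (a # b # J) / 2))"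
  proof (intro ext)
    fix y J
    show "contraction 2 \<Omega> \<pi> y J = (\<Sum>a\<in>UNIV. \<Sum>b\<in>UNIV. \<pi> y [a, b] * (\<Omega> x (a # b # J) / 2))"
      unfolding contraction_def \<Omega>_const[of y] numeral_2_eq_2 sum_lists_length_Suc
      by (simp add: sum_divide_distrib)
  qed
  have d: "partial c (\<lambda>y. contraction 2 \<Omega> \<pi> y J') x = (\<Sum>a\<in>UNIV. \<Sum>b\<in>UNIV. ?P c a b * (\<Omega> x (a # b # J') / 2))" for c J'
    unfolding contr
    by (simp only: partial_sum smooth_sum smooth_mult smooth_const sm partial_mult smooth_imp_differentiable
        partial_const mult_zero_right add_0_right)
  show ?thesis
  proof (cases "Suc (length J) = CARD('d)")
    case len: True
    have K: "length (a # b # J) = Suc CARD('d)" for a b using len by simp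
    have key: "(\<Sum>i<length J. (-1) ^ i * of_bool (J ! i = c) * \<Omega> x (a # b # take i J @ drop (Suc i) J))
        = of_bool (b = c) * \<Omega> x (a # J) - of_bool (a = c) * \<Omega> x (b # J)" for a b c
      using top_form_wedge_covector[OF alt K, of a b c, unfolded list.size add_Suc_right add_0_right sum.lessThan_Suc_shift]
      by simp
    have "exterior_derivative (contraction 2 \<Omega> \<pi>) x J
        = (\<Sum>i<length J. (-1) ^ i * (\<Sum>c\<in>UNIV. of_bool (J ! i = c) * (\<Sum>a\<in>UNIV. \<Sum>b\<in>UNIV. ?P c a b * (\<Omega> x (a # b # take i J @ drop (Suc i) J) / 2))))"
      unfolding exterior_derivative_def d by (simp add: of_bool_def if_distrib[of "\<lambda>u. u * _"] cong: if_cong)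
    also have "\<dots> = (\<Sum>i<length J. \<Sum>c\<in>UNIV. \<Sum>a\<in>UNIV. \<Sum>b\<in>UNIV.
          ?P c a b / 2 * ((-1) ^ i * of_bool (J ! i = c) * \<Omega> x (a # b # take i J @ drop (Suc i) J)))"
      by (simp add: sum_distrib_left mult_ac)
    also have "\<dots> = (\<Sum>c\<in>UNIV. \<Sum>i<length J. \<Sum>a\<in>UNIV. \<Sum>b\<in>UNIV.
          ?P c a b / 2 * ((-1) ^ i * of_bool (J ! i = c) * \<Omega> x (a # b # take i J @ drop (Suc i) J)))"
      by (rule sum.swap)
    also have "\<dots> = (\<Sum>c\<in>UNIV. \<Sum>a\<in>UNIV. \<Sum>b\<in>UNIV. \<Sum>i<length J.
          ?P c a b / 2 * ((-1) ^ i * of_bool (J ! i = c) * \<Omega> x (a # b # take i J @ drop (Suc i) J)))"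
      by (intro sum.cong refl, subst sum.swap, intro sum.cong refl, rule sum.swap)
    also have "\<dots> = (\<Sum>c\<in>UNIV. \<Sum>a\<in>UNIV. \<Sum>b\<in>UNIV.
          ?P c a b / 2 * (of_bool (b = c) * \<Omega> x (a # J)) - ?P c a b / 2 * (of_bool (a = c) * \<Omega> x (b # J)))"
      by (simp only: sum_distrib_left[symmetric] key right_diff_distrib)
    also have "\<dots> = (\<Sum>c\<in>UNIV. (\<Sum>a\<in>UNIV. ?P c a c / 2 * \<Omega> x (a # J)) - (\<Sum>b\<in>UNIV. ?P c c b / 2 * \<Omega> x (b # J)))"
    proof (rule sum.cong[OF refl])
      fix c
      have pick: "(\<Sum>b\<in>UNIV. X b * (of_bool (b = c) * Y)) = X c * Y" for X :: "'d \<Rightarrow> real" and Y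
        by (subst sum.remove[of _ c]) auto
      have "(\<Sum>a\<in>UNIV. \<Sum>b\<in>UNIV. ?P c a b / 2 * (of_bool (a = c) * \<Omega> x (b # J))) = (\<Sum>b\<in>UNIV. ?P c c b / 2 * \<Omega> x (b # J))"
        by (subst sum.swap) (simp only: pick)
      then show "(\<Sum>a\<in>UNIV. \<Sum>b\<in>UNIV.
          ?P c a b / 2 * (of_bool (b = c) * \<Omega> x (a # J)) - ?P c a b / 2 * (of_bool (a = c) * \<Omega> x (b # J)))
        = (\<Sum>a\<in>UNIV. ?P c a c / 2 * \<Omega> x (a # J)) - (\<Sum>b\<in>UNIV. ?P c c b / 2 * \<Omega> x (b # J))"
        by (simp only: sum_subtractf pick)
    qed
    also have "\<dots> = (\<Sum>c\<in>UNIV. \<Sum>a\<in>UNIV. ?P c a c * \<Omega> x (a # J))"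
    proof (rule sum.cong[OF refl])
      fix c
      have "?P c c b = - ?P c b c" for b by (rule skew)
      then show "(\<Sum>a\<in>UNIV. ?P c a c / 2 * \<Omega> x (a # J)) - (\<Sum>b\<in>UNIV. ?P c c b / 2 * \<Omega> x (b # J)) = (\<Sum>a\<in>UNIV. ?P c a c * \<Omega> x (a # J))"
        by (simp add: sum_subtractf[symmetric] sum_negf[symmetric] sum.distrib[symmetric] field_simps)
    qed
    also have "\<dots> = (\<Sum>a\<in>UNIV. (\<Sum>b\<in>UNIV. ?P b a b) * \<Omega> x (a # J))"
      by (subst sum.swap) (simp add: sum_distrib_right)
    finally show ?thesis .
  next
    case False
    then have 0: "\<Omega> x (a # J) = 0" for a using alt by (simp add: alternating_def)
    have "\<Omega> x (a # b # take i J @ drop (Suc i) J) = 0" if "i < length J" for a b i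
    proof -
      have "length (a # b # take i J @ drop (Suc i) J) \<noteq> CARD('d)" using that False by auto
      then show ?thesis using alt by (simp only: alternating_def) blast
    qed
    then show ?thesis unfolding exterior_derivative_def d by (simp add: 0)
  qed
qed

lemma contraction_1_injective:
  fixes \<delta> \<delta>' \<Omega> :: "('d::finite) tensor_field"
  assumes \<Omega>: "volume_form \<Omega>" and \<delta>: "multivector_field 1 \<delta>" "multivector_field 1 \<delta>'"
    and eq: "contraction 1 \<Omega> \<delta> = contraction 1 \<Omega> \<delta>'"
  shows "\<delta> = \<delta>'"
proof (intro ext)
  fix x I
  have alt: "alternating CARD('d) (\<Omega> x)" using \<Omega> by (simp add: volume_form_def skew_field_def)
  have contr: "contraction 1 \<Omega> \<epsilon> x J = (\<Sum>a\<in>UNIV. \<epsilon> x [a] * \<Omega> x (a # J))" for \<epsilon> :: "'d tensor_field" and J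
    unfolding contraction_def One_nat_def sum_lists_length_Suc by simp
  show "\<delta> x I = \<delta>' x I"
  proof (cases "\<exists>m. I = [m]")
    case True
    then obtain m where I: "I = [m]" ..
    obtain L where L: "\<Omega> x L \<noteq> 0" using \<Omega> by (auto simp: volume_form_def)
    then have "distinct L" "length L = CARD('d)"
      using alternating_repeated[OF alt, of L] alt by (auto simp: alternating_def)
    then have "set L = UNIV" by (metis card_subset_eq distinct_card finite subset_UNIV)
    then obtain xs ys where split: "L = xs @ m # ys" by (metis UNIV_I split_list)
    have nz: "\<Omega> x (m # xs @ ys) \<noteq> 0"
      using alternating_move[OF alt, of "[]" xs m ys] L by (simp add: split)
    have "(\<Sum>a\<in>UNIV. \<epsilon> x [a] * \<Omega> x (a # xs @ ys)) = \<epsilon> x [m] * \<Omega> x (m # xs @ ys)" for \<epsilon> :: "'d tensor_field"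
    proof -
      have "\<Omega> x (a # xs @ ys) = 0" if "a \<noteq> m" for a
      proof (rule alternating_repeated[OF alt])
        have "a \<in> set (xs @ ys)" using \<open>set L = UNIV\<close> that by (auto simp: split)
        then show "\<not> distinct (a # xs @ ys)" by simp
      qed
      then show ?thesis by (subst sum.remove[of _ m]) (auto intro!: sum.neutral)
    qed
    then show ?thesis using fun_cong[OF fun_cong[OF eq, of x], of "xs @ ys"] nz unfolding contr I by simp
  next
    case False
    then have "length I \<noteq> 1" by (auto simp: length_Suc_conv)
    then show ?thesis using \<delta> by (simp add: skew_field_def alternating_def)
  qed
qed

text \<open>For a constant volume form the divergence has the components \<open>\<Sum>\<^sub>b \<partial>\<^sub>b \<pi>\<^bsup>ab\<^esup>\<close>. That this field satisfies the description
  of the divergence, and is the only one, has to be proved before the hypothesis says anything.\<close>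

lemma divergence_zero_imp:
  fixes \<pi> \<Omega> :: "('d::finite) tensor_field"
  assumes \<pi>: "multivector_field 2 \<pi>" and \<Omega>: "volume_form \<Omega>" "constant_form \<Omega>"
    and div: "divergence 2 \<Omega> \<pi> = (\<lambda>x I. 0)"
  shows "(\<Sum>b\<in>UNIV. partial b (\<lambda>y. \<pi> y [a, b]) x) = 0"
proof -
  define \<delta> :: "'d tensor_field" where
    "\<delta> = (\<lambda>x I. if length I = 1 then \<Sum>b\<in>UNIV. partial b (\<lambda>y. \<pi> y [hd I, b]) x else 0)"
  have form: "differential_form CARD('d) \<Omega>" using \<Omega>(1) by (simp add: volume_form_def)
  have sm: "smooth (\<lambda>y. \<pi> y I)" for I using \<pi> by (simp add: skew_field_def)
  have \<delta>: "multivector_field 1 \<delta>"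
    unfolding skew_field_def
  proof (intro conjI allI)
    fix x
    have "T (permute_list \<sigma> I) = of_int (sign \<sigma>) * T I" if "length I = 1" "\<sigma> permutes {..<1}"
      for T :: "'d list \<Rightarrow> real" and I :: "'d list" and \<sigma> :: "nat \<Rightarrow> nat"
    proof -
      have "\<sigma> = id" using that(2) by (simp add: lessThan_Suc)
      then show ?thesis by simp
    qed
    then show "alternating 1 (\<delta> x)" unfolding alternating_def by (auto simp: \<delta>_def)
    show "smooth (\<lambda>x. \<delta> x I)" for I
      by (cases "length I = 1") (simp_all add: \<delta>_def smooth_const smooth_sum smooth_partial sm)
  qed
  have contr: "contraction 1 \<Omega> \<delta> = exterior_derivative (contraction 2 \<Omega> \<pi>)"
  proof (intro ext)
    fix x J
    have "contraction 1 \<Omega> \<delta> x J = (\<Sum>a\<in>UNIV. \<delta> x [a] * \<Omega> x (a # J))"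
      unfolding contraction_def One_nat_def sum_lists_length_Suc by simp
    then show "contraction 1 \<Omega> \<delta> x J = exterior_derivative (contraction 2 \<Omega> \<pi>) x J"
      by (simp add: exterior_derivative_contraction[OF \<pi> form \<Omega>(2)] \<delta>_def)
  qed
  have "divergence 2 \<Omega> \<pi> = \<delta>"
    unfolding divergence_def
  proof (rule the_equality)
    show "multivector_field (2 - 1) \<delta> \<and> contraction (2 - 1) \<Omega> \<delta> = exterior_derivative (contraction 2 \<Omega> \<pi>)"
      using \<delta> contr by simp
    fix \<delta>' assume "multivector_field (2 - 1) \<delta>' \<and> contraction (2 - 1) \<Omega> \<delta>' = exterior_derivative (contraction 2 \<Omega> \<pi>)"
    then show "\<delta>' = \<delta>" using contraction_1_injective[OF \<Omega>(1) _ \<delta>, of \<delta>'] contr by simp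
  qed
  then have "\<delta> = (\<lambda>x I. 0)" using div by (simp only:)
  then have "\<delta> x [a] = 0" by (rule fun_cong[OF fun_cong, THEN trans]) simp
  then show ?thesis by (simp add: \<delta>_def)
qed

section \<open>The multidifferential operators\<close>

definition vertex_function ::
    "('d::finite) tensor_field \<Rightarrow> (real^'d \<Rightarrow> real) list \<Rightarrow> (nat \<times> nat \<Rightarrow> 'd) \<Rightarrow> vertex \<Rightarrow> real^'d \<Rightarrow> real" where
  "vertex_function \<pi> fs I v =
     (case v of FirstType k \<Rightarrow> (\<lambda>y. \<pi> y [I (k, 0), I (k, 1)]) | SecondType j \<Rightarrow> fs ! j)"

definition vertex_factor ::
    "nat \<Rightarrow> (nat \<times> nat \<Rightarrow> vertex) \<Rightarrow> ('d::finite) tensor_field \<Rightarrow> (real^'d \<Rightarrow> real) list \<Rightarrow> (nat \<times> nat \<Rightarrow> 'd) \<Rightarrow> vertex \<Rightarrow> real^'d \<Rightarrow> real" where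
  "vertex_factor n \<tau> \<pi> fs I v = partials (map I (filter (\<lambda>e. \<tau> e = v) (star_edges n))) (vertex_function \<pi> fs I v)"

text \<open>The integral of the operator of the graph with target map \<open>\<tau>\<close>, applied to three functions which sit at the
  vertices \<open>SecondType 0\<close>, \<open>SecondType 1\<close>, \<open>SecondType 2\<close>.\<close>

definition graph_integral ::
    "nat \<Rightarrow> (nat \<times> nat \<Rightarrow> vertex) \<Rightarrow> ('d::finite) tensor_field \<Rightarrow> (real^'d \<Rightarrow> real) list \<Rightarrow> real" where
  "graph_integral n \<tau> \<pi> fs =
     (LINT x|lborel. (\<Sum>I \<in> PiE (set (star_edges n)) (\<lambda>_. UNIV). \<Prod>v\<in>vertices n 3. vertex_factor n \<tau> \<pi> fs I v x))"

lemma finite_vertices [simp]: "finite (vertices n m)"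
  by (simp add: vertices_def)

lemma sum_PiE_split:
  assumes "finite A" "e \<in> A"
  shows "(\<Sum>\<tau>\<in>PiE A (\<lambda>_. V). F \<tau>) = (\<Sum>\<tau>\<in>PiE (A - {e}) (\<lambda>_. V). \<Sum>v\<in>V. F (\<tau>(e := v)))"
proof -
  have A: "A = insert e (A - {e})" using assms by auto
  have "PiE A (\<lambda>_. V) = (\<lambda>(v, \<tau>). \<tau>(e := v)) ` (V \<times> PiE (A - {e}) (\<lambda>_. V))"
    using PiE_insert_eq[of e "A - {e}" "\<lambda>_. V"] A by simp
  moreover have "inj_on (\<lambda>(v, \<tau>). \<tau>(e := v)) (V \<times> PiE (A - {e}) (\<lambda>_. V))"
    using inj_combinator[of e "A - {e}" "\<lambda>_. V"] by simp
  ultimately have "(\<Sum>\<tau>\<in>PiE A (\<lambda>_. V). F \<tau>) = (\<Sum>(v, \<tau>)\<in>V \<times> PiE (A - {e}) (\<lambda>_. V). F (\<tau>(e := v)))"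
    by (simp add: sum.reindex split_beta')
  also have "\<dots> = (\<Sum>v\<in>V. \<Sum>\<tau>\<in>PiE (A - {e}) (\<lambda>_. V). F (\<tau>(e := v)))"
    by (rule sum.cartesian_product[symmetric])
  finally show ?thesis by (simp only: sum.swap[of _ V])
qed

text \<open>Redirecting the edge \<open>e\<close> to \<open>v\<close>; multisets suffice because partial derivatives commute.\<close>

lemma mset_filter_target:
  assumes "distinct es" "e \<in> set es"
  shows "mset (map I (filter (\<lambda>e'. (\<tau>(e := v)) e' = u) es))
       = (if u = v then {#I e#} else {#}) + mset (map I (filter (\<lambda>e'. e' \<noteq> e \<and> \<tau> e' = u) es))"
proof -
  obtain xs ys where es: "es = xs @ e # ys" "e \<notin> set xs" "e \<notin> set ys"
    using assms by (auto dest!: split_list)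
  define P Q where "P = (\<lambda>e'. (\<tau>(e := v)) e' = u)" and "Q = (\<lambda>e'. e' \<noteq> e \<and> \<tau> e' = u)"
  have "filter P xs = filter Q xs" "filter P ys = filter Q ys"
    using es(2,3) by (auto intro!: filter_cong simp: P_def Q_def)
  moreover have "P e = (u = v)" "\<not> Q e" by (auto simp: P_def Q_def)
  ultimately show ?thesis unfolding P_def[symmetric] Q_def[symmetric] es(1) by simp
qed

lemma partials_zero: "partials is (\<lambda>_. 0) = (\<lambda>_. 0)"
  by (induction "is") simp_all

locale graph_data =
  fixes \<pi> :: "('d::finite) tensor_field" and fs :: "(real^'d \<Rightarrow> real) list"
  assumes bivector: "multivector_field 2 \<pi>"
    and length_fs: "length fs = 3"
    and smooth_fs: "\<And>f. f \<in> set fs \<Longrightarrow> smooth f"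
    and supported_fs: "\<And>f. f \<in> set fs \<Longrightarrow> compactly_supported f"
begin

lemma smooth_vertex_function: "v \<in> vertices n 3 \<Longrightarrow> smooth (vertex_function \<pi> fs I v)"
  using bivector smooth_fs length_fs by (auto simp: vertex_function_def vertices_def skew_field_def)

lemma supported_product:
  obtains K where "compact K"
    "\<And>is. supported_on K (\<lambda>x. \<Prod>v\<in>vertices n 3. partials (is v) (vertex_function \<pi> fs I v) x)"
proof -
  have "fs ! 0 \<in> set fs" using length_fs by simp
  then obtain K where K: "compact K" "supported_on K (fs ! 0)"
    using supported_fs compactly_supported_obtains by blast
  have "supported_on K (\<lambda>x. \<Prod>v\<in>vertices n 3. partials (is v) (vertex_function \<pi> fs I v) x)" for "is"
    unfolding supported_on_def
  proof (intro allI impI prod_zero finite_vertices bexI)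
    fix x assume "x \<notin> K"
    then show "partials (is (SecondType 0)) (vertex_function \<pi> fs I (SecondType 0)) x = 0"
      using supported_on_partials[OF compact_imp_closed[OF K(1)] K(2)]
      by (simp add: vertex_function_def supported_on_def)
    show "SecondType 0 \<in> vertices n 3" by (simp add: vertices_def)
  qed
  then show ?thesis using that K(1) by blast
qed

lemma integrable_vertex_factors:
  "integrable lborel (\<lambda>x. \<Prod>v\<in>vertices n 3. vertex_factor n \<tau> \<pi> fs I v x)"
proof -
  obtain K where "compact K" "\<And>is. supported_on K (\<lambda>x. \<Prod>v\<in>vertices n 3. partials (is v) (vertex_function \<pi> fs I v) x)"
    using supported_product[where n = n and I = I] by blast
  then show ?thesis unfolding vertex_factor_def
    by (intro integrable_supported_on smooth_imp_continuous smooth_prod smooth_partials smooth_vertex_function)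
qed

lemma graph_integral_sum:
  "graph_integral n \<tau> \<pi> fs = (\<Sum>I \<in> PiE (set (star_edges n)) (\<lambda>_. UNIV). LINT x|lborel. (\<Prod>v\<in>vertices n 3. vertex_factor n \<tau> \<pi> fs I v x))"
  unfolding graph_integral_def by (rule Bochner_Integration.integral_sum) (rule integrable_vertex_factors)

text \<open>Summing over all targets of an edge gives, by the Leibniz rule, the integral of a derivative.\<close>

lemma sum_targets:
  assumes e: "e \<in> set (star_edges n)"
  shows "(\<Sum>v\<in>vertices n 3. graph_integral n (\<tau>(e := v)) \<pi> fs) = 0"
proof -
  have "(\<Sum>v\<in>vertices n 3. LINT x|lborel. (\<Prod>u\<in>vertices n 3. vertex_factor n (\<tau>(e := v)) \<pi> fs I u x)) = 0" for I
  proof -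
    define Q where "Q = (\<lambda>u. partials (map I (filter (\<lambda>e'. e' \<noteq> e \<and> \<tau> e' = u) (star_edges n))) (vertex_function \<pi> fs I u))"
    have Q: "smooth (Q u)" if "u \<in> vertices n 3" for u
      unfolding Q_def by (intro smooth_partials smooth_vertex_function[OF that])
    have factor: "vertex_factor n (\<tau>(e := v)) \<pi> fs I u = (if u = v then partial (I e) (Q u) else Q u)" if "u \<in> vertices n 3" for u v
    proof (cases "u = v")
      case True
      have "vertex_factor n (\<tau>(e := v)) \<pi> fs I u
          = partials (I e # map I (filter (\<lambda>e'. e' \<noteq> e \<and> \<tau> e' = u) (star_edges n))) (vertex_function \<pi> fs I u)"
        unfolding vertex_factor_def
        by (rule partials_mset_cong[OF smooth_vertex_function[OF that]])
           (subst mset_filter_target[OF distinct_star_edges e], simp add: True)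
      then show ?thesis using True by (simp add: Q_def)
    next
      case False
      have "vertex_factor n (\<tau>(e := v)) \<pi> fs I u
          = partials (map I (filter (\<lambda>e'. e' \<noteq> e \<and> \<tau> e' = u) (star_edges n))) (vertex_function \<pi> fs I u)"
        unfolding vertex_factor_def
        by (rule partials_mset_cong[OF smooth_vertex_function[OF that]])
           (subst mset_filter_target[OF distinct_star_edges e], simp add: False)
      then show ?thesis using False by (simp add: Q_def)
    qed
    have "(\<Sum>v\<in>vertices n 3. LINT x|lborel. (\<Prod>u\<in>vertices n 3. vertex_factor n (\<tau>(e := v)) \<pi> fs I u x))
        = (LINT x|lborel. (\<Sum>v\<in>vertices n 3. \<Prod>u\<in>vertices n 3. vertex_factor n (\<tau>(e := v)) \<pi> fs I u x))"
      by (rule Bochner_Integration.integral_sum[symmetric]) (rule integrable_vertex_factors)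
    also have "\<dots> = (LINT x|lborel. partial (I e) (\<lambda>x. \<Prod>u\<in>vertices n 3. Q u x) x)"
      by (simp add: partial_prod Q factor cong: prod.cong)
    also have "\<dots> = 0"
    proof -
      obtain K where K: "compact K" "\<And>is. supported_on K (\<lambda>x. \<Prod>v\<in>vertices n 3. partials (is v) (vertex_function \<pi> fs I v) x)"
        using supported_product[where n = n and I = I] by blast
      show ?thesis
        by (rule integral_partial_eq_0[OF smooth_prod[OF Q] K(1)]) (simp_all add: Q_def K(2))
    qed
    finally show ?thesis .
  qed
  then show ?thesis unfolding graph_integral_sum by (subst sum.swap) simp
qed

text \<open>A loop at \<open>k\<close> differentiates the bivector field at \<open>k\<close> along its own index: this is its divergence.\<close>

lemma graph_integral_loop:
  assumes div: "\<And>a x. (\<Sum>b\<in>UNIV. partial b (\<lambda>y. \<pi> y [a, b]) x) = 0"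
    and e: "(k, l) \<in> set (star_edges n)" "\<tau> (k, l) = FirstType k"
  shows "graph_integral n \<tau> \<pi> fs = 0"
proof -
  let ?E = "set (star_edges n)"
  have sm: "smooth (\<lambda>y. \<pi> y J)" for J using bivector by (simp add: skew_field_def)
  have k: "FirstType k \<in> vertices n 3" "k < n" "l = 0 \<or> l = 1" using e(1) by (auto simp: set_star_edges vertices_def less_2_cases_iff)
  have div': "(\<Sum>b\<in>UNIV. partial b (\<lambda>y. \<pi> y [b, a]) x) = 0" for a x
  proof -
    have "partial b (\<lambda>y. \<pi> y [b, a]) x = - partial b (\<lambda>y. \<pi> y [a, b]) x" for b
    proof -
      have "\<pi> y [b, a] = - 1 * \<pi> y [a, b]" for y
        using alternating_transpose[of 2 "\<pi> y" 0 1 "[a, b]"] bivector by (simp add: skew_field_def)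
      then have "partial b (\<lambda>y. \<pi> y [b, a]) x = partial b (\<lambda>y. - 1 * \<pi> y [a, b]) x" by simp
      also have "\<dots> = - partial b (\<lambda>y. \<pi> y [a, b]) x"
        by (subst partial_mult) (simp_all add: smooth_imp_differentiable smooth_const sm)
      finally show ?thesis .
    qed
    then show ?thesis using div[of a x] by (simp add: sum_negf)
  qed
  have "(\<Sum>I \<in> PiE ?E (\<lambda>_. UNIV). \<Prod>v\<in>vertices n 3. vertex_factor n \<tau> \<pi> fs I v x) = 0" for x
  proof -
    have "(\<Sum>i\<in>UNIV. \<Prod>v\<in>vertices n 3. vertex_factor n \<tau> \<pi> fs (I((k, l) := i)) v x) = 0" for I
    proof -
      let ?I = "\<lambda>i. I((k, l) := i)" and ?v = "FirstType k"
      let ?others = "filter (\<lambda>e'. e' \<noteq> (k, l) \<and> \<tau> e' = ?v) (star_edges n)"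
      have rest: "vertex_factor n \<tau> \<pi> fs (?I i) v = vertex_factor n \<tau> \<pi> fs I v" if "v \<noteq> ?v" for v i
      proof -
        have "map (?I i) (filter (\<lambda>e. \<tau> e = v) (star_edges n)) = map I (filter (\<lambda>e. \<tau> e = v) (star_edges n))"
          using e(2) that by (intro map_cong) auto
        moreover have "vertex_function \<pi> fs (?I i) v = vertex_function \<pi> fs I v"
          using that by (auto simp: vertex_function_def split: vertex.splits)
        ultimately show ?thesis by (simp only: vertex_factor_def)
      qed
      have loop: "vertex_factor n \<tau> \<pi> fs (?I i) ?v = partials (map I ?others) (partial i (vertex_function \<pi> fs (?I i) ?v))" for i
      proof -
        have "\<tau> = \<tau>((k, l) := ?v)" using e(2) by auto
        then have "mset (map (?I i) (filter (\<lambda>e. \<tau> e = ?v) (star_edges n))) = {#i#} + mset (map (?I i) ?others)"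
          using mset_filter_target[OF distinct_star_edges e(1), of "?I i" \<tau> ?v ?v] by simp
        also have "map (?I i) ?others = map I ?others" by (intro map_cong) auto
        finally have F: "mset (map (?I i) (filter (\<lambda>e. \<tau> e = ?v) (star_edges n))) = {#i#} + mset (map I ?others)" .
        have "mset (map (?I i) (filter (\<lambda>e. \<tau> e = ?v) (star_edges n))) = mset (map I ?others @ [i])"
          unfolding F by simp
        then have "vertex_factor n \<tau> \<pi> fs (?I i) ?v = partials (map I ?others @ [i]) (vertex_function \<pi> fs (?I i) ?v)"
          unfolding vertex_factor_def by (rule partials_mset_cong[OF smooth_vertex_function[OF k(1)]])
        then show ?thesis by simp
      qed
      have "(\<Sum>i\<in>UNIV. vertex_factor n \<tau> \<pi> fs (?I i) ?v x) = partials (map I ?others) (\<lambda>y. \<Sum>i\<in>UNIV. partial i (vertex_function \<pi> fs (?I i) ?v) y) x"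
        unfolding loop by (subst partials_sum) (auto intro: smooth_partial smooth_vertex_function[OF k(1)])
      also have "(\<lambda>y. \<Sum>i\<in>UNIV. partial i (vertex_function \<pi> fs (?I i) ?v) y) = (\<lambda>y. 0)"
        using k(3) div div' by (auto simp: vertex_function_def)
      also have "partials (map I ?others) (\<lambda>y. 0) x = 0"
        by (simp only: partials_zero)
      finally have zero: "(\<Sum>i\<in>UNIV. vertex_factor n \<tau> \<pi> fs (?I i) ?v x) = 0" .
      have "(\<Prod>v\<in>vertices n 3. vertex_factor n \<tau> \<pi> fs (?I i) v x)
          = vertex_factor n \<tau> \<pi> fs (?I i) ?v x * (\<Prod>v\<in>vertices n 3 - {?v}. vertex_factor n \<tau> \<pi> fs I v x)" for i
        using k(1) by (subst prod.remove[of _ ?v]) (auto simp: rest)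
      then show ?thesis by (simp only: sum_distrib_right[symmetric] zero mult_zero_left)
    qed
    then show ?thesis by (subst sum_PiE_split[OF _ e(1)]) simp_all
  qed
  then show ?thesis unfolding graph_integral_def by simp
qed

end

lemma bij_betw_cyclic_vertex: "bij_betw cyclic_vertex (vertices n 3) (vertices n 3)"
proof -
  let ?g = "cyclic_vertex \<circ> cyclic_vertex"
  show ?thesis
    by (rule bij_betw_byWitness[where f' = ?g]) (auto simp: cyclic_vertex_def vertices_def)
qed

text \<open>Both integrands are the same product, with the factors at the three functions in another order.\<close>

lemma graph_integral_cyclic:
  fixes \<pi> :: "('d::finite) tensor_field"
  assumes "\<And>e. e \<in> set (star_edges n) \<Longrightarrow> \<tau> e \<in> vertices n 3"
  shows "graph_integral n (\<lambda>e. cyclic_vertex (\<tau> e)) \<pi> [g, h, f] = graph_integral n \<tau> \<pi> [f, g, h]"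
proof -
  have inj: "cyclic_vertex u = cyclic_vertex v \<longleftrightarrow> u = v" if "u \<in> vertices n 3" "v \<in> vertices n 3" for u v
    using bij_betw_cyclic_vertex[of n] that by (auto simp: bij_betw_def inj_on_def)
  have "vertex_factor n (\<lambda>e. cyclic_vertex (\<tau> e)) \<pi> [g, h, f] I (cyclic_vertex v) = vertex_factor n \<tau> \<pi> [f, g, h] I v"
    if v: "v \<in> vertices n 3" for I v
  proof -
    have "filter (\<lambda>e. cyclic_vertex (\<tau> e) = cyclic_vertex v) (star_edges n) = filter (\<lambda>e. \<tau> e = v) (star_edges n)"
      using assms inj v by (intro filter_cong) auto
    moreover have "vertex_function \<pi> [g, h, f] I (cyclic_vertex v) = vertex_function \<pi> [f, g, h] I v"
      using v by (auto simp: vertices_def vertex_function_def cyclic_vertex_def less_Suc_eq numeral_3_eq_3)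
    ultimately show ?thesis by (simp add: vertex_factor_def)
  qed
  then have "(\<Prod>v\<in>vertices n 3. vertex_factor n (\<lambda>e. cyclic_vertex (\<tau> e)) \<pi> [g, h, f] I v x)
      = (\<Prod>v\<in>vertices n 3. vertex_factor n \<tau> \<pi> [f, g, h] I v x)" for I x
    using prod.reindex_bij_betw[OF bij_betw_cyclic_vertex[of n], of "\<lambda>v. vertex_factor n (\<lambda>e. cyclic_vertex (\<tau> e)) \<pi> [g, h, f] I v x"]
    by (simp cong: prod.cong)
  then show ?thesis by (simp add: graph_integral_def)
qed

section \<open>Cyclic symmetry of the sum over graphs\<close>

abbreviation target_maps :: "nat \<Rightarrow> (nat \<times> nat \<Rightarrow> vertex) set" where
  "target_maps n \<equiv> PiE (set (star_edges n)) (\<lambda>_. vertices n 3)"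

abbreviation graph_row :: "nat \<Rightarrow> (nat \<times> nat \<Rightarrow> vertex) \<Rightarrow> nat \<times> nat \<Rightarrow> (nat \<Rightarrow> real) \<Rightarrow> nat \<Rightarrow> real" where
  "graph_row n \<tau> e \<equiv> angle_row n (fst e) (\<tau> e)"

lemma configuration_integral_cong:
  assumes "\<And>e. e \<in> set (star_edges n) \<Longrightarrow> \<rho> e = \<rho>' e"
  shows "configuration_integral n \<rho> = configuration_integral n \<rho>'"
proof -
  have "map (\<lambda>e. \<rho> e y) (star_edges n) = map (\<lambda>e. \<rho>' e y) (star_edges n)" for y
    using assms by (intro map_cong) auto
  then show ?thesis unfolding configuration_integral_def configuration_form_def by (simp only:)
qed

abbreviation graph_sum :: "nat \<Rightarrow> ('d::finite) tensor_field \<Rightarrow> (real^'d \<Rightarrow> real) list \<Rightarrow> real" where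
  "graph_sum n \<pi> fs \<equiv>
     (\<Sum>\<tau>\<in>target_maps n. configuration_integral n (graph_row n \<tau>) * graph_integral n \<tau> \<pi> fs)"

text \<open>The angle of the edges in \<open>S\<close> is measured from the first function instead of the third one.\<close>

definition shifted_row :: "nat \<Rightarrow> (nat \<times> nat) set \<Rightarrow> (nat \<times> nat \<Rightarrow> vertex) \<Rightarrow> nat \<times> nat \<Rightarrow> (nat \<Rightarrow> real) \<Rightarrow> nat \<Rightarrow> real" where
  "shifted_row n S \<tau> e =
     (if e \<in> S then (\<lambda>y j. graph_row n \<tau> e y j - angle_row n (fst e) (SecondType 0) y j) else graph_row n \<tau> e)"

text \<open>Moving one edge from the unshifted to the shifted form changes the weight by a term that does not depend on the
  target of this edge. Such a term does not contribute to the sum, by \<open>sum_targets\<close>.\<close>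

lemma (in graph_data) sum_shifted_row:
  assumes n: "n \<ge> 1" and S: "S \<subseteq> set (star_edges n)"
  shows "(\<Sum>\<tau>\<in>target_maps n. configuration_integral n (shifted_row n S \<tau>) * graph_integral n \<tau> \<pi> fs)
       = graph_sum n \<pi> fs"
proof -
  have "finite S" using S finite_subset by blast
  then show ?thesis using S
  proof (induction S rule: finite_induct)
    case empty
    then show ?case by (simp add: shifted_row_def[abs_def])
  next
    case (insert e S)
    let ?V = "vertices n 3" and ?E = "set (star_edges n)"
    let ?\<gamma> = "angle_row n (fst e) (SecondType 0)"
    have e: "e \<in> ?E" using insert.prems by simp
    have comb: "arg_combination {2..<2 * n + 2} (angle_row n (fst e') v)" if "e' \<in> ?E" "v \<in> ?V" for e' v
      using that by (intro arg_combination_angle_row) (auto simp: set_star_edges)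
    have S0: "SecondType 0 \<in> ?V" by (simp add: vertices_def)
    have split: "configuration_integral n (shifted_row n (insert e S) \<tau>)
        = configuration_integral n (shifted_row n S \<tau>) - configuration_integral n ((shifted_row n S \<tau>)(e := ?\<gamma>))"
      if \<tau>: "\<tau> \<in> target_maps n" for \<tau>
    proof -
      have V: "\<tau> e' \<in> ?V" if "e' \<in> ?E" for e' using \<tau> that by auto
      have 1: "shifted_row n (insert e S) \<tau> = (shifted_row n S \<tau>)(e := \<lambda>y j. graph_row n \<tau> e y j - ?\<gamma> y j)"
        by (auto simp: shifted_row_def fun_eq_iff)
      have 2: "(shifted_row n S \<tau>)(e := graph_row n \<tau> e) = shifted_row n S \<tau>"
        using insert.hyps by (auto simp: shifted_row_def fun_eq_iff)
      have "configuration_integral n ((shifted_row n S \<tau>)(e := \<lambda>y j. graph_row n \<tau> e y j - ?\<gamma> y j))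
          = configuration_integral n ((shifted_row n S \<tau>)(e := graph_row n \<tau> e))
          - configuration_integral n ((shifted_row n S \<tau>)(e := ?\<gamma>))"
      proof (rule configuration_integral_linear[OF n _ comb[OF e V[OF e]] comb[OF e S0] e])
        fix e' assume "e' \<in> ?E"
        then show "arg_combination {2..<2 * n + 2} (shifted_row n S \<tau> e')"
          using comb V S0 by (simp add: shifted_row_def arg_combination_diff)
      qed
      then show ?thesis unfolding 1 2 .
    qed
    have "(\<Sum>\<tau>\<in>target_maps n. configuration_integral n ((shifted_row n S \<tau>)(e := ?\<gamma>)) * graph_integral n \<tau> \<pi> fs)
        = (\<Sum>\<tau>\<in>PiE (?E - {e}) (\<lambda>_. ?V). \<Sum>v\<in>?V. configuration_integral n ((shifted_row n S (\<tau>(e := v)))(e := ?\<gamma>)) * graph_integral n (\<tau>(e := v)) \<pi> fs)"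
      by (rule sum_PiE_split) (use e in auto)
    also have "\<dots> = (\<Sum>\<tau>\<in>PiE (?E - {e}) (\<lambda>_. ?V). configuration_integral n ((shifted_row n S \<tau>)(e := ?\<gamma>)) * (\<Sum>v\<in>?V. graph_integral n (\<tau>(e := v)) \<pi> fs))"
    proof -
      have "(shifted_row n S (\<tau>(e := v)))(e := ?\<gamma>) = (shifted_row n S \<tau>)(e := ?\<gamma>)" for \<tau> v
        by (auto simp: shifted_row_def fun_eq_iff)
      then show ?thesis by (simp only: sum_distrib_left)
    qed
    also have "\<dots> = 0" by (simp add: sum_targets[OF e])
    finally have zero: "(\<Sum>\<tau>\<in>target_maps n. configuration_integral n ((shifted_row n S \<tau>)(e := ?\<gamma>)) * graph_integral n \<tau> \<pi> fs) = 0" .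
    have "(\<Sum>\<tau>\<in>target_maps n. configuration_integral n (shifted_row n (insert e S) \<tau>) * graph_integral n \<tau> \<pi> fs)
        = (\<Sum>\<tau>\<in>target_maps n. configuration_integral n (shifted_row n S \<tau>) * graph_integral n \<tau> \<pi> fs
             - configuration_integral n ((shifted_row n S \<tau>)(e := ?\<gamma>)) * graph_integral n \<tau> \<pi> fs)"
      by (intro sum.cong refl) (simp add: split left_diff_distrib)
    also have "\<dots> = (\<Sum>\<tau>\<in>target_maps n. configuration_integral n (shifted_row n S \<tau>) * graph_integral n \<tau> \<pi> fs)"
      unfolding sum_subtractf zero by simp
    finally show ?case using insert by simp
  qed
qed

text \<open>All edges are shifted, then the configuration is rotated. Graphs with loops, for which the rotation is not available,
  do not contribute because \<open>\<pi>\<close> is divergence-free.\<close>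

lemma cyclic_sum_over_graphs:
  fixes \<pi> :: "('d::finite) tensor_field"
  assumes n: "n \<ge> 1" and \<pi>: "multivector_field 2 \<pi>"
    and div: "\<And>a x. (\<Sum>b\<in>UNIV. partial b (\<lambda>y. \<pi> y [a, b]) x) = 0"
    and fgh: "smooth f" "smooth g" "smooth h" "compactly_supported f" "compactly_supported g" "compactly_supported h"
  shows "graph_sum n \<pi> [f, g, h]
       = graph_sum n \<pi> [g, h, f]"
proof -
  let ?E = "set (star_edges n)" and ?V = "vertices n 3"
  interpret graph_data \<pi> "[f, g, h]" by unfold_locales (use \<pi> fgh in auto)
  let ?\<sigma> = "\<lambda>\<tau>. \<lambda>e\<in>?E. cyclic_vertex (\<tau> e)"
  have "graph_sum n \<pi> [f, g, h]
      = (\<Sum>\<tau>\<in>target_maps n. configuration_integral n (shifted_row n ?E \<tau>) * graph_integral n \<tau> \<pi> [f, g, h])"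
    by (rule sum_shifted_row[OF n order_refl, symmetric])
  also have "\<dots> = (\<Sum>\<tau>\<in>target_maps n. configuration_integral n (graph_row n (?\<sigma> \<tau>)) * graph_integral n (?\<sigma> \<tau>) \<pi> [g, h, f])"
  proof (rule sum.cong[OF refl])
    fix \<tau> assume \<tau>: "\<tau> \<in> target_maps n"
    have V: "\<tau> e \<in> ?V" if "e \<in> ?E" for e using \<tau> that by auto
    have "graph_integral n (?\<sigma> \<tau>) \<pi> [g, h, f] = graph_integral n (\<lambda>e. cyclic_vertex (\<tau> e)) \<pi> [g, h, f]"
    proof -
      have "filter (\<lambda>e. ?\<sigma> \<tau> e = v) (star_edges n) = filter (\<lambda>e. cyclic_vertex (\<tau> e) = v) (star_edges n)" for v
        by (intro filter_cong) auto
      then show ?thesis unfolding graph_integral_def vertex_factor_def by (simp only:)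
    qed
    also have "\<dots> = graph_integral n \<tau> \<pi> [f, g, h]"
      by (rule graph_integral_cyclic) (rule V)
    finally have B: "graph_integral n (?\<sigma> \<tau>) \<pi> [g, h, f] = graph_integral n \<tau> \<pi> [f, g, h]" .
    show "configuration_integral n (shifted_row n ?E \<tau>) * graph_integral n \<tau> \<pi> [f, g, h]
        = configuration_integral n (graph_row n (?\<sigma> \<tau>)) * graph_integral n (?\<sigma> \<tau>) \<pi> [g, h, f]"
    proof (cases "\<exists>(k, l)\<in>?E. \<tau> (k, l) = FirstType k")
      case True
      then show ?thesis using graph_integral_loop[OF div] unfolding B by auto
    next
      case False
      have "configuration_integral n (shifted_row n ?E \<tau>)
          = configuration_integral n (relative_row n \<tau>)"
        by (rule configuration_integral_cong) (simp add: shifted_row_def)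
      also have "\<dots> = configuration_integral n (\<lambda>e. angle_row n (fst e) (cyclic_vertex (\<tau> e)))"
        by (rule configuration_integral_rotation[OF n]) (use V False in auto)
      also have "\<dots> = configuration_integral n (graph_row n (?\<sigma> \<tau>))"
        by (rule configuration_integral_cong) simp
      finally show ?thesis unfolding B by simp
    qed
  qed
  also have "\<dots> = graph_sum n \<pi> [g, h, f]"
  proof (rule sum.reindex_bij_betw)
    have inj: "inj_on cyclic_vertex ?V" and im: "cyclic_vertex ` ?V = ?V"
      using bij_betw_cyclic_vertex[of n] by (auto simp: bij_betw_def)
    let ?inv = "\<lambda>\<tau>. \<lambda>e\<in>?E. inv_into ?V cyclic_vertex (\<tau> e)"
    show "bij_betw ?\<sigma> (target_maps n) (target_maps n)"
    proof (rule bij_betw_byWitness[where f' = ?inv])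
      show "\<forall>\<tau>\<in>target_maps n. ?inv (?\<sigma> \<tau>) = \<tau>"
        using inj by (auto simp: fun_eq_iff PiE_iff extensional_def inv_into_f_f)
      show "\<forall>\<tau>\<in>target_maps n. ?\<sigma> (?inv \<tau>) = \<tau>"
        using im by (auto simp: fun_eq_iff PiE_iff extensional_def f_inv_into_f)
      show "?\<sigma> ` target_maps n \<subseteq> target_maps n" using im by (auto simp: PiE_iff)
      show "?inv ` target_maps n \<subseteq> target_maps n" using im by (auto simp: PiE_iff inv_into_into)
    qed
  qed
  finally show ?thesis .
qed

section \<open>The star product as a sum over target maps\<close>

definition star_graph :: "nat \<Rightarrow> (nat \<times> nat \<Rightarrow> vertex) \<Rightarrow> graph" where
  "star_graph n \<tau> = map (\<lambda>k. [\<tau> (k, 0), \<tau> (k, 1)]) [0..<n]"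

lemma length_star_graph [simp]: "length (star_graph n \<tau>) = n"
  by (simp add: star_graph_def)

lemma nth_star_graph [simp]: "k < n \<Longrightarrow> star_graph n \<tau> ! k = [\<tau> (k, 0), \<tau> (k, 1)]"
  by (simp add: star_graph_def)

lemma edges_star_graph: "edges (star_graph n \<tau>) = star_edges n"
proof -
  have "map (\<lambda>k. map (\<lambda>l. (k, l)) [0..<length (star_graph n \<tau> ! k)]) [0..<n]
      = map (\<lambda>k. map (\<lambda>l. (k, l)) [0..<2]) [0..<n]"
    by (intro map_cong) (auto simp: numeral_2_eq_2)
  then show ?thesis unfolding edges_def star_edges_def length_star_graph by (simp only:)
qed

lemma target_star_graph: "e \<in> set (star_edges n) \<Longrightarrow> target (star_graph n \<tau>) e = \<tau> e"
  by (auto simp: set_star_edges target_def less_2_cases_iff)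

lemma incoming_star_graph: "incoming (star_graph n \<tau>) v = filter (\<lambda>e. \<tau> e = v) (star_edges n)"
  unfolding incoming_def edges_star_graph by (intro filter_cong) (auto simp: target_star_graph)

definition weight_factor :: "nat \<Rightarrow> real" where
  "weight_factor n = (1 / 2) ^ n * (1 / (2 * pi) ^ (2 * n))"

lemma weight_star_graph:
  assumes \<tau>: "\<And>k l. (k, l) \<in> set (star_edges n) \<Longrightarrow> \<tau> (k, l) \<in> vertices n 2 - {FirstType k}"
  shows "weight n 2 (star_graph n \<tau>) = weight_factor n * configuration_integral n (graph_row n \<tau>)"
proof -
  have "indicator (configurations n 2) (gauge_fix y) *
        wedge_covectors (map (angle_form n (star_graph n \<tau>) (gauge_fix y)) (star_edges n)) [2..<2 * n + 2]
      = configuration_form n (graph_row n \<tau>) y" for y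
  proof (cases "gauge_fix y \<in> configurations n 2")
    case conf: True
    have "angle_form n (star_graph n \<tau>) (gauge_fix y) e j = graph_row n \<tau> e y j" if e: "e \<in> set (star_edges n)" for e j
    proof -
      obtain k l where [simp]: "e = (k, l)" by fastforce
      let ?p = "position n (gauge_fix y)"
      have k: "k < n" and v: "\<tau> e \<in> vertices n 2" "\<tau> e \<noteq> FirstType k"
        using e \<tau>[of k l] by (auto simp: set_star_edges)
      have upper: "Im (?p (FirstType i)) > 0" if "i < n" for i using conf that by (auto simp: configurations_def)
      have ne: "?p (FirstType k) \<noteq> ?p (\<tau> e) \<and> ?p (FirstType k) \<noteq> cnj (?p (\<tau> e))"
      proof (cases "\<tau> e")
        case (FirstType i)
        then have i: "i < n" "i \<noteq> k" using v by (auto simp: vertices_def)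
        then have "?p (FirstType k) \<noteq> ?p (FirstType i)" using conf k by (auto simp: configurations_def inj_on_def)
        then show ?thesis using upper[OF k] upper[OF i(1)] FirstType by (auto simp: complex_eq_iff)
      next
        case (SecondType i)
        then show ?thesis using upper[OF k] by (auto simp: complex_eq_iff position_def)
      qed
      have "\<tau> e \<noteq> SecondType 2" using v by (auto simp: vertices_def)
      then show ?thesis
        using angle_form_eq[of n "gauge_fix y" e "star_graph n \<tau>" j] ne target_star_graph[OF e, of \<tau>]
        by (simp add: angle_row_def)
    qed
    then have "wedge_covectors (map (angle_form n (star_graph n \<tau>) (gauge_fix y)) (star_edges n)) [2..<2 * n + 2]
        = wedge_covectors (map (\<lambda>e. graph_row n \<tau> e y) (star_edges n)) [2..<2 * n + 2]"
      by (intro wedge_covectors_cong) simp_all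
    then show ?thesis by (simp only: configuration_form_def)
  next
    case False
    then show ?thesis by (simp add: configuration_form_def)
  qed
  then have "quotient_integral n 2 (\<lambda>x. wedge_covectors (map (angle_form n (star_graph n \<tau>) x) (edges (star_graph n \<tau>))))
      = configuration_integral n (graph_row n \<tau>)"
    unfolding quotient_integral_def edges_star_graph configuration_integral_def by (simp only:)
  then show ?thesis
    by (simp add: weight_def weight_factor_def power_one_over)
qed

lemma prod_vertices:
  "(\<Prod>v\<in>vertices n m. F v) = (\<Prod>i<n. F (FirstType i)) * (\<Prod>j<m. F (SecondType j))"
  unfolding vertices_def
  by (subst prod.union_disjoint) (auto simp: prod.reindex inj_on_def)

lemma graph_operator_star_graph:
  assumes \<pi>: "multivector_field 2 \<pi>" and \<tau>: "\<And>e. e \<in> set (star_edges n) \<Longrightarrow> \<tau> e \<noteq> SecondType 2"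
  shows "graph_operator (star_graph n \<tau>) (replicate n \<pi>) [f, g] x * h x
       = (\<Sum>I \<in> PiE (set (star_edges n)) (\<lambda>_. UNIV). \<Prod>v\<in>vertices n 3. vertex_factor n \<tau> \<pi> [f, g, h] I v x)"
proof -
  have "filter (\<lambda>e. \<tau> e = SecondType 2) (star_edges n) = []" using \<tau> by (auto simp: filter_empty_conv)
  then have h: "vertex_factor n \<tau> \<pi> [f, g, h] I (SecondType 2) x = h x" for I
    by (simp add: vertex_factor_def vertex_function_def)
  have 3: "{..<3::nat} = {0, 1, 2}" and 2: "{..<2::nat} = {0, 1}" by auto
  have "(\<Prod>i<n. partials (map I (incoming (star_graph n \<tau>) (FirstType i)))
           (\<lambda>y. (replicate n \<pi> ! i) y (map (\<lambda>l. I (i, l)) [0..<length (star_graph n \<tau> ! i)])) x)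
      = (\<Prod>i<n. vertex_factor n \<tau> \<pi> [f, g, h] I (FirstType i) x)" for I
    by (intro prod.cong refl) (simp add: incoming_star_graph vertex_factor_def vertex_function_def upt_rec)
  moreover have "(\<Prod>j<length [f, g]. partials (map I (incoming (star_graph n \<tau>) (SecondType j))) ([f, g] ! j) x) * h x
      = (\<Prod>j<3. vertex_factor n \<tau> \<pi> [f, g, h] I (SecondType j) x)" for I
    unfolding 3 by (simp add: h 2 numeral_2_eq_2[symmetric]) (simp add: incoming_star_graph vertex_factor_def vertex_function_def)
  moreover have cond: "\<forall>i<length (star_graph n \<tau>). multivector_field (length (star_graph n \<tau> ! i)) (replicate n \<pi> ! i)"
    using \<pi> by (simp add: numeral_2_eq_2)
  ultimately show ?thesis
    unfolding graph_operator_def prod_vertices if_P[OF cond]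
    by (simp only: edges_star_graph length_star_graph sum_distrib_right mult.assoc)
qed

text \<open>A field that is both a bivector field and a \<open>k\<close>-vector field for \<open>k \<noteq> 2\<close> vanishes.\<close>

lemma graph_operator_zero:
  assumes \<pi>: "multivector_field 2 \<pi>" and k: "k < n" "length \<Gamma> = n" "length (\<Gamma> ! k) \<noteq> 2"
  shows "graph_operator \<Gamma> (replicate n \<pi>) fs x = 0"
proof (cases "\<forall>i<length \<Gamma>. multivector_field (length (\<Gamma> ! i)) (replicate n \<pi> ! i)")
  case True
  then have "multivector_field (length (\<Gamma> ! k)) \<pi>" using k by auto
  then have "\<pi> y I = 0" for y I
    using \<pi> k(3) unfolding skew_field_def alternating_def by metis
  then have "(\<Prod>i<length \<Gamma>. partials (map I (incoming \<Gamma> (FirstType i)))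
      (\<lambda>y. (replicate n \<pi> ! i) y (map (\<lambda>l. I (i, l)) [0..<length (\<Gamma> ! i)])) x) = 0" for I
    using k by (intro prod_zero bexI[of _ k]) (auto simp: partials_zero)
  then show ?thesis unfolding graph_operator_def by (simp only: mult_zero_left sum.neutral_const if_cancel)
next
  case False
  then show ?thesis unfolding graph_operator_def by (rule if_not_P)
qed

text \<open>The target maps that come from admissible graphs with two functions.\<close>

definition proper_target_maps :: "nat \<Rightarrow> (nat \<times> nat \<Rightarrow> vertex) set" where
  "proper_target_maps n =
     {\<tau> \<in> target_maps n. (\<forall>e\<in>set (star_edges n). \<tau> e \<noteq> SecondType 2 \<and> \<tau> e \<noteq> FirstType (fst e)) \<and>
        (\<forall>k<n. \<tau> (k, 0) \<noteq> \<tau> (k, 1))}"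

lemma bij_betw_star_graph:
  "bij_betw (star_graph n) (proper_target_maps n)
     {\<Gamma> \<in> admissible_graphs n 2. \<forall>k<n. length (\<Gamma> ! k) = 2}"
proof (rule bij_betw_byWitness[where f' = "\<lambda>\<Gamma>. restrict (target \<Gamma>) (set (star_edges n))"])
  show "\<forall>\<tau>\<in>proper_target_maps n. restrict (target (star_graph n \<tau>)) (set (star_edges n)) = \<tau>"
    by (auto simp: proper_target_maps_def fun_eq_iff target_star_graph PiE_iff extensional_def)
  have two: "xs = [xs ! 0, xs ! 1]" if "length xs = 2" for xs :: "vertex list"
    using that by (auto simp: numeral_2_eq_2 length_Suc_conv)
  show "\<forall>\<Gamma>\<in>{\<Gamma> \<in> admissible_graphs n 2. \<forall>k<n. length (\<Gamma> ! k) = 2}. star_graph n (restrict (target \<Gamma>) (set (star_edges n))) = \<Gamma>"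
    by (auto simp: admissible_graphs_def set_star_edges target_def two[symmetric] simp del: One_nat_def intro!: nth_equalityI)
  show "star_graph n ` proper_target_maps n \<subseteq> {\<Gamma> \<in> admissible_graphs n 2. \<forall>k<n. length (\<Gamma> ! k) = 2}"
  proof safe
    fix \<tau> assume \<tau>: "\<tau> \<in> proper_target_maps n"
    have "\<tau> (k, l) \<in> vertices n 2 - {FirstType k}" if "k < n" "l < 2" for k l
    proof -
      have "(k, l) \<in> set (star_edges n)" using that by (simp add: set_star_edges)
      then have "\<tau> (k, l) \<in> vertices n 3" "\<tau> (k, l) \<noteq> SecondType 2" "\<tau> (k, l) \<noteq> FirstType k"
        using \<tau> by (auto simp: proper_target_maps_def)
      then show ?thesis by (auto simp: vertices_def numeral_3_eq_3 numeral_2_eq_2 less_Suc_eq)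
    qed
    then show "star_graph n \<tau> \<in> admissible_graphs n 2"
      using \<tau> by (auto simp: admissible_graphs_def proper_target_maps_def)
  qed simp
  show "(\<lambda>\<Gamma>. restrict (target \<Gamma>) (set (star_edges n))) ` {\<Gamma> \<in> admissible_graphs n 2. \<forall>k<n. length (\<Gamma> ! k) = 2} \<subseteq> proper_target_maps n"
  proof safe
    fix \<Gamma> assume \<Gamma>: "\<Gamma> \<in> admissible_graphs n 2" "\<forall>k<n. length (\<Gamma> ! k) = 2"
    have "\<Gamma> ! k ! l \<in> vertices n 2 - {FirstType k}" if "k < n" "l < 2" for k l
      using \<Gamma> that unfolding admissible_graphs_def by (metis (mono_tags, lifting) mem_Collect_eq nth_mem subsetD)
    then have v: "target \<Gamma> e \<in> vertices n 2 - {FirstType (fst e)}" if "e \<in> set (star_edges n)" for e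
      using that by (auto simp: set_star_edges target_def)
    have "vertices n 2 \<subseteq> vertices n 3 - {SecondType 2}" by (auto simp: vertices_def)
    then have v': "target \<Gamma> e \<in> vertices n 3" "target \<Gamma> e \<noteq> SecondType 2" "target \<Gamma> e \<noteq> FirstType (fst e)"
      if "e \<in> set (star_edges n)" for e
      using v[OF that] by auto
    have "target \<Gamma> (k, 0) \<noteq> target \<Gamma> (k, 1)" if "k < n" for k
      using \<Gamma> that by (simp add: target_def admissible_graphs_def nth_eq_iff_index_eq)
    then show "restrict (target \<Gamma>) (set (star_edges n)) \<in> proper_target_maps n"
      using v' by (auto simp: proper_target_maps_def set_star_edges)
  qed
qed

text \<open>Passing from admissible graphs to all target maps adds only zeros: an edge towards \<open>\<infinity>\<close> and a double edge have a
  vanishing weight, a loop has a vanishing integral.\<close>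

lemma integral_formality_component:
  fixes \<pi> :: "('d::finite) tensor_field"
  assumes n: "n \<ge> 1" and \<pi>: "multivector_field 2 \<pi>"
    and div: "\<And>a x. (\<Sum>b\<in>UNIV. partial b (\<lambda>y. \<pi> y [a, b]) x) = 0"
    and fgh: "smooth f" "smooth g" "smooth h" "compactly_supported f" "compactly_supported g" "compactly_supported h"
  shows "(LINT x|lborel. formality_component n (replicate n \<pi>) [f, g] x * h x)
       = weight_factor n * graph_sum n \<pi> [f, g, h]"
proof -
  interpret graph_data \<pi> "[f, g, h]" by unfold_locales (use \<pi> fgh in auto)
  let ?A = "{\<Gamma>. \<Gamma> \<in> admissible_graphs n 2 \<and> length (edges \<Gamma>) + 2 = 2 * n + 2}"
  let ?B = "{\<Gamma> \<in> admissible_graphs n 2. \<forall>k<n. length (\<Gamma> ! k) = 2}"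
  let ?W = "\<lambda>\<tau>. configuration_integral n (graph_row n \<tau>)"
  let ?G = "\<lambda>\<tau> x. \<Sum>I \<in> PiE (set (star_edges n)) (\<lambda>_. UNIV). \<Prod>v\<in>vertices n 3. vertex_factor n \<tau> \<pi> [f, g, h] I v x"
  have "finite {\<Gamma>. set \<Gamma> \<subseteq> {xs. set xs \<subseteq> vertices n 2 \<and> length xs \<le> card (vertices n 2)} \<and> length \<Gamma> = n}"
    by (intro finite_lists_length_eq finite_lists_length_le finite_vertices)
  moreover have "admissible_graphs n 2 \<subseteq> {\<Gamma>. set \<Gamma> \<subseteq> {xs. set xs \<subseteq> vertices n 2 \<and> length xs \<le> card (vertices n 2)} \<and> length \<Gamma> = n}"
  proof
    fix \<Gamma> assume \<Gamma>: "\<Gamma> \<in> admissible_graphs n 2"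
    have "set xs \<subseteq> vertices n 2 \<and> length xs \<le> card (vertices n 2)" if "xs \<in> set \<Gamma>" for xs
    proof -
      have xs: "distinct xs" "set xs \<subseteq> vertices n 2" using \<Gamma> that by (auto simp: admissible_graphs_def in_set_conv_nth)
      then show ?thesis by (metis card_mono distinct_card finite_vertices)
    qed
    then show "\<Gamma> \<in> {\<Gamma>. set \<Gamma> \<subseteq> {xs. set xs \<subseteq> vertices n 2 \<and> length xs \<le> card (vertices n 2)} \<and> length \<Gamma> = n}"
      using \<Gamma> by (auto simp: admissible_graphs_def)
  qed
  ultimately have fin: "finite (admissible_graphs n 2)" by (rule finite_subset[rotated])
  have "formality_component n (replicate n \<pi>) [f, g] x * h x = (\<Sum>\<tau>\<in>proper_target_maps n. weight_factor n * ?W \<tau> * ?G \<tau> x)" for x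
  proof -
    have sub: "?B \<subseteq> ?A"
    proof safe
      fix \<Gamma> assume \<Gamma>: "\<Gamma> \<in> admissible_graphs n 2" "\<forall>k<n. length (\<Gamma> ! k) = 2"
      then obtain \<tau> where "\<Gamma> = star_graph n \<tau>" using bij_betw_star_graph[of n] unfolding bij_betw_def by blast
      then show "length (edges \<Gamma>) + 2 = 2 * n + 2" by (simp add: edges_star_graph length_star_edges)
    qed
    have "formality_component n (replicate n \<pi>) [f, g] x = (\<Sum>\<Gamma>\<in>?A. weight n 2 \<Gamma> * graph_operator \<Gamma> (replicate n \<pi>) [f, g] x)"
      by (simp add: formality_component_def numeral_2_eq_2)
    also have "\<dots> = (\<Sum>\<Gamma>\<in>?B. weight n 2 \<Gamma> * graph_operator \<Gamma> (replicate n \<pi>) [f, g] x)"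
    proof (rule sum.mono_neutral_right)
      show "finite ?A" using fin by simp
      show "\<forall>\<Gamma>\<in>?A - ?B. weight n 2 \<Gamma> * graph_operator \<Gamma> (replicate n \<pi>) [f, g] x = 0"
      proof
        fix \<Gamma> assume \<Gamma>: "\<Gamma> \<in> ?A - ?B"
        then obtain k where "k < n" "length (\<Gamma> ! k) \<noteq> 2" by auto
        moreover have "length \<Gamma> = n" using \<Gamma> by (simp add: admissible_graphs_def)
        ultimately show "weight n 2 \<Gamma> * graph_operator \<Gamma> (replicate n \<pi>) [f, g] x = 0"
          using graph_operator_zero[OF \<pi>] by simp
      qed
    qed (rule sub)
    also have "\<dots> = (\<Sum>\<tau>\<in>proper_target_maps n. weight n 2 (star_graph n \<tau>) * graph_operator (star_graph n \<tau>) (replicate n \<pi>) [f, g] x)"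
      by (rule sum.reindex_bij_betw[OF bij_betw_star_graph, symmetric])
    finally have "formality_component n (replicate n \<pi>) [f, g] x * h x
        = (\<Sum>\<tau>\<in>proper_target_maps n. weight n 2 (star_graph n \<tau>) * (graph_operator (star_graph n \<tau>) (replicate n \<pi>) [f, g] x * h x))"
      by (simp add: sum_distrib_right mult.assoc)
    also have "\<dots> = (\<Sum>\<tau>\<in>proper_target_maps n. weight_factor n * ?W \<tau> * ?G \<tau> x)"
    proof (rule sum.cong[OF refl])
      fix \<tau> assume \<tau>: "\<tau> \<in> proper_target_maps n"
      then have "\<tau> (k, l) \<in> vertices n 2 - {FirstType k}" if "(k, l) \<in> set (star_edges n)" for k l
        using that by (force simp: proper_target_maps_def PiE_iff vertices_def numeral_3_eq_3 numeral_2_eq_2 less_Suc_eq)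
      moreover have "\<tau> e \<noteq> SecondType 2" if "e \<in> set (star_edges n)" for e using \<tau> that by (auto simp: proper_target_maps_def)
      ultimately have "weight n 2 (star_graph n \<tau>) = weight_factor n * ?W \<tau>"
        "graph_operator (star_graph n \<tau>) (replicate n \<pi>) [f, g] x * h x = ?G \<tau> x"
        by (auto intro!: weight_star_graph graph_operator_star_graph[OF \<pi>])
      then show "weight n 2 (star_graph n \<tau>) * (graph_operator (star_graph n \<tau>) (replicate n \<pi>) [f, g] x * h x) = weight_factor n * ?W \<tau> * ?G \<tau> x"
        by (simp only:)
    qed
    finally show ?thesis .
  qed
  then have "(LINT x|lborel. formality_component n (replicate n \<pi>) [f, g] x * h x)
      = (LINT x|lborel. (\<Sum>\<tau>\<in>proper_target_maps n. weight_factor n * ?W \<tau> * ?G \<tau> x))" by (simp only:)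
  also have "\<dots> = (\<Sum>\<tau>\<in>proper_target_maps n. LINT x|lborel. weight_factor n * ?W \<tau> * ?G \<tau> x)"
    by (intro Bochner_Integration.integral_sum integrable_mult_right Bochner_Integration.integrable_sum integrable_vertex_factors)
  also have "\<dots> = (\<Sum>\<tau>\<in>proper_target_maps n. weight_factor n * (?W \<tau> * graph_integral n \<tau> \<pi> [f, g, h]))"
    by (simp add: graph_integral_def mult.assoc)
  also have "\<dots> = (\<Sum>\<tau>\<in>target_maps n. weight_factor n * (?W \<tau> * graph_integral n \<tau> \<pi> [f, g, h]))"
  proof (rule sum.mono_neutral_left)
    show "finite (target_maps n)" by (intro finite_PiE) auto
    show "proper_target_maps n \<subseteq> target_maps n" by (auto simp: proper_target_maps_def)
    show "\<forall>\<tau>\<in>target_maps n - proper_target_maps n. weight_factor n * (?W \<tau> * graph_integral n \<tau> \<pi> [f, g, h]) = 0"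
    proof
      fix \<tau> assume "\<tau> \<in> target_maps n - proper_target_maps n"
      then consider (infinity) e where "e \<in> set (star_edges n)" "\<tau> e = SecondType 2"
        | (loop) e where "e \<in> set (star_edges n)" "\<tau> e = FirstType (fst e)"
        | (double) k where "k < n" "\<tau> (k, 0) = \<tau> (k, 1)"
        by (auto simp: proper_target_maps_def)
      then show "weight_factor n * (?W \<tau> * graph_integral n \<tau> \<pi> [f, g, h]) = 0"
      proof cases
        case infinity
        have "(\<lambda>_. 0) \<in> set (map (\<lambda>e. graph_row n \<tau> e y) (star_edges n))" for y
          using infinity by (auto simp: angle_row_def intro!: image_eqI[of _ _ e])
        then have "?W \<tau> = 0" unfolding configuration_integral_def configuration_form_def
          by (simp only: wedge_covectors_zero mult_zero_right Bochner_Integration.integral_zero)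
        then show ?thesis by simp
      next
        case loop
        then have "graph_integral n \<tau> \<pi> [f, g, h] = 0"
          using graph_integral_loop[OF div, of "fst e" "snd e" n \<tau>] by simp
        then show ?thesis by simp
      next
        case double
        have "(k, 0) \<in> set (star_edges n)" "(k, 1) \<in> set (star_edges n)" using double by (auto simp: set_star_edges)
        then obtain i j where ij: "i < length (star_edges n)" "j < length (star_edges n)" "star_edges n ! i = (k, 0)" "star_edges n ! j = (k, 1)"
          by (metis in_set_conv_nth)
        then have "wedge_covectors (map (\<lambda>e. graph_row n \<tau> e y) (star_edges n)) js = 0" for y js
          using double by (intro wedge_covectors_repeated[of i _ j]) auto
        then have "?W \<tau> = 0" unfolding configuration_integral_def configuration_form_def by simp
        then show ?thesis by simp
      qed
    qed
  qed
  finally show ?thesis by (simp add: sum_distrib_left)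
qed

section \<open>Cyclicity\<close>

theorem mainTheorem2:
  fixes \<pi> \<Omega> :: "('d::{finite,linorder}) tensor_field"
    and f g h :: "real^('d::{finite,linorder}) \<Rightarrow> real"
  assumes "poisson_bivector \<pi>"
    and "volume_form \<Omega>"
    and "constant_form \<Omega>"
    and "divergence 2 \<Omega> \<pi> = (\<lambda>x I. 0)"
    and "smooth f" "compactly_supported f"
    and "smooth g" "compactly_supported g"
    and "smooth h" "compactly_supported h"
  shows "integral_against (\<lambda>x. kontsevich_star \<pi> f g x * fps_const (h x)) \<Omega>
       = integral_against (\<lambda>x. kontsevich_star \<pi> g h x * fps_const (f x)) \<Omega>"
proof (rule fps_ext)
  fix n
  have \<pi>: "multivector_field 2 \<pi>" using assms(1) by (simp add: poisson_bivector_def)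
  have div: "(\<Sum>b\<in>UNIV. partial b (\<lambda>y. \<pi> y [a, b]) x) = 0" for a x
    by (rule divergence_zero_imp[OF \<pi> assms(2-4)])
  let ?L = "sorted_list_of_set (UNIV :: 'd set)"
  define c where "c = \<Omega> 0 ?L"
  have \<Omega>: "\<Omega> x ?L = c" for x using assms(3) unfolding c_def by (metis constant_form_def)
  have coeff: "fps_nth (integral_against (\<lambda>x. kontsevich_star \<pi> u v x * fps_const (w x)) \<Omega>) n
      = (LINT x|lborel. fps_nth (kontsevich_star \<pi> u v x) n * w x) * c" for u v w :: "real^('d::{finite,linorder}) \<Rightarrow> real"
    unfolding integral_against_def integral_top_form_def \<Omega> by simp
  show "fps_nth (integral_against (\<lambda>x. kontsevich_star \<pi> f g x * fps_const (h x)) \<Omega>) n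
      = fps_nth (integral_against (\<lambda>x. kontsevich_star \<pi> g h x * fps_const (f x)) \<Omega>) n"
  proof (cases "n = 0")
    case True
    then show ?thesis unfolding coeff by (simp add: kontsevich_star_def mult_ac)
  next
    case False
    then have n: "n \<ge> 1" by simp
    have star: "(LINT x|lborel. fps_nth (kontsevich_star \<pi> u v x) n * w x)
        = (LINT x|lborel. formality_component n (replicate n \<pi>) [u, v] x * w x) / fact n" for u v w :: "real^('d::{finite,linorder}) \<Rightarrow> real"
      using False by (simp add: kontsevich_star_def)
    show ?thesis unfolding coeff star
      using integral_formality_component[OF n \<pi> div, of f g h] integral_formality_component[OF n \<pi> div, of g h f]
        cyclic_sum_over_graphs[OF n \<pi> div, of f g h] assms(5-10)
      by simp
  qed
qed

end
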